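(* Let $X$ be a finite set with conductances $C$ and nonzero killing measure $\kappa$ (transient case), let $G$ be the associated Green function, $\mu^{x,y}$ the associated bridge measures, $\widehat{\mathcal L}_{\frac12}$ the occupation field of the Poissonian loop ensemble of intensity $\frac12\mu$, and let $\phi=(\phi^x)_{x\in X}$ be the Gaussian free field, i.e. the centered Gaussian vector with covariance $\mathbb E_\phi(\phi^x\phi^y)=G^{x,y}$. Then: (a) The fields $\widehat{\mathcal L}_{\frac12}=(\widehat{\mathcal L}_{\frac12}^x)_{x\in X}$ and $\frac12\phi^2=(\frac12(\phi^x)^2)_{x\in X}$ have the same distribution. (b) For all $x,y\in X$ and any bounded (measurable) functional $F$ of a non-negative field, i.e. $F:\mathbb R_+^X\to\mathbb R$, $$\mathbb E_\phi\big(\phi^x\phi^y F(\tfrac12\phi^2)\big)=\int \mathbb E\big(F(\widehat{\mathcal L}_{\frac12}+\widehat\gamma)\big)\,\mu^{x,y}(d\gamma).$$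
   Context: Setting. $X$ is a finite set; $C_{x,y}=C_{y,x}\ge 0$ ($x\ne y$) are conductances (with $C_{x,x}=0$) such that the graph with edges $\{x,y\}$, $C_{x,y}>0$, is connected; $\kappa:X\to[0,\infty)$ is not identically zero. Put $\lambda_x=\kappa_x+\sum_y C_{x,y}$, $P^x_y=C_{x,y}/\lambda_x$, $P_t=\exp(t(P-I))$. The (sub)Markov chain $(x_t)$ with semigroup $P_t$ has exponential holding times of parameter $1$ and is killed at a jump from $x$ with probability $\kappa_x/\lambda_x$; $\mathbb P_x$ is its law started at $x$. The Green function is $G=(M_\lambda-C)^{-1}$, where $M_\lambda$ is the diagonal matrix with entries $\lambda_x$. Bridge measures. For measurable sets $A$ of piecewise constant paths on $[0,t]$, $\mathbb P_t^{x,y}(A)=\frac1{\lambda_y}\mathbb P_x(A\cap\{x_t=y\})$, and $\mu^{x,y}=\int_0^\infty\mathbb P_t^{x,y}\,dt$ (a measure on finite-duration paths from $x$ to $y$). Loop measure and loop ensembles. $\mu=\sum_{x\in X}\int_0^\infty\frac1t\mathbb P_t^{x,x}\lambda_x\,dt$, a $\sigma$-finite measure on based loops (piecewise constant paths of duration $T(l)=t$ with the same start and end point). For $\alpha>0$, $\mathcal L_\alpha$ is a Poisson point process of loops with intensity $\alpha\mu$; $\mathbb E$ is the corresponding expectation. Occupation fields. For a loop or path $l$ of duration $T(l)$, $\widehat l^{\,x}=\frac1{\lambda_x}\int_0^{T(l)}1_{\{l(s)=x\}}ds$; and $\widehat{\mathcal L}_\alpha^{x}=\sum_{l\in\mathcal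 L_\alpha}\widehat l^{\,x}$. *)

theory Defs
  imports "HOL-Probability.Probability"
begin

section \<open>Conductances and Green function\<close>

definition total_rate :: "('x::finite \<Rightarrow> 'x \<Rightarrow> real) \<Rightarrow> ('x \<Rightarrow> real) \<Rightarrow> 'x \<Rightarrow> real" where
  "total_rate C \<kappa> x = \<kappa> x + (\<Sum>y\<in>UNIV. C x y)"

definition green :: "('x::finite \<Rightarrow> 'x \<Rightarrow> real) \<Rightarrow> ('x \<Rightarrow> real) \<Rightarrow> real^'x^'x" where
  "green C \<kappa> =
     matrix_inv ((\<chi> x y. if x = y then total_rate C \<kappa> x else 0) - (\<chi> x y. C x y))"


section \<open>The killed continuous-time chain\<close>

text \<open>One jump from \<open>x\<close>; \<open>None\<close> is the cemetery.\<close>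

definition jump_pmf ::
  "('x::finite \<Rightarrow> 'x \<Rightarrow> real) \<Rightarrow> ('x \<Rightarrow> real) \<Rightarrow> 'x \<Rightarrow> 'x option pmf" where
  "jump_pmf C \<kappa> x = embed_pmf (\<lambda>z. case z of
       None \<Rightarrow> \<kappa> x / total_rate C \<kappa> x
     | Some y \<Rightarrow> C x y / total_rate C \<kappa> x)"

text \<open>
  The chain is built on a product space that carries, independently, a jump instruction
  \<open>U (n, z)\<close> with law \<open>jump_pmf C \<kappa> z\<close> for every step \<open>n\<close> and every state \<open>z\<close>, and holding
  times \<open>\<tau> n\<close> that are exponential of parameter 1. The \<open>n\<close>-th jump obeys \<open>U (n, z)\<close>, where \<open>z\<close>
  is the current state. All starting points \<open>x\<close> share this space, so that the law of the chain
  started at \<open>x\<close> is the image of \<open>driving_space C \<kappa>\<close> under \<open>chain x\<close>.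
\<close>

type_synonym 'x driving = "(nat \<times> 'x \<Rightarrow> 'x option) \<times> (nat \<Rightarrow> real)"

definition driving_space ::
  "('x::finite \<Rightarrow> 'x \<Rightarrow> real) \<Rightarrow> ('x \<Rightarrow> real) \<Rightarrow> 'x driving measure" where
  "driving_space C \<kappa> =
     (PiM UNIV (\<lambda>(n, z). measure_pmf (jump_pmf C \<kappa> z))) \<Otimes>\<^sub>M
     (PiM UNIV (\<lambda>n. density lborel (exponential_density 1)))"

primrec skeleton :: "'x \<Rightarrow> (nat \<times> 'x \<Rightarrow> 'x option) \<Rightarrow> nat \<Rightarrow> 'x option" where
  "skeleton x U 0 = Some x"
| "skeleton x U (Suc n) = Option.bind (skeleton x U n) (\<lambda>z. U (n, z))"

definition chain :: "'x \<Rightarrow> 'x driving \<Rightarrow> real \<Rightarrow> 'x option" where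
  "chain x = (\<lambda>(U, \<tau>) t.
     if \<exists>n. t < (\<Sum>i\<le>n. \<tau> i) then skeleton x U (LEAST n. t < (\<Sum>i\<le>n. \<tau> i)) else None)"


section \<open>Paths of finite duration\<close>

text \<open>
  A path is a pair of its duration \<open>t\<close> and a function on \<open>{0..t}\<close>, extended by \<open>undefined\<close>. The
  condition on the finite set \<open>D\<close> of jump times says that the function is piecewise constant and
  right-continuous.
\<close>

type_synonym 'x path = "real \<times> (real \<Rightarrow> 'x)"

definition paths :: "'x path set" where
  "paths = {(t, l). 0 < t \<and> l \<in> extensional {0..t} \<and>
     (\<exists>D. finite D \<and>
        (\<forall>r\<in>{0..t}. \<forall>s\<in>{0..t}. r \<le> s \<and> {r<..s} \<inter> D = {} \<longrightarrow> l r = l s))}"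

text \<open>
  The \<open>\<sigma>\<close>-algebra is generated by the duration and the evaluations at fixed times. Evaluations
  are stopped at the duration, which makes the end point measurable as well.
\<close>

definition path_space :: "'x path measure" where
  "path_space = sigma paths
     ({{\<gamma>\<in>paths. fst \<gamma> \<le> a} | a. True} \<union>
      {{\<gamma>\<in>paths. snd \<gamma> (min s (fst \<gamma>)) = z} | s z. 0 \<le> s})"

definition loop_space :: "'x path measure" where
  "loop_space = restrict_space path_space {\<gamma>. snd \<gamma> 0 = snd \<gamma> (fst \<gamma>)}"

definition occupation ::
  "('x::finite \<Rightarrow> 'x \<Rightarrow> real) \<Rightarrow> ('x \<Rightarrow> real) \<Rightarrow> 'x path \<Rightarrow> real^'x" where
  "occupation C \<kappa> \<gamma> =
     (\<chi> x. 1 / total_rate C \<kappa> x * (LINT s:{0..fst \<gamma>}|lborel. indicator {x} (snd \<gamma> s)))"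


section \<open>Bridge measures and loop measure\<close>

text \<open>The value \<open>the None\<close> is irrelevant: a chain alive at time \<open>t\<close> is alive on all of \<open>{0..t}\<close>.\<close>

definition chain_path :: "'x \<Rightarrow> real \<Rightarrow> 'x driving \<Rightarrow> 'x path" where
  "chain_path x t \<omega> = (t, \<lambda>s\<in>{0..t}. the (chain x \<omega> s))"

definition bridge_at ::
  "('x::finite \<Rightarrow> 'x \<Rightarrow> real) \<Rightarrow> ('x \<Rightarrow> real) \<Rightarrow> real \<Rightarrow> 'x \<Rightarrow> 'x \<Rightarrow> 'x path measure" where
  "bridge_at C \<kappa> t x y = measure_of (space path_space) (sets path_space)
     (\<lambda>A. emeasure (driving_space C \<kappa>)
            {\<omega> \<in> space (driving_space C \<kappa>). chain_path x t \<omega> \<in> A \<and> chain x \<omega> t = Some y}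
          / ennreal (total_rate C \<kappa> y))"

definition bridge_measure ::
  "('x::finite \<Rightarrow> 'x \<Rightarrow> real) \<Rightarrow> ('x \<Rightarrow> real) \<Rightarrow> 'x \<Rightarrow> 'x \<Rightarrow> 'x path measure" where
  "bridge_measure C \<kappa> x y = measure_of (space path_space) (sets path_space)
     (\<lambda>A. \<integral>\<^sup>+t\<in>{0<..}. emeasure (bridge_at C \<kappa> t x y) A \<partial>lborel)"

definition loop_measure ::
  "('x::finite \<Rightarrow> 'x \<Rightarrow> real) \<Rightarrow> ('x \<Rightarrow> real) \<Rightarrow> 'x path measure" where
  "loop_measure C \<kappa> = measure_of (space loop_space) (sets loop_space)
     (\<lambda>A. \<Sum>x\<in>UNIV. \<integral>\<^sup>+t\<in>{0<..}.
        ennreal (1 / t) * emeasure (bridge_at C \<kappa> t x x) A * ennreal (total_rate C \<kappa> x) \<partial>lborel)"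


section \<open>Poisson point processes\<close>

text \<open>
  A point process is represented by its random counting measure \<open>N\<close>: \<open>emeasure (N \<omega>) A\<close> is the
  number of points in \<open>A\<close>, and the sum of \<open>f\<close> over the points is \<open>\<integral>\<^sup>+l. f l \<partial>N \<omega>\<close>.
\<close>

definition poisson_point_process ::
  "'w measure \<Rightarrow> 'l measure \<Rightarrow> ('w \<Rightarrow> 'l measure) \<Rightarrow> bool" where
  "poisson_point_process M \<nu> N \<longleftrightarrow>
     prob_space M \<and>
     (\<forall>\<omega>\<in>space M. sets (N \<omega>) = sets \<nu> \<and>
        (\<forall>A\<in>sets \<nu>. emeasure (N \<omega>) A \<in> insert \<infinity> (range of_nat))) \<and>
     (\<forall>A\<in>sets \<nu>. (\<lambda>\<omega>. emeasure (N \<omega>) A) \<in> borel_measurable M) \<and>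
     (\<forall>A\<in>sets \<nu>. emeasure \<nu> A = \<infinity> \<longrightarrow> (AE \<omega> in M. emeasure (N \<omega>) A = \<infinity>)) \<and>
     (\<forall>A\<in>sets \<nu>. emeasure \<nu> A \<noteq> \<infinity> \<longrightarrow> (\<forall>k::nat.
        measure M {\<omega>\<in>space M. emeasure (N \<omega>) A = of_nat k}
          = measure \<nu> A ^ k / fact k * exp (- measure \<nu> A))) \<and>
     (\<forall>\<A>. finite \<A> \<and> \<A> \<subseteq> sets \<nu> \<and> disjoint \<A> \<longrightarrow>
        prob_space.indep_vars M (\<lambda>_. borel) (\<lambda>A \<omega>. emeasure (N \<omega>) A) \<A>)"

definition ensemble_occupation ::
  "('x::finite \<Rightarrow> 'x \<Rightarrow> real) \<Rightarrow> ('x \<Rightarrow> real) \<Rightarrow> 'x path measure \<Rightarrow> real^'x" where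
  "ensemble_occupation C \<kappa> L =
     (\<chi> x. enn2real (\<integral>\<^sup>+l. ennreal (occupation C \<kappa> l $ x) \<partial>L))"


section \<open>Gaussian vectors\<close>

definition gaussian_rv :: "'p measure \<Rightarrow> ('p \<Rightarrow> real) \<Rightarrow> bool" where
  "gaussian_rv M Y \<longleftrightarrow> Y \<in> borel_measurable M \<and>
     ((\<exists>m. AE \<omega> in M. Y \<omega> = m) \<or>
      (\<exists>m \<sigma>. 0 < \<sigma> \<and> distributed M lborel Y (normal_density m \<sigma>)))"

definition centered_gaussian_vector ::
  "'p measure \<Rightarrow> real^'x^'x \<Rightarrow> ('p \<Rightarrow> real^'x::finite) \<Rightarrow> bool" where
  "centered_gaussian_vector M K \<phi> \<longleftrightarrow>
     prob_space M \<and>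
     (\<forall>a. gaussian_rv M (\<lambda>\<omega>. a \<bullet> \<phi> \<omega>)) \<and>
     (\<forall>x. (LINT \<omega>|M. \<phi> \<omega> $ x) = 0) \<and>
     (\<forall>x y. (LINT \<omega>|M. \<phi> \<omega> $ x * \<phi> \<omega> $ y) = K $ x $ y)"

definition half_square :: "real^'x \<Rightarrow> real^'x::finite" where
  "half_square v = (\<chi> x. (v $ x)\<^sup>2 / 2)"

definition nonneg_fields :: "(real^'x::finite) set" where
  "nonneg_fields = {v. \<forall>x. 0 \<le> v $ x}"

end

theory Submission
  imports Defs
begin

text \<open>
  Both sides of each identity are compared through Laplace transforms, which determine (signed)
  laws of nonnegative fields by Stone--Weierstrass. Let \<open>W q\<close> be the inverse of
  \<open>M\<^sub>\<lambda> + M\<^sub>q - C\<close> for a potential \<open>q \<ge> 0\<close>, so that \<open>W 0\<close> is the Green function.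

  Expanding the chain according to its number of jumps gives a Neumann series, whence
  \<open>\<integral> exp (- \<langle>q, \<gamma>\<rangle>) \<mu>\<^sup>x\<^sup>y(d\<gamma>) = W q x y\<close>. For the loop measure, \<open>1 / t\<close> is written as
  \<open>\<integral> exp (- p t) dp\<close>; with the resolvent identity this yields
  \<open>\<integral> (1 - exp (- \<langle>q, l\<rangle>)) \<mu>(dl) = \<integral> (\<Sum>z. q z * W (s q) z z) ds\<close> over \<open>0 \<le> s \<le> 1\<close>. On the Gaussian
  side, integration by parts gives \<open>E (\<phi>\<^sup>x \<phi>\<^sup>y exp (- \<langle>q, \<phi>\<^sup>2\<rangle> / 2)) = W q x y * g q\<close> with
  \<open>g q = E exp (- \<langle>q, \<phi>\<^sup>2\<rangle> / 2)\<close>, so the logarithmic derivative of \<open>s \<mapsto> g (s q)\<close> is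
  \<open>- (\<Sum>z. q z * W (s q) z z) / 2\<close>. Hence the loop integral is \<open>- 2 ln (g q)\<close>, and Campbell's formula for
  the intensity \<open>\<mu> / 2\<close> turns it into \<open>E exp (- \<langle>q, L\<rangle>) = g q\<close>. No determinant is needed.
\<close>

section \<open>Uniqueness of Laplace transforms\<close>

text \<open>The loop measure has infinite mass, and \<open>ensemble_occupation\<close> turns an
  infinite local time into 0, so almost sure finiteness of the loop field has to be proved.
  Campbell's formula is therefore established with values in [0, \<infinity>], and letting q tend to
  0 in the resulting Laplace transform shows that no probability sits at infinity. Signed laws are
  unavoidable because the weight \<open>\<phi> \<omega> $ x * \<phi> \<omega> $ y\<close> of the
  second identity changes sign. The factor exp (- p t) can be absorbed because the duration of a
  path is the sum of \<open>lam x\<close> times its occupation at x: damping by duration is itself a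
  potential, namely \<open>p * lam x\<close>. The intensity 1/2 is matched by the 1/2 in the squared
  field, which is the factor in the logarithmic derivative of g. Bridge and loop measures are given
  by bare set functions through \<open>measure_of\<close>. Each has to be recognised as a weighted
  image of time and driving randomness before anything can be integrated against it, while
  \<open>chain_path\<close> yields a path only where the chain is still alive.\<close>

lemma borel_measurable_vecI:
  fixes f :: "'a \<Rightarrow> real^'x::finite"
  assumes "\<And>x. (\<lambda>\<omega>. f \<omega> $ x) \<in> borel_measurable M"
  shows "f \<in> borel_measurable M"
  using assms by (subst borel_measurable_euclidean_space) (auto simp: Basis_vec_def inner_axis)

definition field_exp :: "('x::finite \<Rightarrow> real) \<Rightarrow> real^'x \<Rightarrow> real" where
  "field_exp q z = exp (- (\<Sum>x\<in>UNIV. q x * z $ x))"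

lemma measurable_field_exp[measurable]: "field_exp q \<in> borel_measurable borel"
  unfolding field_exp_def by measurable

lemma field_exp_pos: "0 < field_exp q z"
  by (simp add: field_exp_def)

lemma field_exp_le_1: "(\<And>x. 0 \<le> q x) \<Longrightarrow> z \<in> nonneg_fields \<Longrightarrow> field_exp q z \<le> 1"
  by (auto simp: field_exp_def nonneg_fields_def intro!: sum_nonneg)

lemma field_exp_add: "field_exp q (y + z) = field_exp q y * field_exp q z"
  by (simp add: field_exp_def algebra_simps sum.distrib exp_add[symmetric])

lemma field_exp_add_left: "field_exp (\<lambda>x. p x + q x) z = field_exp p z * field_exp q z"
  by (simp add: field_exp_def algebra_simps sum.distrib exp_add[symmetric])

text \<open>Functions of \<open>z\<close> are viewed as functions of \<open>u = (exp (- z $ x))\<^sub>x\<close>, which lives in a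
  compact box; there the \<open>field_exp q\<close> with integral \<open>q\<close> are the monomials, and Stone--Weierstrass
  applies.\<close>

lemma bounded_linear_real_cart:
  fixes f :: "real^'x::finite \<Rightarrow> real"
  assumes "bounded_linear f"
  shows "f u = (\<Sum>x\<in>UNIV. f (axis x 1) * u $ x)"
proof -
  have "f u = f (\<Sum>x\<in>UNIV. u $ x *\<^sub>R axis x 1)"
    using basis_expansion[of u] unfolding scalar_mult_eq_scaleR by (rule arg_cong[OF sym])
  also have "\<dots> = (\<Sum>x\<in>UNIV. f (u $ x *\<^sub>R axis x 1))"
    by (rule linear_sum[OF bounded_linear.linear[OF assms]])
  also have "\<dots> = (\<Sum>x\<in>UNIV. f (axis x 1) * u $ x)"
    by (intro sum.cong refl, subst linear_scale[OF bounded_linear.linear[OF assms]]) simp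
  finally show ?thesis .
qed

lemma sum_mem_of_add_closed:
  fixes \<D> :: "('a \<Rightarrow> real) set"
  assumes "(\<lambda>_. 0) \<in> \<D>" and "\<And>f g. f \<in> \<D> \<Longrightarrow> g \<in> \<D> \<Longrightarrow> (\<lambda>z. f z + g z) \<in> \<D>"
    and "finite I" and "\<And>i. i \<in> I \<Longrightarrow> f i \<in> \<D>"
  shows "(\<lambda>z. \<Sum>i\<in>I. f i z) \<in> \<D>"
  using assms(3,4) by (induction I rule: finite_induct) (simp_all add: assms(1,2))

text \<open>A monotone class argument, kept abstract in \<open>\<D>\<close>. Bounds and limits are
  demanded on \<open>nonneg_fields\<close> only, since the exponentials are unbounded elsewhere. The
  class grows from polynomials in u to continuous functions of u, to indicators of lower orthants,
  to Borel sets, and to bounded Borel functions.\<close>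

lemma laplace_class_contains_bounded:
  fixes \<D> :: "(real^'x::finite \<Rightarrow> real) set"
  assumes exps: "\<And>q. (\<And>x. 0 \<le> q x) \<Longrightarrow> field_exp q \<in> \<D>"
    and add: "\<And>f g. f \<in> \<D> \<Longrightarrow> g \<in> \<D> \<Longrightarrow> (\<lambda>z. f z + g z) \<in> \<D>"
    and scale: "\<And>f c. f \<in> \<D> \<Longrightarrow> (\<lambda>z. c * f z) \<in> \<D>"
    and lim: "\<And>(f::nat \<Rightarrow> real^'x \<Rightarrow> real) g B. (\<And>n. f n \<in> \<D>) \<Longrightarrow> (\<And>n. f n \<in> borel_measurable borel) \<Longrightarrow>
       (\<And>n z. z \<in> nonneg_fields \<Longrightarrow> \<bar>f n z\<bar> \<le> B) \<Longrightarrow>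
       (\<And>z. z \<in> nonneg_fields \<Longrightarrow> (\<lambda>n. f n z) \<longlonglongrightarrow> g z) \<Longrightarrow> g \<in> borel_measurable borel \<Longrightarrow> g \<in> \<D>"
    and F: "F \<in> borel_measurable borel" "\<And>z. \<bar>F z\<bar> \<le> B"
  shows "F \<in> \<D>"
proof -
  have one: "(\<lambda>_. 1) \<in> \<D>"
    using exps[of "\<lambda>_. 0"] by (simp add: field_exp_def[abs_def])
  have zero: "(\<lambda>_. 0) \<in> \<D>" using scale[OF one, of 0] by simp
  note sum_in = sum_mem_of_add_closed[OF zero add]

  define T :: "real^'x \<Rightarrow> real^'x" where "T z = (\<chi> x. exp (- z $ x))" for z
  have T[measurable]: "T \<in> borel_measurable borel"
  proof (rule borel_measurable_vecI)
    have "(\<lambda>z::real^'x. exp (- z $ x)) \<in> borel_measurable borel" for x by measurable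
    then show "(\<lambda>z. T z $ x) \<in> borel_measurable borel" for x unfolding T_def vec_lambda_beta .
  qed
  have T_box: "T z \<in> cbox 0 1" if "z \<in> nonneg_fields" for z
    using that by (auto simp: T_def nonneg_fields_def mem_box_cart)

  \<comment> \<open>The spare factor \<open>field_exp q\<close> makes the class stable under
    multiplication by a coordinate: each coordinate of \<open>T z\<close> is itself a
    \<open>field_exp\<close>, so it only shifts q. Closure of \<open>\<D>\<close> under products is
    never assumed.\<close>
  define \<A> where "\<A> = {h. \<forall>q. (\<forall>x. 0 \<le> q x) \<longrightarrow> (\<lambda>z. h (T z) * field_exp q z) \<in> \<D>}"
  have \<A>_add: "(\<lambda>u. f u + g u) \<in> \<A>" if "f \<in> \<A>" "g \<in> \<A>" for f g
    using that unfolding \<A>_def by (auto simp: distrib_right intro!: add)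
  have "(\<lambda>_. 0) \<in> \<A>" by (simp add: \<A>_def zero)
  note \<A>_sum = sum_mem_of_add_closed[OF this \<A>_add]
  have \<A>_scale: "(\<lambda>z. c * f z) \<in> \<A>" if "f \<in> \<A>" for f c
    using that unfolding \<A>_def by (auto simp: mult.assoc intro!: scale)
  have \<A>_coord: "(\<lambda>u. u $ x * h u) \<in> \<A>" if "h \<in> \<A>" for h x
    unfolding \<A>_def
  proof (safe)
    fix q :: "'x \<Rightarrow> real" assume q: "\<forall>x. 0 \<le> q x"
    define d :: "'x \<Rightarrow> real" where "d y = (if y = x then 1 else 0)" for y
    have "T z $ x = field_exp d z" for z
      by (simp add: T_def field_exp_def d_def if_distrib[of "\<lambda>t. t * _"] cong: if_cong)
    then have "(\<lambda>z. T z $ x * h (T z) * field_exp q z) = (\<lambda>z. h (T z) * field_exp (\<lambda>y. d y + q y) z)"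
      by (simp add: field_exp_add_left mult_ac)
    moreover have "(\<lambda>z. h (T z) * field_exp (\<lambda>y. d y + q y) z) \<in> \<D>"
      using that q unfolding \<A>_def by (auto simp: d_def)
    ultimately show "(\<lambda>z. T z $ x * h (T z) * field_exp q z) \<in> \<D>" by simp
  qed
  \<comment> \<open>Carrying an arbitrary factor h through the induction settles products: the two
    hypotheses are applied one after the other.\<close>
  have poly: "(\<lambda>u. p u * h u) \<in> \<A>" if "real_polynomial_function p" "h \<in> \<A>" for p h
    using that
  proof (induction arbitrary: h rule: real_polynomial_function.induct)
    case (linear f)
    have "(\<lambda>u. f u * h u) = (\<lambda>u. \<Sum>x\<in>UNIV. f (axis x 1) * (u $ x * h u))"
      by (subst bounded_linear_real_cart[OF linear(1)]) (simp add: sum_distrib_right mult.assoc)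
    then show ?case using linear(2) by (simp only: ) (intro \<A>_sum \<A>_scale \<A>_coord finite)
  next
    case (const c) then show ?case by (rule \<A>_scale)
  next
    case (add f g)
    have "(\<lambda>u. f u * h u + g u * h u) \<in> \<A>"
      by (rule \<A>_add[OF add.IH[OF add.prems]])
    then show ?case by (simp add: distrib_right)
  next
    case (mult f g)
    from mult.IH(1)[OF mult.IH(2)[OF mult.prems]] show ?case by (simp add: mult.assoc)
  qed
  have one_A: "(\<lambda>_. 1) \<in> \<A>" by (auto simp: \<A>_def exps)
  have poly_in: "(\<lambda>z. p (T z)) \<in> \<D>" if "real_polynomial_function p" for p
  proof -
    have "(\<lambda>z. p (T z) * 1 * field_exp (\<lambda>_. 0) z) \<in> \<D>"
      using poly[OF that one_A] unfolding \<A>_def by (auto dest!: spec[of _ "\<lambda>_. 0"])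
    then show ?thesis by (simp add: field_exp_def)
  qed

  have cont_in: "(\<lambda>z. f (T z)) \<in> \<D>" if f: "continuous_on UNIV f" for f
  proof -
    have cf: "continuous_on (cbox 0 1) f" by (rule continuous_on_subset[OF f subset_UNIV])
    have "\<exists>p. real_polynomial_function p \<and> (\<forall>u\<in>cbox 0 1. \<bar>f u - p u\<bar> < 1 / real (Suc n))" for n
      by (rule Stone_Weierstrass_real_polynomial_function[OF compact_cbox cf, of "1 / real (Suc n)"]) auto
    then obtain p where p: "\<And>n. real_polynomial_function (p n)"
      and pf: "\<And>n u. u \<in> cbox 0 1 \<Longrightarrow> \<bar>f u - p n u\<bar> < 1 / real (Suc n)" by metis
    have "bounded (f ` cbox 0 1)"
      by (rule compact_imp_bounded[OF compact_continuous_image[OF cf compact_cbox]])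
    then obtain B where B: "\<And>u. u \<in> cbox 0 1 \<Longrightarrow> \<bar>f u\<bar> \<le> B" by (auto simp: bounded_iff)
    show ?thesis
    proof (rule lim)
      show "(\<lambda>z. p n (T z)) \<in> \<D>" for n by (rule poly_in[OF p])
      have [measurable]: "p n \<in> borel_measurable borel" for n
        by (intro borel_measurable_continuous_onI continuous_on_polymonial_function
            p[unfolded real_polynomial_function_eq])
      show "(\<lambda>z. p n (T z)) \<in> borel_measurable borel" for n by measurable
      have [measurable]: "f \<in> borel_measurable borel" using f by (rule borel_measurable_continuous_onI)
      show "(\<lambda>z. f (T z)) \<in> borel_measurable borel" by measurable
      show "\<bar>p n (T z)\<bar> \<le> B + 1" if "z \<in> nonneg_fields" for n z
      proof -
        have "1 / real (Suc n) \<le> 1" by simp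
        then show ?thesis using B[OF T_box[OF that]] pf[OF T_box[OF that], of n] by linarith
      qed
      show "(\<lambda>n. p n (T z)) \<longlonglongrightarrow> f (T z)" if "z \<in> nonneg_fields" for z
      proof -
        have "(\<lambda>n. p n (T z) - f (T z)) \<longlonglongrightarrow> 0"
          by (rule Lim_null_comparison[OF _ LIMSEQ_inverse_real_of_nat])
             (use pf[OF T_box[OF that]] in \<open>auto simp: abs_minus_commute inverse_eq_divide intro!: always_eventually less_imp_le\<close>)
        then show ?thesis by (simp add: LIM_zero_iff)
      qed
    qed
  qed

  have atMost_in: "indicator {..a} \<in> \<D>" for a :: "real^'x"
  proof (rule lim)
    \<comment> \<open>A product of ramps in u: each factor is 1 where \<open>u $ x\<close> is at
      least \<open>exp (- a $ x)\<close> and falls to 0 with slope n below. The map T reverses the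
      order, so the limit is the indicator of z \<le> a.\<close>
    let ?f = "\<lambda>n u. \<Prod>x\<in>UNIV. max 0 (1 - real n * max 0 (exp (- a $ x) - u $ x))"
    have c: "continuous_on UNIV (?f n)" for n by (intro continuous_intros)
    show "(\<lambda>z. ?f n (T z)) \<in> \<D>" for n by (rule cont_in[OF c])
    show "(\<lambda>z. ?f n (T z)) \<in> borel_measurable borel" for n
      by (rule measurable_compose[OF T borel_measurable_continuous_onI[OF c]])
    show "indicator {..a} \<in> borel_measurable (borel :: (real^'x) measure)" by simp
    show "\<bar>?f n (T z)\<bar> \<le> 1" for n z
      by (auto intro!: prod_le_1 simp: abs_prod)
    show "(\<lambda>n. ?f n (T z)) \<longlonglongrightarrow> indicator {..a} z" for z
    proof -
      have coord: "(\<lambda>n. max 0 (1 - real n * max 0 (exp (- a $ x) - T z $ x)))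
          \<longlonglongrightarrow> (if z $ x \<le> a $ x then 1 else 0)" for x
      proof (cases "z $ x \<le> a $ x")
        case True then show ?thesis by (simp add: T_def)
      next
        case False
        define d where "d = exp (- a $ x) - T z $ x"
        have d: "0 < d" using False by (simp add: d_def T_def)
        obtain N where N: "1 < real N * d" using reals_Archimedean3[OF d] by auto
        have "max 0 (1 - real n * max 0 d) = 0" if "n \<ge> N" for n
        proof -
          have "real N * d \<le> real n * d" using that d by (intro mult_right_mono) auto
          then have "1 - real n * d \<le> 0" using N by linarith
          then show ?thesis using d by simp
        qed
        then have "(\<lambda>n. max 0 (1 - real n * max 0 d)) \<longlonglongrightarrow> 0"
          by (intro tendsto_eventually eventually_sequentiallyI[of N])
        then show ?thesis using False by (simp add: d_def)
      qed
      have "(\<Prod>x\<in>UNIV. if z $ x \<le> a $ x then 1 else 0 :: real) = indicator {..a} z"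
        by (auto simp: less_eq_vec_def indicator_def)
      moreover have "(\<lambda>n. ?f n (T z)) \<longlonglongrightarrow> (\<Prod>x\<in>UNIV. if z $ x \<le> a $ x then 1 else 0)"
        by (rule tendsto_prod) (rule coord)
      ultimately show ?thesis by simp
    qed
  qed

  have borel_in: "indicator A \<in> \<D>" if "A \<in> sets borel" for A
  proof -
    \<comment> \<open>Lower orthants generate the Borel sets and are stable under intersection, so
      the pi-lambda theorem applies; \<open>lim\<close> handles countable disjoint unions.\<close>
    let ?G = "range (\<lambda>a::real^'x. {..a})"
    have "Int_stable ?G"
    proof (unfold Int_stable_def, safe)
      fix a b :: "real^'x"
      have "{..a} \<inter> {..b} = {..(\<chi> x. min (a $ x) (b $ x))}"
        by (auto simp: less_eq_vec_def)
      then show "{..a} \<inter> {..b} \<in> ?G" by auto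
    qed
    moreover have "?G \<subseteq> Pow UNIV" by simp
    moreover have "A \<in> sigma_sets UNIV ?G"
      using that by (simp add: borel_eq_atMost)
    ultimately show ?thesis
    proof (induction rule: sigma_sets_induct_disjoint)
      case (basic A) then show ?case using atMost_in by auto
    next
      case empty then show ?case using zero by (simp add: indicator_def[abs_def])
    next
      case (compl A)
      have "(\<lambda>z. 1 + -1 * indicator A z) \<in> \<D>"
        by (intro add[OF one] scale compl)
      also have "(\<lambda>z. 1 + -1 * indicator A z :: real) = indicator (UNIV - A)"
        by (rule ext) (simp split: split_indicator)
      finally show ?case .
    next
      case (union A)
      have A: "A i \<in> sets borel" for i
        using union(2) by (auto simp: borel_eq_atMost)
      show ?case
      proof (rule lim)
        show "(\<lambda>z. \<Sum>i<n. indicator (A i) z) \<in> \<D>" for n by (intro sum_in union) auto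
        show "(\<lambda>z. \<Sum>i<n. indicator (A i) z :: real) \<in> borel_measurable borel" for n by (intro borel_measurable_sum borel_measurable_indicator A)
        show "indicator (\<Union>i. A i) \<in> borel_measurable borel" using A by (intro borel_measurable_indicator) auto
        have s: "(\<lambda>i. indicator (A i) z :: real) sums indicator (\<Union>i. A i) z" for z
          by (rule indicator_sums[OF disjoint_family_onD[OF union(1)]]) auto
        then show "(\<lambda>n. \<Sum>i<n. indicator (A i) z :: real) \<longlonglongrightarrow> indicator (\<Union>i. A i) z" for z
          by (simp add: sums_def)
        have "(\<Sum>i<n. indicator (A i) z :: real) \<le> indicator (\<Union>i. A i) z" for n z
          using s[of z] by (intro sum_le_suminf[OF sums_summable, OF s[of z], folded sums_unique[OF s[of z]]]) auto
        then show "\<bar>\<Sum>i<n. indicator (A i) z :: real\<bar> \<le> 1" for n z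
          using order_trans[of "\<Sum>i<n. indicator (A i) z :: real" "indicator (\<Union>i. A i) z" 1]
          by (auto simp: sum_nonneg indicator_le_1)
      qed
    qed
  qed

  show ?thesis
  proof (rule lim[OF _ _ _ _ F(1)])
    \<comment> \<open>F rounded down to multiples of 1/(n+1). As F is bounded, only finitely many
      values occur, so this is a finite combination of indicators.\<close>
    let ?f = "\<lambda>n z. of_int \<lfloor>real (Suc n) * F z\<rfloor> / real (Suc n)"
    show "?f n \<in> \<D>" for n
    proof -
      define K where "K = \<lceil>real (Suc n) * B\<rceil> + 1"
      have fl: "\<lfloor>real (Suc n) * F z\<rfloor> \<in> {-K..K}" for z
      proof -
        have "\<bar>real (Suc n) * F z\<bar> \<le> real (Suc n) * B" using F(2)[of z] by (simp add: abs_mult)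
        then show ?thesis unfolding K_def atLeastAtMost_iff by linarith
      qed
      have "(\<lambda>z. \<Sum>k\<in>{-K..K}. (of_int k / real (Suc n)) * indicator {z. \<lfloor>real (Suc n) * F z\<rfloor> = k} z) \<in> \<D>"
      proof (intro sum_in scale borel_in)
        fix k
        have "{z \<in> space borel. \<lfloor>real (Suc n) * F z\<rfloor> = k} \<in> sets borel"
          using F(1) by measurable
        then show "{z. \<lfloor>real (Suc n) * F z\<rfloor> = k} \<in> sets borel" by simp
      qed auto
      also have "(\<lambda>z. \<Sum>k\<in>{-K..K}. (of_int k / real (Suc n)) * indicator {z. \<lfloor>real (Suc n) * F z\<rfloor> = k} z) = ?f n"
      proof
        fix z
        have "(\<Sum>k\<in>{-K..K}. (of_int k / real (Suc n)) * indicator {z. \<lfloor>real (Suc n) * F z\<rfloor> = k} z)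
          = (\<Sum>k\<in>{-K..K}. if k = \<lfloor>real (Suc n) * F z\<rfloor> then of_int k / real (Suc n) else 0)"
          by (intro sum.cong) auto
        also have "\<dots> = ?f n z" using fl[of z] by (simp del: of_nat_Suc)
        finally show "(\<Sum>k\<in>{-K..K}. (of_int k / real (Suc n)) * indicator {z. \<lfloor>real (Suc n) * F z\<rfloor> = k} z) = ?f n z" .
      qed
      finally show ?thesis .
    qed
    show "?f n \<in> borel_measurable borel" for n using F(1) by measurable
    have close: "\<bar>?f n z - F z\<bar> \<le> inverse (real (Suc n))" for n z
    proof -
      have "\<bar>of_int \<lfloor>real (Suc n) * F z\<rfloor> - real (Suc n) * F z\<bar> \<le> 1" by linarith
      then have "\<bar>of_int \<lfloor>real (Suc n) * F z\<rfloor> - real (Suc n) * F z\<bar> / real (Suc n) \<le> 1 / real (Suc n)"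
        by (intro divide_right_mono) auto
      moreover have "\<bar>?f n z - F z\<bar> = \<bar>of_int \<lfloor>real (Suc n) * F z\<rfloor> - real (Suc n) * F z\<bar> / real (Suc n)"
        by (subst abs_div_pos) (auto simp: diff_divide_distrib simp del: of_nat_Suc)
      ultimately show ?thesis by (simp add: inverse_eq_divide)
    qed
    show "\<bar>?f n z\<bar> \<le> B + 1" for n z
    proof -
      have "inverse (real (Suc n)) \<le> 1" by (simp add: inverse_eq_divide)
      then show ?thesis using close[of n z] F(2)[of z] by linarith
    qed
    show "(\<lambda>n. ?f n z) \<longlonglongrightarrow> F z" for z
    proof -
      have "(\<lambda>n. ?f n z - F z) \<longlonglongrightarrow> 0"
        by (rule Lim_null_comparison[OF _ LIMSEQ_inverse_real_of_nat])
           (use close in \<open>auto intro!: always_eventually\<close>)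
      then show ?thesis by (simp add: LIM_zero_iff)
    qed
  qed
qed

section \<open>Equality of Laplace transforms implies equality of signed laws\<close>

lemma integrable_mult_bounded_field:
  fixes Z :: "'a \<Rightarrow> real^'x::finite"
  assumes w: "integrable M w" and Z[measurable]: "Z \<in> borel_measurable M"
    and f[measurable]: "f \<in> borel_measurable borel"
    and B: "\<And>z. z \<in> nonneg_fields \<Longrightarrow> \<bar>f z\<bar> \<le> B"
    and n: "\<And>\<omega>. \<omega> \<in> space M \<Longrightarrow> Z \<omega> \<in> nonneg_fields"
  shows "integrable M (\<lambda>\<omega>. w \<omega> * f (Z \<omega>) :: real)"
proof (rule Bochner_Integration.integrable_bound)
  note [measurable] = borel_measurable_integrable[OF w]
  show "integrable M (\<lambda>\<omega>. \<bar>B\<bar> * \<bar>w \<omega>\<bar>)" using w by simp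
  show "(\<lambda>\<omega>. w \<omega> * f (Z \<omega>)) \<in> borel_measurable M" by measurable
  show "AE \<omega> in M. norm (w \<omega> * f (Z \<omega>)) \<le> norm (\<bar>B\<bar> * \<bar>w \<omega>\<bar>)"
  proof (rule AE_I2)
    fix \<omega> assume "\<omega> \<in> space M"
    then have "\<bar>f (Z \<omega>)\<bar> \<le> \<bar>B\<bar>" using B[OF n] by fastforce
    then have "\<bar>f (Z \<omega>)\<bar> * \<bar>w \<omega>\<bar> \<le> \<bar>B\<bar> * \<bar>w \<omega>\<bar>" by (intro mult_right_mono) auto
    then show "norm (w \<omega> * f (Z \<omega>)) \<le> norm (\<bar>B\<bar> * \<bar>w \<omega>\<bar>)" by (simp add: abs_mult mult.commute)
  qed
qed

lemma tendsto_integral_bounded_field: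
  fixes Z :: "'a \<Rightarrow> real^'x::finite" and f :: "nat \<Rightarrow> real^'x \<Rightarrow> real"
  assumes w: "integrable M w" and Z[measurable]: "Z \<in> borel_measurable M"
    and f[measurable]: "\<And>n. f n \<in> borel_measurable borel" and g[measurable]: "g \<in> borel_measurable borel"
    and B: "\<And>n z. z \<in> nonneg_fields \<Longrightarrow> \<bar>f n z\<bar> \<le> B"
    and lim: "\<And>z. z \<in> nonneg_fields \<Longrightarrow> (\<lambda>n. f n z) \<longlonglongrightarrow> g z"
    and n: "\<And>\<omega>. \<omega> \<in> space M \<Longrightarrow> Z \<omega> \<in> nonneg_fields"
  shows "(\<lambda>n. LINT \<omega>|M. w \<omega> * f n (Z \<omega>)) \<longlonglongrightarrow> (LINT \<omega>|M. w \<omega> * g (Z \<omega>))"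
proof (rule integral_dominated_convergence[where w = "\<lambda>\<omega>. \<bar>w \<omega>\<bar> * B"])
  note [measurable] = borel_measurable_integrable[OF w]
  show "(\<lambda>\<omega>. w \<omega> * g (Z \<omega>)) \<in> borel_measurable M" "\<And>i. (\<lambda>\<omega>. w \<omega> * f i (Z \<omega>)) \<in> borel_measurable M"
    by measurable
  show "integrable M (\<lambda>\<omega>. \<bar>w \<omega>\<bar> * B)" using w by simp
  show "AE \<omega> in M. (\<lambda>i. w \<omega> * f i (Z \<omega>)) \<longlonglongrightarrow> w \<omega> * g (Z \<omega>)"
    by (intro AE_I2 tendsto_intros lim n)
  show "AE \<omega> in M. norm (w \<omega> * f i (Z \<omega>)) \<le> \<bar>w \<omega>\<bar> * B" for i
    by (intro AE_I2) (auto simp: abs_mult intro!: mult_left_mono B n)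
qed

text \<open>The weights may take both signs, so this compares signed laws living on possibly
  different spaces. Equality of distributions uses weights 1; the bridge identity uses a product of
  two field coordinates on one side and 1 on the other.\<close>

lemma laplace_uniqueness:
  fixes Z\<^sub>1 :: "'a \<Rightarrow> real^'x::finite" and Z\<^sub>2 :: "'b \<Rightarrow> real^'x"
  assumes Z\<^sub>1[measurable]: "Z\<^sub>1 \<in> borel_measurable M\<^sub>1" and Z\<^sub>2[measurable]: "Z\<^sub>2 \<in> borel_measurable M\<^sub>2"
    and w: "integrable M\<^sub>1 w\<^sub>1" "integrable M\<^sub>2 w\<^sub>2"
    and nonneg: "\<And>\<omega>. \<omega> \<in> space M\<^sub>1 \<Longrightarrow> Z\<^sub>1 \<omega> \<in> nonneg_fields" "\<And>\<omega>. \<omega> \<in> space M\<^sub>2 \<Longrightarrow> Z\<^sub>2 \<omega> \<in> nonneg_fields"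
    and laplace: "\<And>q. (\<And>x. 0 \<le> q x) \<Longrightarrow>
        (LINT \<omega>|M\<^sub>1. w\<^sub>1 \<omega> * field_exp q (Z\<^sub>1 \<omega>)) = (LINT \<omega>|M\<^sub>2. w\<^sub>2 \<omega> * field_exp q (Z\<^sub>2 \<omega>))"
    and F: "F \<in> borel_measurable borel" "\<And>z. \<bar>F z\<bar> \<le> B"
  shows "(LINT \<omega>|M\<^sub>1. w\<^sub>1 \<omega> * F (Z\<^sub>1 \<omega>)) = (LINT \<omega>|M\<^sub>2. w\<^sub>2 \<omega> * F (Z\<^sub>2 \<omega>))"
proof -
  \<comment> \<open>Measurability and boundedness are part of the class because additivity of the
    integral needs integrable summands.\<close>
  define \<D> where "\<D> = {f \<in> borel_measurable borel. (\<exists>B. \<forall>z\<in>nonneg_fields. \<bar>f z\<bar> \<le> B) \<and>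
    (LINT \<omega>|M\<^sub>1. w\<^sub>1 \<omega> * f (Z\<^sub>1 \<omega>)) = (LINT \<omega>|M\<^sub>2. w\<^sub>2 \<omega> * f (Z\<^sub>2 \<omega>))}"
  note [measurable] = borel_measurable_integrable[OF w(1)] borel_measurable_integrable[OF w(2)]
  have "F \<in> \<D>"
  proof (rule laplace_class_contains_bounded[OF _ _ _ _ F])
    fix q :: "'x \<Rightarrow> real" assume "\<And>x. 0 \<le> q x"
    then show "field_exp q \<in> \<D>"
      using field_exp_le_1[of q] field_exp_pos[of q]
      by (auto simp: \<D>_def laplace less_imp_le intro!: exI[of _ 1])
  next
    fix f g assume fg: "f \<in> \<D>" "g \<in> \<D>"
    then obtain B C where B: "\<And>z. z \<in> nonneg_fields \<Longrightarrow> \<bar>f z\<bar> \<le> B" and C: "\<And>z. z \<in> nonneg_fields \<Longrightarrow> \<bar>g z\<bar> \<le> C"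
      by (auto simp: \<D>_def)
    have m[measurable]: "f \<in> borel_measurable borel" "g \<in> borel_measurable borel" using fg by (auto simp: \<D>_def)
    have "\<bar>f z + g z\<bar> \<le> B + C" if "z \<in> nonneg_fields" for z using B[OF that] C[OF that] by linarith
    then show "(\<lambda>z. f z + g z) \<in> \<D>"
      using fg integrable_mult_bounded_field[OF w(1) Z\<^sub>1 m(1) B nonneg(1)] integrable_mult_bounded_field[OF w(2) Z\<^sub>2 m(1) B nonneg(2)]
         integrable_mult_bounded_field[OF w(1) Z\<^sub>1 m(2) C nonneg(1)] integrable_mult_bounded_field[OF w(2) Z\<^sub>2 m(2) C nonneg(2)]
      by (auto simp: \<D>_def distrib_left)
  next
    fix f :: "real^'x \<Rightarrow> real" and c :: real assume f: "f \<in> \<D>"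
    then obtain B where B: "\<And>z. z \<in> nonneg_fields \<Longrightarrow> \<bar>f z\<bar> \<le> B"
      by (auto simp: \<D>_def)
    have m[measurable]: "f \<in> borel_measurable borel" using f by (auto simp: \<D>_def)
    have "\<bar>c * f z\<bar> \<le> \<bar>c\<bar> * B" if "z \<in> nonneg_fields" for z
      using B[OF that] by (simp add: abs_mult mult_left_mono)
    then show "(\<lambda>z. c * f z) \<in> \<D>"
      using f by (auto simp: \<D>_def mult.left_commute[of _ c])
  next
    fix f :: "nat \<Rightarrow> real^'x \<Rightarrow> real" and g B
    assume f: "\<And>n. f n \<in> \<D>" and m[measurable]: "\<And>n. f n \<in> borel_measurable borel"
      and B: "\<And>n z. z \<in> nonneg_fields \<Longrightarrow> \<bar>f n z\<bar> \<le> B"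
      and lim: "\<And>z. z \<in> nonneg_fields \<Longrightarrow> (\<lambda>n. f n z) \<longlonglongrightarrow> g z" and g[measurable]: "g \<in> borel_measurable borel"
    have gB: "\<bar>g z\<bar> \<le> B" if "z \<in> nonneg_fields" for z
      by (rule LIMSEQ_le_const2[OF tendsto_rabs[OF lim[OF that]]]) (use B that in auto)
    have eq: "(LINT \<omega>|M\<^sub>1. w\<^sub>1 \<omega> * f n (Z\<^sub>1 \<omega>)) = (LINT \<omega>|M\<^sub>2. w\<^sub>2 \<omega> * f n (Z\<^sub>2 \<omega>))" for n
      using f by (simp add: \<D>_def)
    have "(LINT \<omega>|M\<^sub>1. w\<^sub>1 \<omega> * g (Z\<^sub>1 \<omega>)) = (LINT \<omega>|M\<^sub>2. w\<^sub>2 \<omega> * g (Z\<^sub>2 \<omega>))"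
      by (rule LIMSEQ_unique[OF tendsto_integral_bounded_field[OF w(1) Z\<^sub>1 m g B lim nonneg(1)]
            tendsto_integral_bounded_field[OF w(2) Z\<^sub>2 m g B lim nonneg(2), folded eq]])
    then show "g \<in> \<D>" using gB by (auto simp: \<D>_def)
  qed
  then show ?thesis by (simp add: \<D>_def)
qed

section \<open>Laplace functional of a Poisson point process\<close>

text \<open>The continuous extension of a \<mapsto> exp (- a) to [0, \<infinity>]. With it,
  Campbell's formula covers fields that might be infinite.\<close>

definition nexp :: "ennreal \<Rightarrow> ennreal" where
  "nexp a = (if a = \<top> then 0 else ennreal (exp (- enn2real a)))"

lemma nexp_ennreal: "0 \<le> a \<Longrightarrow> nexp (ennreal a) = ennreal (exp (- a))"
  by (simp add: nexp_def)

lemma nexp_top[simp]: "nexp \<top> = 0"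
  by (simp add: nexp_def)

lemma nexp_0[simp]: "nexp 0 = 1"
  by (simp add: nexp_def)

lemma nexp_le_1: "nexp a \<le> 1"
  by (simp add: nexp_def)

lemma nexp_neq_top[simp]: "nexp a \<noteq> \<top>"
  by (simp add: nexp_def)

lemma nexp_antimono: "a \<le> b \<Longrightarrow> nexp b \<le> nexp a"
  by (cases a; cases b) (auto simp: nexp_def top_unique)

lemma nexp_add: "nexp (a + b) = nexp a * nexp b"
  by (cases a; cases b) (auto simp: nexp_def ennreal_mult[symmetric] exp_add[symmetric] ennreal_plus[symmetric] simp del: ennreal_plus)

lemma nexp_sum: "finite I \<Longrightarrow> nexp (\<Sum>i\<in>I. f i) = (\<Prod>i\<in>I. nexp (f i))"
  by (induction I rule: finite_induct) (simp_all add: nexp_add)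

lemma tendsto_nexp:
  assumes "(f \<longlongrightarrow> a) F"
  shows "((\<lambda>x. nexp (f x)) \<longlongrightarrow> nexp a) F"
proof (cases a)
  case (real r)
  have "((\<lambda>x. ennreal (exp (- enn2real (f x)))) \<longlongrightarrow> ennreal (exp (- r))) F"
    using assms real by (intro tendsto_ennrealI tendsto_intros tendsto_enn2real) auto
  moreover have "\<forall>\<^sub>F x in F. f x < \<top>"
    using order_tendstoD(2)[OF assms, of \<top>] real by simp
  then have "\<forall>\<^sub>F x in F. ennreal (exp (- enn2real (f x))) = nexp (f x)"
    by eventually_elim (simp add: nexp_def)
  ultimately have "((\<lambda>x. nexp (f x)) \<longlongrightarrow> ennreal (exp (- r))) F"
    by (rule Lim_transform_eventually)
  moreover have "nexp a = ennreal (exp (- r))" using real by (simp add: nexp_def)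
  ultimately show ?thesis by simp
next
  case top
  show ?thesis
  proof (rule order_tendstoI)
    fix e assume e: "nexp a < e"
    obtain K where K: "0 \<le> K" "ennreal (exp (- K)) < e"
    proof (cases e)
      case (real r)
      then have r: "0 < r" using e top by (simp add: ennreal_less_zero_iff)
      \<comment> \<open>This K gives exp (- K) \<le> r / e < r; the maximum with 0 keeps K
        nonnegative.\<close>
      show ?thesis
      proof (rule that[of "max 0 (1 - ln r)"])
        have "exp (- max 0 (1 - ln r)) \<le> exp (ln r - 1)" by simp
        also have "\<dots> < r" using r by (simp add: exp_diff divide_less_eq)
        finally show "ennreal (exp (- max 0 (1 - ln r))) < e" using real by (simp add: ennreal_less_iff)
      qed simp
    next
      case top then show ?thesis by (intro that[of 0]) auto
    qed
    have "\<forall>\<^sub>F x in F. ennreal K < f x"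
      using order_tendstoD(1)[OF assms, of "ennreal K"] top by simp
    then show "\<forall>\<^sub>F x in F. nexp (f x) < e"
    proof eventually_elim
      case (elim x)
      then have "nexp (f x) \<le> nexp (ennreal K)" by (intro nexp_antimono) simp
      then show ?case using K by (simp add: nexp_ennreal)
    qed
  qed (simp add: top)
qed

lemma measurable_nexp[measurable]: "nexp \<in> borel_measurable borel"
proof -
  have "(\<lambda>a. if a \<in> {\<top>} then 0 else ennreal (exp (- enn2real a))) \<in> borel_measurable borel"
    by measurable
  then show ?thesis by (simp add: nexp_def[abs_def])
qed

text \<open>With h the identity this evaluates the sum of f over the points; with
  \<open>h v = 1 - nexp v\<close> it evaluates the exponent in Campbell's formula over the same
  level sets.\<close>

lemma nn_integral_compose_simple_function:
  assumes f: "simple_function M f"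
  shows "(\<integral>\<^sup>+x. h (f x) \<partial>M) = (\<Sum>v\<in>f ` space M. h v * emeasure M (f -` {v} \<inter> space M))"
proof -
  note fin = simple_functionD(1)[OF f] and meas = simple_functionD(2)[OF f]
  have "(\<integral>\<^sup>+x. h (f x) \<partial>M) = (\<integral>\<^sup>+x. (\<Sum>v\<in>f ` space M. h v * indicator (f -` {v} \<inter> space M) x) \<partial>M)"
  proof (rule nn_integral_cong)
    fix x assume x: "x \<in> space M"
    have "(\<Sum>v\<in>f ` space M. h v * indicator (f -` {v} \<inter> space M) x) = (\<Sum>v\<in>f ` space M. if v = f x then h v else 0)"
      using x by (intro sum.cong) (auto split: split_indicator)
    then show "h (f x) = (\<Sum>v\<in>f ` space M. h v * indicator (f -` {v} \<inter> space M) x)"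
      using x fin by simp
  qed
  also have "\<dots> = (\<Sum>v\<in>f ` space M. h v * emeasure M (f -` {v} \<inter> space M))"
    using meas by (subst nn_integral_sum) (auto simp: nn_integral_cmult_indicator)
  finally show ?thesis .
qed

section \<open>Campbell's formula: one set, simple functions, measurable functions\<close>

context
  fixes M :: "'w measure" and \<nu> :: "'l measure" and N :: "'w \<Rightarrow> 'l measure"
  assumes ppp: "poisson_point_process M \<nu> N"
begin

lemma ppp_prob: "prob_space M"
  using ppp by (simp add: poisson_point_process_def)

lemma ppp_sets: "\<omega> \<in> space M \<Longrightarrow> sets (N \<omega>) = sets \<nu>"
  using ppp by (simp add: poisson_point_process_def)

lemma ppp_space: "\<omega> \<in> space M \<Longrightarrow> space (N \<omega>) = space \<nu>"
  using ppp_sets by (rule sets_eq_imp_space_eq)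

lemma ppp_count_measurable[measurable]: "A \<in> sets \<nu> \<Longrightarrow> (\<lambda>\<omega>. emeasure (N \<omega>) A) \<in> borel_measurable M"
  using ppp by (simp add: poisson_point_process_def)

lemma ppp_indep:
  "finite \<A> \<Longrightarrow> \<A> \<subseteq> sets \<nu> \<Longrightarrow> disjoint \<A> \<Longrightarrow>
    prob_space.indep_vars M (\<lambda>_. borel) (\<lambda>A \<omega>. emeasure (N \<omega>) A) \<A>"
  using ppp by (simp add: poisson_point_process_def)

text \<open>The generating function of a Poisson variable of mean m at exp (- a) is exp (- (1 - exp
  (- a)) m). If the intensity is infinite, the count is almost surely infinite and both sides vanish
  when a > 0.\<close>

lemma poisson_laplace_set:
  assumes A: "A \<in> sets \<nu>" and v: "v < \<top>"
  shows "(\<integral>\<^sup>+\<omega>. nexp (v * emeasure (N \<omega>) A) \<partial>M) = nexp ((1 - nexp v) * emeasure \<nu> A)"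
proof -
  interpret prob_space M by (rule ppp_prob)
  obtain a where a: "v = ennreal a" "0 \<le> a" using v by (cases v) auto
  show ?thesis
  \<comment> \<open>At a = 0 both sides are 1, also for infinite intensity, because 0 times
    \<infinity> is 0 here; from then on a > 0 can be used.\<close>
  proof (cases "a = 0")
    case True then show ?thesis by (simp add: a emeasure_space_1)
  next
    case False
    then have pos: "0 < a" using a by simp
    have one_minus: "1 - nexp v = ennreal (1 - exp (- a))"
    proof -
      have "1 - nexp v = ennreal 1 - ennreal (exp (- a))"
        by (simp only: a(1) nexp_ennreal[OF a(2)] ennreal_1)
      then show ?thesis by (simp only: ennreal_minus exp_ge_zero)
    qed
    show ?thesis
    proof (cases "emeasure \<nu> A = \<infinity>")
      case True
      then have "AE \<omega> in M. emeasure (N \<omega>) A = \<infinity>"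
        using ppp A by (simp add: poisson_point_process_def)
      then have "AE \<omega> in M. nexp (v * emeasure (N \<omega>) A) = 0"
      proof eventually_elim
        case (elim \<omega>)
        then show ?case using pos by (simp add: a ennreal_mult_top)
      qed
      then have "(\<integral>\<^sup>+\<omega>. nexp (v * emeasure (N \<omega>) A) \<partial>M) = 0"
        by (subst nn_integral_0_iff_AE) (use A in measurable)
      moreover have "(1 - nexp v) * emeasure \<nu> A = \<top>"
        using True pos by (simp add: one_minus ennreal_mult_top)
      ultimately show ?thesis by simp
    next
      case False
      define m where "m = measure \<nu> A"
      have m: "emeasure \<nu> A = ennreal m" "0 \<le> m"
        using False by (simp_all add: m_def emeasure_eq_ennreal_measure)
      let ?B = "\<lambda>k::nat. {\<omega> \<in> space M. emeasure (N \<omega>) A = of_nat k}"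
      have B: "?B k \<in> sets M" for k using A by measurable
      have PB: "measure M (?B k) = m ^ k / fact k * exp (- m)" for k
        using ppp A False by (simp add: poisson_point_process_def m_def)
      \<comment> \<open>Expansion over the value k of the count. Outcomes with infinite count lie in
        no \<open>?B k\<close>, and there the left side is 0 as well because a > 0.\<close>
      have "(\<integral>\<^sup>+\<omega>. nexp (v * emeasure (N \<omega>) A) \<partial>M) = (\<integral>\<^sup>+\<omega>. (\<Sum>k. ennreal (exp (- a * real k)) * indicator (?B k) \<omega>) \<partial>M)"
      proof (rule nn_integral_cong)
        fix \<omega> assume \<omega>: "\<omega> \<in> space M"
        have "emeasure (N \<omega>) A \<in> insert \<infinity> (range of_nat)"
          using ppp A \<omega> by (simp add: poisson_point_process_def)
        then consider "emeasure (N \<omega>) A = \<top>" | k :: nat where "emeasure (N \<omega>) A = of_nat k" by auto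
        then show "nexp (v * emeasure (N \<omega>) A) = (\<Sum>k. ennreal (exp (- a * real k)) * indicator (?B k) \<omega>)"
        proof cases
          case 1
          have "v * emeasure (N \<omega>) A = \<top>" using pos by (simp add: 1 a(1) ennreal_mult_top)
          moreover have "indicator (?B k) \<omega> = (0 :: ennreal)" for k by (simp add: 1 indicator_def)
          ultimately show ?thesis by (simp only: nexp_top mult_zero_right suminf_zero)
        next
          case (2 k)
          have "indicator (?B j) \<omega> = (0 :: ennreal)" if "j \<noteq> k" for j
            using that by (simp add: indicator_def 2)
          then have "(\<Sum>j. ennreal (exp (- a * real j)) * indicator (?B j) \<omega>) = (\<Sum>j\<in>{k}. ennreal (exp (- a * real j)) * indicator (?B j) \<omega>)"
            by (intro suminf_finite) simp_all
          also have "\<dots> = ennreal (exp (- a * real k))" using \<omega> 2 by simp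
          also have "\<dots> = nexp (v * emeasure (N \<omega>) A)"
          proof -
            have "v * emeasure (N \<omega>) A = ennreal (a * real k)"
              unfolding a(1) 2 ennreal_of_nat_eq_real_of_nat using a(2)
              by (simp only: ennreal_mult of_nat_0_le_iff)
            moreover have "0 \<le> a * real k" using a(2) by simp
            ultimately show ?thesis by (simp only: nexp_ennreal mult_minus_left)
          qed
          finally show ?thesis by simp
        qed
      qed
      also have "\<dots> = (\<Sum>k. ennreal (exp (- a * real k)) * emeasure M (?B k))"
        using B by (subst nn_integral_suminf) (simp_all add: nn_integral_cmult_indicator)
      also have "\<dots> = (\<Sum>k. ennreal (exp (- m) * ((m * exp (- a)) ^ k /\<^sub>R fact k)))"
      proof (rule suminf_cong)
        fix k
        have "exp (- a * real k) = exp (- a) ^ k" by (simp add: exp_of_nat_mult[symmetric] mult.commute)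
        then show "ennreal (exp (- a * real k)) * emeasure M (?B k) = ennreal (exp (- m) * ((m * exp (- a)) ^ k /\<^sub>R fact k))"
        proof -
          have "exp (- a * real k) * (m ^ k / fact k * exp (- m)) = exp (- m) * ((m * exp (- a)) ^ k /\<^sub>R fact k)"
            unfolding \<open>exp (- a * real k) = exp (- a) ^ k\<close> real_scaleR_def power_mult_distrib divide_inverse
            by (simp only: mult_ac)
          then show ?thesis
            unfolding emeasure_eq_measure PB using m(2) by (subst ennreal_mult[symmetric]) simp_all
        qed
      qed
      also have "\<dots> = ennreal (exp (- m) * exp (m * exp (- a)))"
      proof (rule suminf_ennreal_eq)
        show "(\<lambda>k. exp (- m) * ((m * exp (- a)) ^ k /\<^sub>R fact k)) sums (exp (- m) * exp (m * exp (- a)))"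
          by (intro sums_mult exp_converges)
      qed (use m in simp)
      also have "exp (- m) * exp (m * exp (- a)) = exp (- ((1 - exp (- a)) * m))"
        unfolding exp_add[symmetric] left_diff_distrib mult_1 by (simp only: minus_diff_eq mult.commute[of m] add.commute[of "- m"] uminus_add_conv_diff)
      also have "ennreal (exp (- ((1 - exp (- a)) * m))) = nexp (ennreal ((1 - exp (- a)) * m))"
        by (rule nexp_ennreal[symmetric], rule mult_nonneg_nonneg) (use pos m(2) in auto)
      also have "ennreal ((1 - exp (- a)) * m) = (1 - nexp v) * emeasure \<nu> A"
        unfolding one_minus m(1) by (rule ennreal_mult) (use pos m(2) in auto)
      finally show ?thesis .
    qed
  qed
qed

text \<open>The counts on the disjoint level sets of f are independent, so the expectation of the
  product factors into the case of single sets.\<close>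

lemma poisson_laplace_simple:
  assumes f: "simple_function \<nu> f" and fin: "\<And>l. f l < \<top>"
  shows "(\<integral>\<^sup>+\<omega>. nexp (\<integral>\<^sup>+l. f l \<partial>N \<omega>) \<partial>M) = nexp (\<integral>\<^sup>+l. (1 - nexp (f l)) \<partial>\<nu>)"
proof -
  interpret prob_space M by (rule ppp_prob)
  let ?V = "f ` space \<nu>"
  define A where "A v = f -` {v} \<inter> space \<nu>" for v
  have V: "finite ?V" using simple_functionD(1)[OF f] .
  have A: "A v \<in> sets \<nu>" for v using simple_functionD(2)[OF f] by (simp add: A_def)
  have inj: "inj_on A ?V" by (auto simp: inj_on_def A_def)
  \<comment> \<open>Independence is available for a family indexed by the sets themselves, so the
    value of f has to be recovered from its level set. Level sets of attained values are nonempty,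
    hence distinct.\<close>
  define val where "val = the_inv_into ?V A"
  have val: "val (A v) = v" if "v \<in> ?V" for v
    unfolding val_def using inj that by (rule the_inv_into_f_f)
  have int_N: "nexp (\<integral>\<^sup>+l. f l \<partial>N \<omega>) = (\<Prod>B\<in>A ` ?V. nexp (val B * emeasure (N \<omega>) B))" if \<omega>: "\<omega> \<in> space M" for \<omega>
  proof -
    have "simple_function (N \<omega>) f"
      using f ppp_sets[OF \<omega>] ppp_space[OF \<omega>] by (simp add: simple_function_def)
    then have "(\<integral>\<^sup>+l. f l \<partial>N \<omega>) = (\<Sum>v\<in>?V. v * emeasure (N \<omega>) (A v))"
      using nn_integral_compose_simple_function[of "N \<omega>" f "\<lambda>v. v"] by (simp add: ppp_space[OF \<omega>] A_def)
    then show ?thesis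
      using V by (simp add: nexp_sum prod.reindex[OF inj] val)
  qed
  have "indep_vars (\<lambda>_. borel) (\<lambda>B \<omega>. emeasure (N \<omega>) B) (A ` ?V)"
  proof (rule ppp_indep)
    show "disjoint (A ` ?V)" by (auto simp: disjoint_def A_def)
  qed (use V A in auto)
  then have "indep_vars (\<lambda>_. borel) (\<lambda>B \<omega>. nexp (val B * emeasure (N \<omega>) B)) (A ` ?V)"
    by (rule indep_vars_compose2[where Y = "\<lambda>B c. nexp (val B * c)"]) measurable
  from indep_vars_nn_integral[OF _ this] V
  have "(\<integral>\<^sup>+\<omega>. (\<Prod>B\<in>A ` ?V. nexp (val B * emeasure (N \<omega>) B)) \<partial>M)
     = (\<Prod>B\<in>A ` ?V. \<integral>\<^sup>+\<omega>. nexp (val B * emeasure (N \<omega>) B) \<partial>M)" by simp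
  also have "\<dots> = (\<Prod>v\<in>?V. nexp ((1 - nexp v) * emeasure \<nu> (A v)))"
    using fin A by (simp add: prod.reindex[OF inj] val) (intro prod.cong refl poisson_laplace_set, auto)
  also have "\<dots> = nexp (\<integral>\<^sup>+l. (1 - nexp (f l)) \<partial>\<nu>)"
    using nn_integral_compose_simple_function[OF f, of "\<lambda>v. 1 - nexp v"] V by (simp add: nexp_sum A_def)
  finally show ?thesis
    using int_N by (simp cong: nn_integral_cong)
qed

text \<open>The definition of a point process makes only the counts measurable; sums over points
  inherit this by induction on the integrand.\<close>

lemma measurable_ppp_nn_integral:
  assumes f: "f \<in> borel_measurable \<nu>"
  shows "(\<lambda>\<omega>. \<integral>\<^sup>+l. f l \<partial>N \<omega>) \<in> borel_measurable M"
  using f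
proof (induction rule: borel_measurable_induct)
  case (cong f g)
  have "(\<integral>\<^sup>+l. f l \<partial>N \<omega>) = (\<integral>\<^sup>+l. g l \<partial>N \<omega>)" if "\<omega> \<in> space M" for \<omega>
    using cong.hyps by (intro nn_integral_cong) (simp add: ppp_space[OF that])
  then show ?case using cong.IH cong.hyps by (simp cong: measurable_cong)
next
  case (set A)
  have "(\<integral>\<^sup>+l. indicator A l \<partial>N \<omega>) = emeasure (N \<omega>) A" if "\<omega> \<in> space M" for \<omega>
    using set by (intro nn_integral_indicator) (simp add: ppp_sets[OF that])
  then show ?case using ppp_count_measurable[OF set] by (simp cong: measurable_cong)
next
  case (mult u c)
  have "(\<integral>\<^sup>+l. c * u l \<partial>N \<omega>) = c * (\<integral>\<^sup>+l. u l \<partial>N \<omega>)" if "\<omega> \<in> space M" for \<omega>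
    using mult.hyps by (intro nn_integral_cmult) (simp cong: measurable_cong_sets[OF ppp_sets[OF that] refl])
  then show ?case using mult.IH by (simp cong: measurable_cong)
next
  case (add u v)
  have "(\<integral>\<^sup>+l. v l + u l \<partial>N \<omega>) = (\<integral>\<^sup>+l. v l \<partial>N \<omega>) + (\<integral>\<^sup>+l. u l \<partial>N \<omega>)" if "\<omega> \<in> space M" for \<omega>
    using add.hyps by (intro nn_integral_add) (simp_all cong: measurable_cong_sets[OF ppp_sets[OF that] refl])
  then show ?case using add.IH by (simp cong: measurable_cong)
next
  case (seq U)
  have "(\<integral>\<^sup>+l. (SUP i. U i) l \<partial>N \<omega>) = (SUP i. \<integral>\<^sup>+l. U i l \<partial>N \<omega>)" if "\<omega> \<in> space M" for \<omega>
    unfolding SUP_apply using seq.hyps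
    by (intro nn_integral_monotone_convergence_SUP) (simp_all cong: measurable_cong_sets[OF ppp_sets[OF that] refl])
  moreover have "(\<lambda>\<omega>. SUP i. \<integral>\<^sup>+l. U i l \<partial>N \<omega>) \<in> borel_measurable M"
    by (rule borel_measurable_SUP) (simp_all add: seq.IH)
  ultimately show ?case using seq.hyps by (simp cong: measurable_cong)
qed

text \<open>Simple functions increase to f. On the left the integrands are bounded by 1 and converge
  by continuity of \<open>nexp\<close>; on the right \<open>1 - nexp\<close> increases, so monotone
  convergence applies inside.\<close>

theorem poisson_laplace:
  assumes f: "f \<in> borel_measurable \<nu>"
  shows "(\<integral>\<^sup>+\<omega>. nexp (\<integral>\<^sup>+l. f l \<partial>N \<omega>) \<partial>M) = nexp (\<integral>\<^sup>+l. (1 - nexp (f l)) \<partial>\<nu>)"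
proof -
  interpret prob_space M by (rule ppp_prob)
  obtain F where F: "\<And>i. simple_function \<nu> (F i)" "incseq F" "\<And>i x. F i x < \<top>" "\<And>x. (SUP i. F i x) = f x"
    using borel_measurable_implies_simple_function_sequence'[OF f] by blast
  have Fm: "F i \<in> borel_measurable \<nu>" for i using F(1) by (rule borel_measurable_simple_function)
  have Flim: "(\<lambda>i. F i x) \<longlonglongrightarrow> f x" for x
    unfolding F(4)[symmetric] using F(2) by (intro LIMSEQ_SUP) (auto simp: incseq_def le_fun_def)
  have "(\<lambda>i. \<integral>\<^sup>+\<omega>. nexp (\<integral>\<^sup>+l. F i l \<partial>N \<omega>) \<partial>M) \<longlonglongrightarrow> (\<integral>\<^sup>+\<omega>. nexp (\<integral>\<^sup>+l. f l \<partial>N \<omega>) \<partial>M)"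
  proof (rule nn_integral_dominated_convergence[where w = "\<lambda>_. 1"])
    show "(\<lambda>\<omega>. nexp (\<integral>\<^sup>+l. F i l \<partial>N \<omega>)) \<in> borel_measurable M" for i
      using measurable_ppp_nn_integral[OF Fm] by measurable
    show "(\<lambda>\<omega>. nexp (\<integral>\<^sup>+l. f l \<partial>N \<omega>)) \<in> borel_measurable M"
      using measurable_ppp_nn_integral[OF f] by measurable
    show "AE \<omega> in M. (\<lambda>i. nexp (\<integral>\<^sup>+l. F i l \<partial>N \<omega>)) \<longlonglongrightarrow> nexp (\<integral>\<^sup>+l. f l \<partial>N \<omega>)"
    proof (rule AE_I2)
      fix \<omega> assume \<omega>: "\<omega> \<in> space M"
      have "(\<lambda>i. \<integral>\<^sup>+l. F i l \<partial>N \<omega>) \<longlonglongrightarrow> (\<integral>\<^sup>+l. f l \<partial>N \<omega>)"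
        using F(2) Flim Fm
        by (intro nn_integral_LIMSEQ) (simp_all cong: measurable_cong_sets[OF ppp_sets[OF \<omega>] refl])
      then show "(\<lambda>i. nexp (\<integral>\<^sup>+l. F i l \<partial>N \<omega>)) \<longlonglongrightarrow> nexp (\<integral>\<^sup>+l. f l \<partial>N \<omega>)"
        by (rule tendsto_nexp)
    qed
  qed (auto simp: nexp_le_1 emeasure_space_1)
  moreover have "(\<lambda>i. \<integral>\<^sup>+\<omega>. nexp (\<integral>\<^sup>+l. F i l \<partial>N \<omega>) \<partial>M) \<longlonglongrightarrow> nexp (\<integral>\<^sup>+l. (1 - nexp (f l)) \<partial>\<nu>)"
    unfolding poisson_laplace_simple[OF F(1,3)]
  proof (rule tendsto_nexp, rule nn_integral_LIMSEQ)
    show "incseq (\<lambda>i l. 1 - nexp (F i l))"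
      using F(2) by (auto simp: incseq_def le_fun_def intro!: ennreal_mono_minus nexp_antimono)
    show "(\<lambda>l. 1 - nexp (F i l)) \<in> borel_measurable \<nu>" for i using Fm[of i] by measurable
    show "(\<lambda>i. 1 - nexp (F i l)) \<longlonglongrightarrow> 1 - nexp (f l)" for l
      by (intro tendsto_diff_ennreal tendsto_nexp Flim tendsto_const) auto
  qed
  ultimately show ?thesis by (rule LIMSEQ_unique)
qed

end

section \<open>Resolvents of the network\<close>

definition potential_green ::
  "('x::finite \<Rightarrow> 'x \<Rightarrow> real) \<Rightarrow> ('x \<Rightarrow> real) \<Rightarrow> ('x \<Rightarrow> real) \<Rightarrow> 'x \<Rightarrow> 'x \<Rightarrow> real" where
  "potential_green C \<kappa> q x y =
     matrix_inv (\<chi> x y. (if x = y then total_rate C \<kappa> x + q x else 0) - C x y) $ x $ y"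

lemma green_eq_potential_green: "green C \<kappa> $ x $ y = potential_green C \<kappa> (\<lambda>_. 0) x y"
proof -
  have "(\<chi> x y. if x = y then total_rate C \<kappa> x else 0) - (\<chi> x y. C x y)
      = (\<chi> x y. (if x = y then total_rate C \<kappa> x + 0 else 0) - C x y)"
    by (simp add: vec_eq_iff)
  then show ?thesis
    unfolding green_def potential_green_def by simp
qed

lemma sum_indicator_mult:
  fixes f :: "'x::finite \<Rightarrow> real"
  shows "(\<Sum>w\<in>UNIV. (if x = w then 1 else 0) * f w) = f x"
    and "(\<Sum>w\<in>UNIV. f w * (if w = x then 1 else 0)) = f x"
  by (simp_all add: if_distrib[of "\<lambda>t. t * f _"] if_distrib[of "\<lambda>t. f _ * t"] cong: if_cong)

locale killed_network =
  fixes C :: "'x::finite \<Rightarrow> 'x \<Rightarrow> real" and \<kappa> :: "'x \<Rightarrow> real"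
  assumes C_sym: "\<And>x y. C x y = C y x"
    and C_nonneg: "\<And>x y. 0 \<le> C x y"
    and C_diag: "\<And>x. C x x = 0"
    and connected: "\<And>x y. (\<lambda>u v. 0 < C u v)\<^sup>*\<^sup>* x y"
    and \<kappa>_nonneg: "\<And>x. 0 \<le> \<kappa> x"
    and \<kappa>_nonzero: "\<exists>x. \<kappa> x \<noteq> 0"
begin

abbreviation lam :: "'x \<Rightarrow> real" where "lam \<equiv> total_rate C \<kappa>"
abbreviation W :: "('x \<Rightarrow> real) \<Rightarrow> 'x \<Rightarrow> 'x \<Rightarrow> real" where "W \<equiv> potential_green C \<kappa>"

section \<open>Energy form and positive definiteness\<close>

text \<open>Discrete Green formula: \<open>lam\<close> splits into killing and conductances, and the
  symmetry of C completes the mixed terms to squares of differences.\<close>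

lemma energy_identity:
  "(\<Sum>x\<in>UNIV. f x * (lam x * f x - (\<Sum>y\<in>UNIV. C x y * f y)))
    = (\<Sum>x\<in>UNIV. \<kappa> x * (f x)\<^sup>2) + (\<Sum>x\<in>UNIV. \<Sum>y\<in>UNIV. C x y * (f x - f y)\<^sup>2) / 2"
proof -
  have sw: "(\<Sum>x\<in>UNIV. \<Sum>y\<in>UNIV. C x y * (f y)\<^sup>2) = (\<Sum>x\<in>UNIV. \<Sum>y\<in>UNIV. C x y * (f x)\<^sup>2)"
    by (subst sum.swap) (simp add: C_sym)
  have "(\<Sum>x\<in>UNIV. \<Sum>y\<in>UNIV. C x y * (f x - f y)\<^sup>2)
     = (\<Sum>x\<in>UNIV. \<Sum>y\<in>UNIV. C x y * (f x)\<^sup>2) + (\<Sum>x\<in>UNIV. \<Sum>y\<in>UNIV. C x y * (f y)\<^sup>2)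
       - 2 * (\<Sum>x\<in>UNIV. \<Sum>y\<in>UNIV. C x y * f x * f y)"
    by (simp add: power2_diff sum.distrib[symmetric] sum_subtractf[symmetric] sum_distrib_left)
       (simp add: algebra_simps)
  also have "\<dots> = 2 * ((\<Sum>x\<in>UNIV. \<Sum>y\<in>UNIV. C x y * (f x)\<^sup>2) - (\<Sum>x\<in>UNIV. \<Sum>y\<in>UNIV. C x y * f x * f y))"
    by (simp add: sw)
  finally have "(\<Sum>x\<in>UNIV. \<Sum>y\<in>UNIV. C x y * (f x - f y)\<^sup>2) / 2
    = (\<Sum>x\<in>UNIV. \<Sum>y\<in>UNIV. C x y * (f x)\<^sup>2) - (\<Sum>x\<in>UNIV. \<Sum>y\<in>UNIV. C x y * f x * f y)" by simp
  moreover have "f x * (lam x * f x - (\<Sum>y\<in>UNIV. C x y * f y))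
    = \<kappa> x * (f x)\<^sup>2 + (\<Sum>y\<in>UNIV. C x y * (f x)\<^sup>2) - (\<Sum>y\<in>UNIV. C x y * f x * f y)" for x
    unfolding total_rate_def
    by (simp add: algebra_simps power2_eq_square sum_distrib_left sum_distrib_right)
  ultimately show ?thesis
    by (simp add: sum.distrib sum_subtractf)
qed

text \<open>Vanishing energy makes f constant along edges and zero at a point with killing;
  connectedness spreads the zero. The form with \<le> 0 also serves arguments that test with a
  truncated function.\<close>

lemma energy_pos_def:
  assumes "(\<Sum>x\<in>UNIV. f x * (lam x * f x - (\<Sum>y\<in>UNIV. C x y * f y))) \<le> 0"
  shows "f x = 0"
proof -
  have a: "0 \<le> (\<Sum>x\<in>UNIV. \<kappa> x * (f x)\<^sup>2)" "0 \<le> (\<Sum>x\<in>UNIV. \<Sum>y\<in>UNIV. C x y * (f x - f y)\<^sup>2)"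
    by (auto intro!: sum_nonneg mult_nonneg_nonneg \<kappa>_nonneg C_nonneg)
  then have z: "(\<Sum>x\<in>UNIV. \<kappa> x * (f x)\<^sup>2) = 0" "(\<Sum>x\<in>UNIV. \<Sum>y\<in>UNIV. C x y * (f x - f y)\<^sup>2) = 0"
    using assms unfolding energy_identity by auto
  have 1: "\<kappa> x * (f x)\<^sup>2 = 0" for x
    using z(1) by (subst (asm) sum_nonneg_eq_0_iff) (auto intro!: mult_nonneg_nonneg \<kappa>_nonneg)
  have 2: "C x y * (f x - f y)\<^sup>2 = 0" for x y
    using z(2)
    by (subst (asm) sum_nonneg_eq_0_iff)
       (auto intro!: sum_nonneg mult_nonneg_nonneg C_nonneg simp: sum_nonneg_eq_0_iff C_nonneg)
  have edge: "0 < C x y \<Longrightarrow> f x = f y" for x y using 2[of x y] by auto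
  obtain x0 where "\<kappa> x0 \<noteq> 0" using \<kappa>_nonzero by auto
  then have "f x0 = 0" using 1[of x0] by auto
  moreover have "f x = f x0" using connected[of x x0]
    by (induction rule: rtranclp_induct) (auto dest: edge)
  ultimately show ?thesis by simp
qed

text \<open>The energy of a point mass at x is \<open>lam x\<close>, since \<open>C x x = 0\<close>;
  were it not positive, the point mass would vanish.\<close>

lemma lam_pos: "0 < lam x"
proof (rule ccontr)
  assume "\<not> 0 < lam x"
  then have "(if x = x then 1 else 0 :: real) = 0"
    by (intro energy_pos_def[where f = "\<lambda>y. if y = x then 1 else 0"])
       (simp add: C_diag if_distrib[of "\<lambda>t. _ * t"] if_distrib[of "\<lambda>t. t * _"] cong: if_cong)
  then show False by simp
qed

lemma perturbed_energy_pos_def: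
  assumes q: "\<And>x. 0 \<le> q x"
    and le: "(\<Sum>x\<in>UNIV. f x * ((lam x + q x) * f x - (\<Sum>y\<in>UNIV. C x y * f y))) \<le> 0"
  shows "f x = 0"
proof (rule energy_pos_def)
  have "(\<Sum>x\<in>UNIV. f x * (lam x * f x - (\<Sum>y\<in>UNIV. C x y * f y)))
      \<le> (\<Sum>x\<in>UNIV. f x * ((lam x + q x) * f x - (\<Sum>y\<in>UNIV. C x y * f y)))"
  proof (rule sum_mono)
    fix x
    have "0 \<le> q x * (f x)\<^sup>2" using q by simp
    then show "f x * (lam x * f x - (\<Sum>y\<in>UNIV. C x y * f y))
      \<le> f x * ((lam x + q x) * f x - (\<Sum>y\<in>UNIV. C x y * f y))"
      by (simp add: algebra_simps power2_eq_square)
  qed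
  with le show "(\<Sum>x\<in>UNIV. f x * (lam x * f x - (\<Sum>y\<in>UNIV. C x y * f y))) \<le> 0" by simp
qed

text \<open>Positive definiteness gives a trivial kernel and hence invertibility; this is what makes
  \<open>matrix_inv\<close> a genuine two-sided inverse.\<close>

lemma
  assumes q: "\<And>x. 0 \<le> q x"
  shows W_left: "(lam x + q x) * W q x y - (\<Sum>z\<in>UNIV. C x z * W q z y) = (if x = y then 1 else 0)"
    and W_right: "W q x y * (lam y + q y) - (\<Sum>z\<in>UNIV. W q x z * C z y) = (if x = y then 1 else 0)"
proof -
  define A :: "real^'x^'x" where "A = (\<chi> x y. (if x = y then lam x + q x else 0) - C x y)"
  have Av: "(A *v v) $ x = (lam x + q x) * v $ x - (\<Sum>y\<in>UNIV. C x y * v $ y)" for v x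
    by (simp add: A_def matrix_vector_mult_def algebra_simps sum_subtractf
          if_distrib[of "\<lambda>t. _ * t"] if_distrib[of "\<lambda>t. t * _"] cong: if_cong)
  have "v = 0" if "A *v v = 0" for v
  proof -
    have "(lam x + q x) * v $ x - (\<Sum>y\<in>UNIV. C x y * v $ y) = 0" for x
      using that Av[of v x] by simp
    then have "v $ x = 0" for x
      by (intro perturbed_energy_pos_def[where f = "\<lambda>x. v $ x" and q = q]) (auto simp: q)
    then show ?thesis by (simp add: vec_eq_iff)
  qed
  then have "invertible A"
    unfolding invertible_left_inverse matrix_left_invertible_ker by auto
  then have AB: "A ** matrix_inv A = mat 1" "matrix_inv A ** A = mat 1"
    unfolding invertible_def matrix_inv_def by (metis (mono_tags, lifting) someI_ex)+
  have Wq: "matrix_inv A $ x $ y = W q x y" for x y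
    unfolding A_def potential_green_def ..
  have "(A ** matrix_inv A) $ x $ y = (lam x + q x) * W q x y - (\<Sum>z\<in>UNIV. C x z * W q z y)"
    by (simp add: matrix_matrix_mult_def Wq)
       (simp add: A_def algebra_simps sum_subtractf
          if_distrib[of "\<lambda>t. _ * t"] if_distrib[of "\<lambda>t. t * _"] cong: if_cong)
  then show "(lam x + q x) * W q x y - (\<Sum>z\<in>UNIV. C x z * W q z y) = (if x = y then 1 else 0)"
    by (simp add: AB mat_def)
  have "(matrix_inv A ** A) $ x $ y = W q x y * (lam y + q y) - (\<Sum>z\<in>UNIV. W q x z * C z y)"
    by (simp add: matrix_matrix_mult_def Wq)
       (simp add: A_def algebra_simps sum_subtractf sum.distrib
          if_distrib[of "\<lambda>t. _ * t"] if_distrib[of "\<lambda>t. t * _"] cong: if_cong)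
  then show "W q x y * (lam y + q y) - (\<Sum>z\<in>UNIV. W q x z * C z y) = (if x = y then 1 else 0)"
    by (simp add: AB mat_def)
qed

text \<open>Stated for rows and up to a factor c: the sum over jumps gives such a row with c = 1,
  the weighted Gaussian covariance one with c = \<open>gaussian_laplace q\<close>.\<close>

lemma W_unique:
  assumes q: "\<And>x. 0 \<le> q x"
    and eq: "\<And>y. v y * (lam y + q y) - (\<Sum>z\<in>UNIV. v z * C z y) = c * (if x = y then 1 else 0)"
  shows "v y = c * W q x y"
proof -
  have "c * W q x y = (\<Sum>w\<in>UNIV. c * (if x = w then 1 else 0) * W q w y)"
    using sum_indicator_mult(1)[of x "\<lambda>w. W q w y"] by (simp add: sum_distrib_left[symmetric] mult.assoc)
  also have "\<dots> = (\<Sum>w\<in>UNIV. (v w * (lam w + q w) - (\<Sum>z\<in>UNIV. v z * C z w)) * W q w y)"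
    by (simp add: eq)
  also have "\<dots> = (\<Sum>w\<in>UNIV. v w * ((lam w + q w) * W q w y)) - (\<Sum>w\<in>UNIV. \<Sum>z\<in>UNIV. v z * C z w * W q w y)"
    by (simp add: left_diff_distrib sum_subtractf sum_distrib_right mult.assoc)
  also have "(\<Sum>w\<in>UNIV. \<Sum>z\<in>UNIV. v z * C z w * W q w y) = (\<Sum>z\<in>UNIV. v z * (\<Sum>w\<in>UNIV. C z w * W q w y))"
    by (subst sum.swap) (simp add: sum_distrib_left mult.assoc)
  also have "(\<Sum>w\<in>UNIV. v w * ((lam w + q w) * W q w y)) - \<dots>
     = (\<Sum>w\<in>UNIV. v w * ((lam w + q w) * W q w y - (\<Sum>z\<in>UNIV. C w z * W q z y)))"
    by (simp add: right_diff_distrib sum_subtractf)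
  also have "\<dots> = v y"
    unfolding W_left[where q = q, OF q] by (rule sum_indicator_mult)
  finally show ?thesis by simp
qed

text \<open>Testing the equation for \<open>v = W q \<cdot> y\<close> against the negative part of \<open>v\<close>.\<close>

lemma W_nonneg:
  assumes q: "\<And>x. 0 \<le> q x"
  shows "0 \<le> W q x y"
proof -
  define v where "v x = W q x y" for x
  define m where "m x = max 0 (- v x)" for x
  have "m x * ((lam x + q x) * m x - (\<Sum>z\<in>UNIV. C x z * m z)) \<le> 0" for x
  proof -
    \<comment> \<open>On the support of m one has m = - v, so the diagonal part only changes sign;
      off the diagonal m \<ge> - v and the conductances are nonnegative, which gives the inequality
      below.\<close>
    have "(lam x + q x) * m x * m x = - (lam x + q x) * v x * m x"
      by (simp add: m_def max_def algebra_simps)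
    moreover have "m x * (\<Sum>z\<in>UNIV. C x z * m z) \<ge> m x * (\<Sum>z\<in>UNIV. C x z * - v z)"
      by (intro mult_left_mono sum_mono C_nonneg) (auto simp: m_def)
    ultimately have "m x * ((lam x + q x) * m x - (\<Sum>z\<in>UNIV. C x z * m z))
       \<le> - m x * ((lam x + q x) * v x - (\<Sum>z\<in>UNIV. C x z * v z))"
      by (simp add: algebra_simps sum_negf)
    also have "\<dots> = - m x * (if x = y then 1 else 0)"
      unfolding v_def W_left[where q = q, OF q] ..
    also have "\<dots> \<le> 0" by (auto simp: m_def)
    finally show ?thesis .
  qed
  then have "m x = 0" for x
    by (intro perturbed_energy_pos_def[where f = m, OF q] sum_nonpos) auto
  from this[of x] show ?thesis by (auto simp: m_def v_def)
qed

section \<open>Dependence of the resolvent on the potential\<close>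

text \<open>If A and B are the matrices inverted by \<open>W q\<close> and \<open>W r\<close>, then
  B - A is diagonal with entries \<open>r z - q z\<close>, and \<open>W q\<close> (B - A)
  \<open>W r\<close> telescopes to \<open>W q\<close> - \<open>W r\<close>.\<close>

lemma resolvent_identity:
  assumes q: "\<And>x. 0 \<le> q x" and r: "\<And>x. 0 \<le> r x"
  shows "W q x y - W r x y = (\<Sum>z\<in>UNIV. W q x z * (r z - q z) * W r z y)"
proof -
  have "W q x y = 1 * W r x y + (\<Sum>z\<in>UNIV. W q x z * (r z - q z) * W r z y)"
  proof -
    have "(\<Sum>z\<in>UNIV. W q x z * (r z - q z) * W r z y)
      = (\<Sum>z\<in>UNIV. (W q x z * (lam z + r z) - (\<Sum>w\<in>UNIV. W q x w * C w z)) * W r z y)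
        - (\<Sum>z\<in>UNIV. (W q x z * (lam z + q z) - (\<Sum>w\<in>UNIV. W q x w * C w z)) * W r z y)"
      by (simp add: sum_subtractf[symmetric] algebra_simps)
    also have "(\<Sum>z\<in>UNIV. (W q x z * (lam z + q z) - (\<Sum>w\<in>UNIV. W q x w * C w z)) * W r z y) = W r x y"
      unfolding W_right[where q = q, OF q] by (rule sum_indicator_mult)
    also have "(\<Sum>z\<in>UNIV. (W q x z * (lam z + r z) - (\<Sum>w\<in>UNIV. W q x w * C w z)) * W r z y)
       = (\<Sum>w\<in>UNIV. W q x w * ((lam w + r w) * W r w y - (\<Sum>z\<in>UNIV. C w z * W r z y)))"
    proof -
      have "(\<Sum>z\<in>UNIV. (\<Sum>w\<in>UNIV. W q x w * C w z) * W r z y) = (\<Sum>w\<in>UNIV. W q x w * (\<Sum>z\<in>UNIV. C w z * W r z y))"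
        by (simp add: sum_distrib_left sum_distrib_right mult.assoc) (rule sum.swap)
      then show ?thesis
        by (simp add: left_diff_distrib right_diff_distrib sum_subtractf mult.assoc)
    qed
    also have "\<dots> = W q x y"
      unfolding W_left[where q = r, OF r] by (rule sum_indicator_mult)
    finally show ?thesis by simp
  qed
  then show ?thesis by simp
qed

lemma W_antimono:
  assumes q: "\<And>x. 0 \<le> q x" and le: "\<And>x. q x \<le> r x"
  shows "W r x y \<le> W q x y"
proof -
  have r: "\<And>x. 0 \<le> r x" using q le order_trans by blast
  have "0 \<le> W q x y - W r x y"
    unfolding resolvent_identity[where q = q and r = r, OF q r]
    by (intro sum_nonneg mult_nonneg_nonneg W_nonneg q r) (simp add: le)
  then show ?thesis by simp
qed

text \<open>Both resolvents on the right of the resolvent identity are dominated by the Green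
  function, so the Lipschitz constant does not depend on the potentials.\<close>

lemma W_lipschitz:
  assumes q: "\<And>x. 0 \<le> q x" and r: "\<And>x. 0 \<le> r x"
  shows "\<bar>W q x y - W r x y\<bar> \<le> (\<Sum>z\<in>UNIV. W (\<lambda>_. 0) x z * W (\<lambda>_. 0) z y * \<bar>r z - q z\<bar>)"
proof -
  have "\<bar>W q x y - W r x y\<bar> \<le> (\<Sum>z\<in>UNIV. \<bar>W q x z * (r z - q z) * W r z y\<bar>)"
    unfolding resolvent_identity[where q = q and r = r, OF q r] by (rule sum_abs)
  also have "\<dots> \<le> (\<Sum>z\<in>UNIV. W (\<lambda>_. 0) x z * W (\<lambda>_. 0) z y * \<bar>r z - q z\<bar>)"
  proof (rule sum_mono)
    fix z
    have "W q x z * W r z y \<le> W (\<lambda>_. 0) x z * W (\<lambda>_. 0) z y"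
      by (intro mult_mono W_antimono W_nonneg) (auto simp: q r)
    then have "W q x z * W r z y * \<bar>r z - q z\<bar> \<le> W (\<lambda>_. 0) x z * W (\<lambda>_. 0) z y * \<bar>r z - q z\<bar>"
      by (rule mult_right_mono) simp
    then show "\<bar>W q x z * (r z - q z) * W r z y\<bar> \<le> W (\<lambda>_. 0) x z * W (\<lambda>_. 0) z y * \<bar>r z - q z\<bar>"
      by (simp add: abs_mult W_nonneg q r mult_ac)
  qed
  finally show ?thesis .
qed

lemma tendsto_W:
  assumes q: "\<And>x. 0 \<le> q x" and r: "\<forall>\<^sub>F t in F. \<forall>x. 0 \<le> r t x"
    and lim: "\<And>x. ((\<lambda>t. r t x) \<longlongrightarrow> q x) F"
  shows "((\<lambda>t. W (r t) x y) \<longlongrightarrow> W q x y) F"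
proof -
  have "((\<lambda>t. \<Sum>z\<in>UNIV. W (\<lambda>_. 0) x z * W (\<lambda>_. 0) z y * \<bar>q z - r t z\<bar>)
      \<longlongrightarrow> (\<Sum>z\<in>UNIV. W (\<lambda>_. 0) x z * W (\<lambda>_. 0) z y * \<bar>q z - q z\<bar>)) F"
    by (intro tendsto_intros lim)
  then have "((\<lambda>t. \<Sum>z\<in>UNIV. W (\<lambda>_. 0) x z * W (\<lambda>_. 0) z y * \<bar>q z - r t z\<bar>) \<longlongrightarrow> 0) F"
    by simp
  then have "((\<lambda>t. W (r t) x y - W q x y) \<longlongrightarrow> 0) F"
    by (rule Lim_null_comparison[rotated])
       (use r in eventually_elim, use W_lipschitz q in auto)
  then show ?thesis by (simp add: LIM_zero_iff)
qed

text \<open>The resolvent identity divided by s - t, with continuity in the limit. The derivative is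
  taken within \<open>{0..}\<close> because the potential must stay nonnegative.\<close>

lemma W_has_derivative:
  assumes t: "0 \<le> t" and q: "\<And>x. 0 \<le> q x" and d: "\<And>x. 0 \<le> d x"
  shows "((\<lambda>t. W (\<lambda>x. q x + t * d x) x y) has_real_derivative
            - (\<Sum>z\<in>UNIV. W (\<lambda>x. q x + t * d x) x z * d z * W (\<lambda>x. q x + t * d x) z y)) (at t within {0..})"
  unfolding has_field_derivative_iff
proof (rule Lim_transform_eventually)
  let ?r = "\<lambda>s x. q x + s * d x"
  show "((\<lambda>s. - (\<Sum>z\<in>UNIV. W (?r s) x z * d z * W (?r t) z y)) \<longlongrightarrow>
     - (\<Sum>z\<in>UNIV. W (?r t) x z * d z * W (?r t) z y)) (at t within {0..})"
    by (intro tendsto_intros tendsto_W)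
       (auto simp: t q d eventually_at_filter intro!: tendsto_eq_intros)
  show "\<forall>\<^sub>F s in at t within {0..}. - (\<Sum>z\<in>UNIV. W (?r s) x z * d z * W (?r t) z y)
      = (W (?r s) x y - W (?r t) x y) / (s - t)"
    unfolding eventually_at_filter
  proof (intro always_eventually allI impI)
    fix s assume s: "s \<noteq> t" "s \<in> {0..}"
    have "W (?r s) x y - W (?r t) x y = (\<Sum>z\<in>UNIV. W (?r s) x z * (?r t z - ?r s z) * W (?r t) z y)"
      using s t q d by (intro resolvent_identity) auto
    also have "\<dots> = (s - t) * - (\<Sum>z\<in>UNIV. W (?r s) x z * d z * W (?r t) z y)"
      by (simp add: sum_distrib_left sum_negf[symmetric] algebra_simps sum_subtractf[symmetric] sum.distrib[symmetric])
    finally show "- (\<Sum>z\<in>UNIV. W (?r s) x z * d z * W (?r t) z y)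
      = (W (?r s) x y - W (?r t) x y) / (s - t)" using s by simp
  qed
qed

lemma W_tendsto_0:
  assumes q: "\<And>x. 0 \<le> q x"
  shows "((\<lambda>p. W (\<lambda>x. q x + p * lam x) x y) \<longlongrightarrow> 0) at_top"
proof (rule Lim_null_comparison)
  \<comment> \<open>In the column equation at y, \<open>p * lam y\<close> times the resolvent is at
    most the unit term plus the C-term; bounding the latter by the Green function makes the constant
    independent of p.\<close>
  let ?b = "((if x = y then 1 else 0) + (\<Sum>z\<in>UNIV. W (\<lambda>_. 0) x z * C z y)) / lam y"
  show "((\<lambda>p. ?b * inverse p) \<longlongrightarrow> 0) at_top"
    by (rule tendsto_mult_right_zero[OF tendsto_inverse_0_at_top[OF filterlim_ident]])
  show "\<forall>\<^sub>F p in at_top. norm (W (\<lambda>x. q x + p * lam x) x y) \<le> ?b * inverse p"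
    using eventually_gt_at_top[of 0]
  proof eventually_elim
    fix p :: real assume p: "0 < p"
    let ?r = "\<lambda>x. q x + p * lam x"
    have r: "0 \<le> ?r x" for x using q p lam_pos by (simp add: less_imp_le)
    have "W ?r x y * (p * lam y) \<le> W ?r x y * (lam y + ?r y)"
      using q lam_pos[of y] by (intro mult_left_mono W_nonneg r) (simp add: less_imp_le)
    also have "\<dots> = (if x = y then 1 else 0) + (\<Sum>z\<in>UNIV. W ?r x z * C z y)"
      using W_right[where q = ?r and x = x and y = y] r by simp
    also have "\<dots> \<le> (if x = y then 1 else 0) + (\<Sum>z\<in>UNIV. W (\<lambda>_. 0) x z * C z y)"
      by (intro add_left_mono sum_mono mult_right_mono W_antimono C_nonneg) (auto simp: r)
    finally show "norm (W ?r x y) \<le> ?b * inverse p"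
      using p lam_pos[of y] W_nonneg[of ?r x y] r by (simp add: field_simps)
  qed
qed

end

section \<open>Paths of the chain\<close>

lemma skeleton_None_mono:
  assumes "skeleton x U n = None" "n \<le> m"
  shows "skeleton x U m = None"
  using assms(2,1) by (induction rule: dec_induct) auto

lemma chain_eq_skeletonI:
  assumes "t < (\<Sum>i\<le>n. \<tau> i)" "\<And>m. m < n \<Longrightarrow> (\<Sum>i\<le>m. \<tau> i) \<le> t"
  shows "chain x (U, \<tau>) t = skeleton x U n"
proof -
  have "(LEAST n. t < (\<Sum>i\<le>n. \<tau> i)) = n"
    using assms by (intro Least_equality) (auto simp: not_less[symmetric] leI)
  then show ?thesis using assms(1) by (auto simp: chain_def)
qed

text \<open>True for arbitrary holding times: the least index whose partial sum exceeds the time is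
  monotone in the time, and the skeleton never leaves the cemetery. This justifies the use of
  \<open>the\<close> in \<open>chain_path\<close>.\<close>

lemma chain_alive_before:
  assumes alive: "chain x \<omega> t \<noteq> None" and "s \<le> t"
  shows "chain x \<omega> s \<noteq> None"
proof -
  obtain U \<tau> where \<omega>: "\<omega> = (U, \<tau>)" by (cases \<omega>)
  let ?N = "\<lambda>t. LEAST n. t < (\<Sum>i\<le>n. \<tau> i)"
  have ex: "\<exists>n. t < (\<Sum>i\<le>n. \<tau> i)" and sk: "skeleton x U (?N t) \<noteq> None"
    using alive by (auto simp: chain_def \<omega> split: if_splits)
  have "t < (\<Sum>i\<le>?N t. \<tau> i)" using LeastI_ex[OF ex] .
  then have s: "s < (\<Sum>i\<le>?N t. \<tau> i)" using \<open>s \<le> t\<close> by simp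
  then have "?N s \<le> ?N t" by (rule Least_le)
  then have "skeleton x U (?N s) \<noteq> None" using sk skeleton_None_mono by metis
  then show ?thesis using s by (auto simp: chain_def \<omega>)
qed

lemma chain_path_in_paths:
  assumes t: "0 < t" and alive: "chain x \<omega> t \<noteq> None"
  shows "chain_path x t \<omega> \<in> paths"
proof -
  obtain U \<tau> where \<omega>: "\<omega> = (U, \<tau>)" by (cases \<omega>)
  let ?N = "\<lambda>t. LEAST n. t < (\<Sum>i\<le>n. \<tau> i)"
  \<comment> \<open>Being alive at t provides an index whose partial sum exceeds t, so finitely many
    partial sums cover all jumps up to t, even if infinitely many accumulate later.\<close>
  define D where "D = (\<lambda>n. \<Sum>i\<le>n. \<tau> i) ` {..?N t}"
  have t': "t < (\<Sum>i\<le>?N t. \<tau> i)"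
    using alive by (auto simp: chain_def \<omega> split: if_splits intro: LeastI)
  have "chain x \<omega> r = chain x \<omega> s" if rs: "r \<le> s" "s \<le> t" "{r<..s} \<inter> D = {}" for r s
  proof -
    have s1: "s < (\<Sum>i\<le>?N t. \<tau> i)" using rs t' by simp
    have Nst: "?N s \<le> ?N t" using s1 by (rule Least_le)
    have s2: "s < (\<Sum>i\<le>?N s. \<tau> i)" using s1 by (rule LeastI)
    then have r2: "r < (\<Sum>i\<le>?N s. \<tau> i)" using rs by simp
    have r3: "r < (\<Sum>i\<le>?N r. \<tau> i)" using r2 by (rule LeastI)
    have Nrs: "?N r \<le> ?N s" using r2 by (rule Least_le)
    have "?N r = ?N s"
    proof (rule ccontr)
      assume "?N r \<noteq> ?N s"
      then have "?N r < ?N s" using Nrs by simp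
      then have "(\<Sum>i\<le>?N r. \<tau> i) \<le> s" using not_less_Least[of "?N r" "\<lambda>n. s < (\<Sum>i\<le>n. \<tau> i)"] by simp
      moreover have "(\<Sum>i\<le>?N r. \<tau> i) \<in> D" using Nrs Nst by (auto simp: D_def)
      ultimately show False using rs(3) r3 by auto
    qed
    then show ?thesis using r3 s2 by (auto simp: chain_def \<omega>)
  qed
  moreover have "finite D" by (simp add: D_def)
  ultimately show ?thesis
    using t by (auto simp: paths_def chain_path_def intro!: exI[of _ D])
qed

section \<open>Measurability of the chain and of its paths\<close>

lemma countable_UNIV_option[simp]: "countable (UNIV :: 'x::finite option set)"
  by (rule countable_finite) simp

lemma measurable_skeleton[measurable]:
  fixes x :: "'x::finite"
  shows "(\<lambda>U. skeleton x U n) \<in> PiM UNIV (\<lambda>(n, z). measure_pmf (jump_pmf C \<kappa> z)) \<rightarrow>\<^sub>M count_space UNIV"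
    (is "_ \<in> ?M \<rightarrow>\<^sub>M _")
proof (induction n)
  case (Suc n)
  have [measurable]: "(\<lambda>U. U (n, z)) \<in> ?M \<rightarrow>\<^sub>M count_space UNIV" for z
    using measurable_component_singleton[of "(n, z)" UNIV "\<lambda>(n, z). measure_pmf (jump_pmf C \<kappa> z)"] by simp
  have "(\<lambda>U. Option.bind i (\<lambda>z. U (n, z))) \<in> ?M \<rightarrow>\<^sub>M count_space UNIV" for i
    by (cases i) simp_all
  then show ?case
    by simp (rule measurable_compose_countable'[OF _ Suc], auto)
qed simp

text \<open>Measurability along g and f amounts to joint measurability in driving randomness and
  time, as needed for exchanging the two integrations.\<close>

lemma measurable_chain[measurable (raw)]:
  fixes x :: "'x::finite"
  assumes [measurable]: "g \<in> M \<rightarrow>\<^sub>M driving_space C \<kappa>" "f \<in> borel_measurable M"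
  shows "(\<lambda>\<omega>. chain x (g \<omega>) (f \<omega>)) \<in> M \<rightarrow>\<^sub>M count_space UNIV"
proof -
  let ?U = "PiM UNIV (\<lambda>(n, z). measure_pmf (jump_pmf C \<kappa> z))"
  let ?T = "PiM UNIV (\<lambda>n::nat. density lborel (exponential_density 1))"
  have g[measurable]: "(\<lambda>\<omega>. fst (g \<omega>)) \<in> M \<rightarrow>\<^sub>M ?U" "(\<lambda>\<omega>. snd (g \<omega>)) \<in> M \<rightarrow>\<^sub>M ?T"
    using assms(1) unfolding driving_space_def by simp_all
  have [measurable]: "(\<lambda>\<omega>. snd (g \<omega>) i) \<in> borel_measurable M" for i
  proof -
    have "(\<lambda>\<tau>. \<tau> i) \<in> ?T \<rightarrow>\<^sub>M borel"
      using measurable_component_singleton[of i UNIV "\<lambda>n. density lborel (exponential_density 1)"] by simp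
    then show ?thesis using g(2) by (rule measurable_compose[rotated])
  qed
  have [measurable]: "(\<lambda>\<omega>. skeleton x (fst (g \<omega>)) n) \<in> M \<rightarrow>\<^sub>M count_space UNIV" for n
    by (rule measurable_compose[OF g(1) measurable_skeleton])
  have "(\<lambda>\<omega>. if \<exists>n. f \<omega> < (\<Sum>i\<le>n. snd (g \<omega>) i)
      then skeleton x (fst (g \<omega>)) (LEAST n. f \<omega> < (\<Sum>i\<le>n. snd (g \<omega>) i)) else None) \<in> M \<rightarrow>\<^sub>M count_space UNIV"
    by measurable
  then show ?thesis by (simp add: chain_def case_prod_beta)
qed

lemma path_generators_subset:
  "{{\<gamma>\<in>paths. fst \<gamma> \<le> a} | a. True} \<union> {{\<gamma>\<in>paths. snd \<gamma> (min s (fst \<gamma>)) = z} | s z. 0 \<le> s} \<subseteq> Pow paths"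
  by auto

lemma space_path_space[simp]: "space path_space = paths"
  unfolding path_space_def using path_generators_subset by (rule space_measure_of)

text \<open>Evaluations of the path, stopped at its duration, are evaluations of the chain at
  \<open>min s (f \<omega>)\<close>. Survival up to \<open>f \<omega>\<close> guarantees that these
  have proper values and that the result lies in \<open>paths\<close>.\<close>

lemma measurable_chain_path:
  fixes x :: "'x::finite"
  assumes [measurable]: "g \<in> M \<rightarrow>\<^sub>M driving_space C \<kappa>" "f \<in> borel_measurable M"
    and alive: "\<And>\<omega>. \<omega> \<in> space M \<Longrightarrow> 0 < f \<omega> \<and> chain x (g \<omega>) (f \<omega>) \<noteq> None"
  shows "(\<lambda>\<omega>. chain_path x (f \<omega>) (g \<omega>)) \<in> M \<rightarrow>\<^sub>M path_space"
  unfolding path_space_def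
proof (rule measurable_measure_of[OF path_generators_subset])
  show "(\<lambda>\<omega>. chain_path x (f \<omega>) (g \<omega>)) \<in> space M \<rightarrow> paths"
    using alive by (auto intro!: chain_path_in_paths)
  fix A :: "'x path set" assume "A \<in> {{\<gamma>\<in>paths. fst \<gamma> \<le> a} | a. True} \<union> {{\<gamma>\<in>paths. snd \<gamma> (min s (fst \<gamma>)) = z} | s z. 0 \<le> s}"
  then show "(\<lambda>\<omega>. chain_path x (f \<omega>) (g \<omega>)) -` A \<inter> space M \<in> sets M"
  proof (elim UnE CollectE exE conjE)
    fix a assume A: "A = {\<gamma>\<in>paths. fst \<gamma> \<le> a}"
    have "(\<lambda>\<omega>. chain_path x (f \<omega>) (g \<omega>)) -` A \<inter> space M = {\<omega> \<in> space M. f \<omega> \<le> a}"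
      using alive by (auto simp: A chain_path_in_paths) (auto simp: chain_path_def)
    also have "\<dots> \<in> sets M" by measurable
    finally show ?thesis .
  next
    fix s :: real and z :: 'x assume A: "A = {\<gamma>\<in>paths. snd \<gamma> (min s (fst \<gamma>)) = z}" and s: "0 \<le> s"
    have "snd (chain_path x (f \<omega>) (g \<omega>)) (min s (fst (chain_path x (f \<omega>) (g \<omega>)))) = z
      \<longleftrightarrow> chain x (g \<omega>) (min s (f \<omega>)) = Some z" if "\<omega> \<in> space M" for \<omega>
      using alive[OF that] s chain_alive_before[of x "g \<omega>" "f \<omega>" "min s (f \<omega>)"]
      by (auto simp: chain_path_def)
    then have "(\<lambda>\<omega>. chain_path x (f \<omega>) (g \<omega>)) -` A \<inter> space M
        = {\<omega> \<in> space M. chain x (g \<omega>) (min s (f \<omega>)) = Some z}"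
      using alive by (auto simp: A chain_path_in_paths)
    also have "\<dots> \<in> sets M" by measurable
    finally show ?thesis .
  qed
qed

section \<open>Measurable functionals on path space\<close>

lemma measurable_duration[measurable]: "fst \<in> borel_measurable path_space"
proof (rule borel_measurableI_le)
  fix a :: real
  show "{\<gamma> \<in> space path_space. fst \<gamma> \<le> a} \<in> sets path_space"
    unfolding space_path_space unfolding path_space_def sets_measure_of[OF path_generators_subset]
    by (rule sigma_sets.Basic) auto
qed

lemma measurable_stopped_evaluation:
  fixes z :: "'x::finite"
  assumes "0 \<le> s"
  shows "(\<lambda>\<gamma>. snd \<gamma> (min s (fst \<gamma>))) \<in> path_space \<rightarrow>\<^sub>M (count_space UNIV :: 'x measure)"
proof (subst measurable_count_space_eq2[OF finite], safe)
  fix z :: 'x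
  have "(\<lambda>\<gamma>. snd \<gamma> (min s (fst \<gamma>))) -` {z} \<inter> space path_space = {\<gamma>\<in>paths. snd \<gamma> (min s (fst \<gamma>)) = z}"
    by auto
  also have "\<dots> \<in> sets path_space"
    unfolding path_space_def sets_measure_of[OF path_generators_subset]
    using assms by (intro sigma_sets.Basic) auto
  finally show "(\<lambda>\<gamma>. snd \<gamma> (min s (fst \<gamma>))) -` {z} \<inter> space path_space \<in> sets path_space" .
qed simp

lemma paths_right_continuous:
  assumes \<gamma>: "\<gamma> \<in> paths" and s: "0 \<le> s"
  shows "\<exists>e>0. \<forall>r\<in>{s..<s + e}. snd \<gamma> (min r (fst \<gamma>)) = snd \<gamma> (min s (fst \<gamma>))"
proof (cases "fst \<gamma> \<le> s")
  case True then show ?thesis by (intro exI[of _ 1]) (auto simp: min_def)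
next
  case False
  obtain t l where tl: "\<gamma> = (t, l)" by (cases \<gamma>)
  obtain D where D: "finite D" "\<And>r s. r \<in> {0..t} \<Longrightarrow> s \<in> {0..t} \<Longrightarrow> r \<le> s \<Longrightarrow> {r<..s} \<inter> D = {} \<Longrightarrow> l r = l s"
    using \<gamma> by (auto simp: paths_def tl)
  \<comment> \<open>The point s itself is exempt: a jump at s does no harm, because the interval
    \<open>{s<..min r t}\<close> is open at s.\<close>
  obtain e where e: "e > 0" "\<And>d. d \<in> D \<Longrightarrow> d \<noteq> s \<Longrightarrow> e \<le> dist s d"
    using finite_set_avoid[OF D(1), of s] by auto
  have "l s = l (min r t)" if "r \<in> {s..<s + e}" for r
  proof (rule D(2))
    show "{s<..min r t} \<inter> D = {}"
    proof safe
      fix d assume d: "d \<in> {s<..min r t}" "d \<in> D"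
      then have "e \<le> dist s d" using e(2)[of d] by auto
      then show "d \<in> {}" using d that by (auto simp: dist_real_def)
    qed
  qed (use that s False in \<open>auto simp: tl\<close>)
  then have "\<forall>r\<in>{s..<s + e}. l (min r t) = l s" by metis
  moreover have "min s t = s" using False by (simp add: tl)
  ultimately show ?thesis using e(1) by (intro exI[of _ e]) (simp add: tl)
qed

text \<open>Right-continuity reduces evaluation at a variable time to evaluations on countable grids
  approached from the right. The maximum with 0 and the stopping at the duration keep every
  evaluation among the generating ones.\<close>

lemma measurable_evaluation_joint[measurable]:
  "(\<lambda>(\<gamma>, s). snd \<gamma> (min (max 0 s) (fst \<gamma>))) \<in> path_space \<Otimes>\<^sub>M borel \<rightarrow>\<^sub>M (count_space UNIV :: 'x::finite measure)"
proof (subst measurable_count_space_eq2[OF finite], safe)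
  fix z :: 'x
  let ?P = "path_space \<Otimes>\<^sub>M (borel :: real measure) :: ('x path \<times> real) measure"
  \<comment> \<open>The first point strictly above s of the grid of mesh 1/(n+1).\<close>
  define q :: "nat \<Rightarrow> real \<Rightarrow> real" where "q n s = (of_int \<lfloor>real (Suc n) * s\<rfloor> + 1) / real (Suc n)" for n s
  have q: "s < q n s" "q n s \<le> s + 1 / real (Suc n)" for n s
  proof -
    have "real (Suc n) * s < of_int \<lfloor>real (Suc n) * s\<rfloor> + 1" by linarith
    then show "s < q n s" by (simp add: q_def field_simps del: of_nat_Suc)
    have "of_int \<lfloor>real (Suc n) * s\<rfloor> \<le> real (Suc n) * s" by linarith
    then show "q n s \<le> s + 1 / real (Suc n)" by (simp add: q_def field_simps del: of_nat_Suc)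
  qed
  have [measurable]: "(\<lambda>w. snd (fst w) (min (q n (max 0 (snd w))) (fst (fst w)))) \<in> ?P \<rightarrow>\<^sub>M count_space UNIV" for n
  proof -
    have "(\<lambda>w. (\<lambda>k::int. \<lambda>w. snd (fst w) (min (max 0 ((of_int k + 1) / real (Suc n))) (fst (fst w))))
        \<lfloor>real (Suc n) * max 0 (snd w)\<rfloor> w) \<in> ?P \<rightarrow>\<^sub>M count_space UNIV"
    proof (rule measurable_compose_countable[where g = "\<lambda>w. \<lfloor>real (Suc n) * max 0 (snd w)\<rfloor>"
          and f = "\<lambda>k w. snd (fst w) (min (max 0 ((of_int k + 1) / real (Suc n))) (fst (fst w)))"])
      show "(\<lambda>w. snd (fst w) (min (max 0 ((of_int k + 1) / real (Suc n))) (fst (fst w)))) \<in> ?P \<rightarrow>\<^sub>M count_space UNIV" for k :: int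
        by (rule measurable_compose[OF measurable_fst measurable_stopped_evaluation]) simp
      show "(\<lambda>w. \<lfloor>real (Suc n) * max 0 (snd w)\<rfloor>) \<in> ?P \<rightarrow>\<^sub>M count_space UNIV" by measurable
    qed
    moreover have "max 0 ((of_int \<lfloor>real (Suc n) * max 0 s\<rfloor> + 1) / real (Suc n)) = q n (max 0 s)" for s
      using q(1)[of "max 0 s" n] unfolding q_def[symmetric] by simp
    ultimately show ?thesis by simp
  qed
  \<comment> \<open>States are discrete, so convergence along the grid times means eventual
    equality, a countable condition.\<close>
  have ev: "snd \<gamma> (min (max 0 s) (fst \<gamma>)) = z \<longleftrightarrow>
     (\<exists>N. \<forall>n\<ge>N. snd \<gamma> (min (q n (max 0 s)) (fst \<gamma>)) = z)" if \<gamma>: "\<gamma> \<in> paths" for \<gamma> :: "'x path" and s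
  proof -
    obtain e where e: "e > 0" "\<forall>r\<in>{max 0 s..<max 0 s + e}.
        snd \<gamma> (min r (fst \<gamma>)) = snd \<gamma> (min (max 0 s) (fst \<gamma>))"
      using paths_right_continuous[OF \<gamma> max.cobounded1] by blast
    obtain N where N: "1 / real (Suc N) < e" using reals_Archimedean[OF e(1)] by (auto simp: inverse_eq_divide)
    have "snd \<gamma> (min (q n (max 0 s)) (fst \<gamma>)) = snd \<gamma> (min (max 0 s) (fst \<gamma>))" if "n \<ge> N" for n
    proof (rule bspec[OF e(2)])
      have "1 / real (Suc n) \<le> 1 / real (Suc N)" using that by (simp add: frac_le)
      then have "q n (max 0 s) < max 0 s + e" using q(2)[of n "max 0 s"] N by linarith
      then show "q n (max 0 s) \<in> {max 0 s..<max 0 s + e}" using q(1)[of "max 0 s" n] by simp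
    qed
    then show ?thesis by (metis max.cobounded1 max.cobounded2)
  qed
  have "(\<lambda>(\<gamma>, s). snd \<gamma> (min (max 0 s) (fst \<gamma>))) -` {z} \<inter> space ?P
      = {w \<in> space ?P. \<exists>N. \<forall>n\<ge>N. snd (fst w) (min (q n (max 0 (snd w))) (fst (fst w))) = z}"
  proof (rule set_eqI)
    fix w :: "'x path \<times> real"
    show "w \<in> (\<lambda>(\<gamma>, s). snd \<gamma> (min (max 0 s) (fst \<gamma>))) -` {z} \<inter> space ?P \<longleftrightarrow>
      w \<in> {w \<in> space ?P. \<exists>N. \<forall>n\<ge>N. snd (fst w) (min (q n (max 0 (snd w))) (fst (fst w))) = z}"
      using ev[of "fst w" "snd w"]
      by (cases "fst w \<in> paths") (simp_all add: space_pair_measure case_prod_beta mem_Times_iff)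
  qed
  also have "\<dots> \<in> sets ?P" by measurable
  finally show "(\<lambda>(\<gamma>, s). snd \<gamma> (min (max 0 s) (fst \<gamma>))) -` {z} \<inter> space ?P \<in> sets ?P" .
qed simp

lemma measurable_occupation[measurable]:
  "occupation C \<kappa> \<in> borel_measurable (path_space :: 'x::finite path measure)"
proof (rule borel_measurable_vecI)
  fix x :: 'x
  let ?f = "\<lambda>\<gamma> s. indicator {0..fst \<gamma>} s * (if snd \<gamma> (min (max 0 s) (fst \<gamma>)) = x then 1 else 0 :: real)"
  have eq: "occupation C \<kappa> \<gamma> $ x = 1 / total_rate C \<kappa> x * (LINT s|lborel. ?f \<gamma> s)" for \<gamma> :: "'x path"
  proof -
    have "indicator {0..fst \<gamma>} s *\<^sub>R indicator {x} (snd \<gamma> s) = ?f \<gamma> s" for s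
      by (cases "s \<in> {0..fst \<gamma>}") (auto simp: max_def min_def indicator_def)
    then show ?thesis unfolding occupation_def set_lebesgue_integral_def by (simp only: vec_lambda_beta)
  qed
  note [measurable] = measurable_evaluation_joint[unfolded case_prod_beta]
  have "(\<lambda>(\<gamma>, s). (if 0 \<le> s \<and> s \<le> fst \<gamma> then 1 else 0) * (if snd \<gamma> (min (max 0 s) (fst \<gamma>)) = x then 1 else 0 :: real))
    \<in> borel_measurable (path_space \<Otimes>\<^sub>M lborel)"
    unfolding case_prod_beta by measurable
  then have "(\<lambda>\<gamma>. LINT s|lborel. ?f \<gamma> s) \<in> borel_measurable path_space"
    by (intro lborel.borel_measurable_lebesgue_integral) (simp add: indicator_def case_prod_beta)
  then show "(\<lambda>\<gamma>. occupation C \<kappa> \<gamma> $ x) \<in> borel_measurable path_space"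
    unfolding eq by measurable
qed

text \<open>The end point is not an evaluation at a fixed time, but stopped evaluations at integers
  n beyond the duration all return it.\<close>

lemma sets_closed_paths: "{\<gamma> \<in> paths. snd \<gamma> 0 = snd \<gamma> (fst \<gamma>)} \<in> sets (path_space :: 'x::finite path measure)"
proof -
  have eq: "snd \<gamma> 0 = snd \<gamma> (fst \<gamma>) \<longleftrightarrow>
    (\<exists>N. \<forall>n\<ge>N. snd \<gamma> (min 0 (fst \<gamma>)) = snd \<gamma> (min (real n) (fst \<gamma>)))" if "\<gamma> \<in> paths" for \<gamma> :: "'x path"
  proof -
    obtain N where "fst \<gamma> \<le> real N" using real_arch_simple by blast
    then have "snd \<gamma> (min (real n) (fst \<gamma>)) = snd \<gamma> (fst \<gamma>)" if "n \<ge> N" for n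
      using that by (subst min_absorb2) simp_all
    moreover have "min 0 (fst \<gamma>) = 0" using \<open>\<gamma> \<in> paths\<close> by (auto simp: paths_def)
    ultimately show ?thesis by (metis max.cobounded1 max.cobounded2)
  qed
  have [measurable]: "(\<lambda>\<gamma>. snd \<gamma> (min (real n) (fst \<gamma>))) \<in> path_space \<rightarrow>\<^sub>M (count_space UNIV :: 'x measure)"
    "(\<lambda>\<gamma>. snd \<gamma> (min 0 (fst \<gamma>))) \<in> path_space \<rightarrow>\<^sub>M (count_space UNIV :: 'x measure)" for n
    by (rule measurable_stopped_evaluation, simp)+
  have "{\<gamma> \<in> paths. snd \<gamma> 0 = snd \<gamma> (fst \<gamma>)} = {\<gamma> \<in> space (path_space :: 'x path measure).
     \<exists>N. \<forall>n\<ge>N. snd \<gamma> (min 0 (fst \<gamma>)) = snd \<gamma> (min (real n) (fst \<gamma>) :: real)}"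
  proof (rule set_eqI)
    fix \<gamma> :: "'x path"
    show "\<gamma> \<in> {\<gamma> \<in> paths. snd \<gamma> 0 = snd \<gamma> (fst \<gamma>)} \<longleftrightarrow> \<gamma> \<in> {\<gamma> \<in> space path_space.
       \<exists>N. \<forall>n\<ge>N. snd \<gamma> (min 0 (fst \<gamma>)) = snd \<gamma> (min (real n) (fst \<gamma>) :: real)}"
      using eq[of \<gamma>] by (cases "\<gamma> \<in> paths") simp_all
  qed
  also have "\<dots> \<in> sets (path_space :: 'x path measure)" by measurable
  finally show ?thesis .
qed

text \<open>\<open>measure_of\<close> yields the zero measure unless its set function is a measure
  on the generated algebra. Recognising the set function as a weighted image supplies this and
  computes integrals at once.\<close>

lemma nn_integral_measure_of_image:
  assumes T: "T \<in> M \<rightarrow>\<^sub>M N" and w: "w \<in> borel_measurable M"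
    and \<mu>: "\<And>A. A \<in> sets N \<Longrightarrow> \<mu> A = (\<integral>\<^sup>+\<omega>. w \<omega> * indicator A (T \<omega>) \<partial>M)"
    and f: "f \<in> borel_measurable N"
  shows "(\<integral>\<^sup>+y. f y \<partial>measure_of (space N) (sets N) \<mu>) = (\<integral>\<^sup>+\<omega>. w \<omega> * f (T \<omega>) \<partial>M)"
proof -
  let ?D = "distr (density M w) N T"
  have int: "(\<integral>\<^sup>+y. h y \<partial>?D) = (\<integral>\<^sup>+\<omega>. w \<omega> * h (T \<omega>) \<partial>M)" if h: "h \<in> borel_measurable N" for h
    using T h by (subst nn_integral_distr)
      (simp_all add: nn_integral_density[OF w measurable_compose[OF T h]])
  have "emeasure ?D A = \<mu> A" if "A \<in> sets N" for A
    using int[of "indicator A"] that by (simp add: \<mu>)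
  then have eq: "measure_of (space N) (sets N) \<mu> = measure_of (space ?D) (sets ?D) (emeasure ?D)"
    by (simp, intro measure_of_eq) (simp_all add: sets.sigma_sets_eq sets.space_closed)
  show ?thesis unfolding eq measure_of_of_measure by (rule int[OF f])
qed

text \<open>A total, measurable substitute for \<open>chain_path\<close>: on the exceptional event
  it returns a fixed constant path. Demanding \<open>chain x \<omega> 0 = Some x\<close>, which
  holds almost surely, lets bridges from x to x be closed without exception.\<close>

definition safe_path :: "'x \<Rightarrow> 'x option \<Rightarrow> real \<Rightarrow> 'x driving \<Rightarrow> 'x path" where
  "safe_path x z t \<omega> =
     (if 0 < t \<and> chain x \<omega> 0 = Some x \<and> chain x \<omega> t = z then chain_path x t \<omega> else (1, \<lambda>s\<in>{0..1}. x))"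

lemma constant_path_in_paths: "(1, \<lambda>s\<in>{0..1}. x) \<in> paths"
  unfolding paths_def by (auto intro!: exI[of _ "{}"])

lemma measurable_safe_path[measurable (raw)]:
  fixes x :: "'x::finite"
  assumes g[measurable]: "g \<in> M \<rightarrow>\<^sub>M driving_space C \<kappa>" and f[measurable]: "f \<in> borel_measurable M"
  shows "(\<lambda>\<omega>. safe_path x (Some y) (f \<omega>) (g \<omega>)) \<in> M \<rightarrow>\<^sub>M path_space"
proof -
  let ?P = "\<lambda>\<omega>. 0 < f \<omega> \<and> chain x (g \<omega>) 0 = Some x \<and> chain x (g \<omega>) (f \<omega>) = Some y"
  have P: "{\<omega> \<in> space M. ?P \<omega>} \<in> sets M" by measurable
  have "(\<lambda>\<omega>. if ?P \<omega> then chain_path x (f \<omega>) (g \<omega>) else (1, \<lambda>s\<in>{0..1}. x)) \<in> M \<rightarrow>\<^sub>M path_space"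
  proof (subst measurable_If_restrict_space_iff[OF P], intro conjI)
    show "(\<lambda>\<omega>. chain_path x (f \<omega>) (g \<omega>)) \<in> restrict_space M {\<omega>. ?P \<omega>} \<rightarrow>\<^sub>M path_space"
      by (rule measurable_chain_path[where C = C and \<kappa> = \<kappa>])
         (auto simp: space_restrict_space intro: measurable_restrict_space1 g f)
    show "(\<lambda>\<omega>. (1, \<lambda>s\<in>{0..1}. x)) \<in> restrict_space M {\<omega>. \<not> ?P \<omega>} \<rightarrow>\<^sub>M path_space"
      by (rule measurable_const) (simp add: constant_path_in_paths)
  qed
  then show ?thesis by (simp add: safe_path_def)
qed

section \<open>Jump expansion\<close>

text \<open>Independence of one coordinate of an infinite product from a functional that ignores it;
  this is the form in which the Markov property enters. The product splits into coordinate i and the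
  rest.\<close>

lemma nn_integral_PiM_coordinate:
  fixes M :: "'i \<Rightarrow> 'a measure"
  assumes M: "\<And>i. prob_space (M i)"
    and A[measurable]: "A \<in> borel_measurable (PiM UNIV M)" and g[measurable]: "g \<in> borel_measurable (M i)"
    and indep: "\<And>X u. X \<in> space (PiM UNIV M) \<Longrightarrow> u \<in> space (M i) \<Longrightarrow> A (X(i := u)) = A X"
  shows "(\<integral>\<^sup>+\<omega>. A \<omega> * g (\<omega> i) \<partial>PiM UNIV M) = (\<integral>\<^sup>+\<omega>. A \<omega> \<partial>PiM UNIV M) * (\<integral>\<^sup>+u. g u \<partial>M i)"
proof -
  interpret Mi: prob_space "M i" by (rule M)
  \<comment> \<open>An arbitrary value frozen into coordinate i, so that A becomes a function of the
    other coordinates.\<close>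
  obtain u0 where u0: "u0 \<in> space (M i)" using Mi.not_empty by auto
  let ?R = "PiM (UNIV - {i}) M"
  interpret R: prob_space ?R by (intro prob_space_PiM M)
  have ins: "insert i (UNIV - {i}) = UNIV" by auto
  have eq: "distr (M i \<Otimes>\<^sub>M ?R) (PiM UNIV M) (\<lambda>(u, Y). Y(i := u)) = PiM UNIV M"
    using distr_pair_PiM_eq_PiM[of "UNIV - {i}" M i] M by (simp add: ins)
  have upd[measurable]: "(\<lambda>(u, Y). Y(i := u)) \<in> M i \<Otimes>\<^sub>M ?R \<rightarrow>\<^sub>M PiM UNIV M"
    unfolding case_prod_beta by (rule measurable_fun_upd[where J = "UNIV - {i}"]) auto
  have key: "(\<integral>\<^sup>+\<omega>. A \<omega> * h (\<omega> i) \<partial>PiM UNIV M) = (\<integral>\<^sup>+u. h u \<partial>M i) * (\<integral>\<^sup>+X. A (X(i := u0)) \<partial>?R)"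
    if h[measurable]: "h \<in> borel_measurable (M i)" for h
  proof -
    have [measurable]: "(\<lambda>X. X(i := u0)) \<in> ?R \<rightarrow>\<^sub>M PiM UNIV M"
      using measurable_compose[OF measurable_Pair1'[OF u0] upd] by simp
    have hm: "(\<lambda>\<omega>. A \<omega> * h (\<omega> i)) \<in> borel_measurable (PiM UNIV M)" by measurable
    have "(\<integral>\<^sup>+\<omega>. A \<omega> * h (\<omega> i) \<partial>PiM UNIV M)
        = (\<integral>\<^sup>+\<omega>. A \<omega> * h (\<omega> i) \<partial>distr (M i \<Otimes>\<^sub>M ?R) (PiM UNIV M) (\<lambda>(u, Y). Y(i := u)))"
      unfolding eq ..
    also have "\<dots> = (\<integral>\<^sup>+p. A ((snd p)(i := fst p)) * h (fst p) \<partial>(M i \<Otimes>\<^sub>M ?R))"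
      by (subst nn_integral_distr[OF upd]) (use hm in \<open>auto simp: case_prod_beta intro!: nn_integral_cong\<close>)
    also have "\<dots> = (\<integral>\<^sup>+p. h (fst p) * A ((snd p)(i := u0)) \<partial>(M i \<Otimes>\<^sub>M ?R))"
    proof (rule nn_integral_cong)
      fix p assume p: "p \<in> space (M i \<Otimes>\<^sub>M ?R)"
      have "(\<lambda>(u, Y). Y(i := u)) (u0, snd p) \<in> space (PiM UNIV M)"
        by (rule measurable_space[OF upd]) (use p u0 in \<open>auto simp: space_pair_measure\<close>)
      then have "A ((snd p)(i := u0, i := fst p)) = A ((snd p)(i := u0))"
        using p by (intro indep) (auto simp: space_pair_measure)
      then show "A ((snd p)(i := fst p)) * h (fst p) = h (fst p) * A ((snd p)(i := u0))"
        by (simp add: mult.commute)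
    qed
    also have "\<dots> = (\<integral>\<^sup>+u. \<integral>\<^sup>+X. h u * A (X(i := u0)) \<partial>?R \<partial>M i)"
      by (subst R.nn_integral_fst[symmetric]) simp_all
    also have "\<dots> = (\<integral>\<^sup>+u. h u \<partial>M i) * (\<integral>\<^sup>+X. A (X(i := u0)) \<partial>?R)"
      by (simp add: nn_integral_cmult nn_integral_multc)
    finally show ?thesis .
  qed
  \<comment> \<open>Taking h = 1 identifies the remaining factor with the integral of A.\<close>
  have "(\<integral>\<^sup>+\<omega>. A \<omega> \<partial>PiM UNIV M) = (\<integral>\<^sup>+X. A (X(i := u0)) \<partial>?R)"
    using key[of "\<lambda>_. 1"] by (simp add: Mi.emeasure_space_1)
  then show ?thesis using key[OF g] by (simp add: mult.commute)
qed

lemma nn_integral_exponential_laplace: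
  assumes v: "0 \<le> v"
  shows "(\<integral>\<^sup>+t. ennreal (exp (- v * t)) \<partial>density lborel (exponential_density 1)) = ennreal (1 / (1 + v))"
proof -
  define a where "a = 1 + v"
  have a: "0 < a" using v by (simp add: a_def)
  have "(\<integral>\<^sup>+t. ennreal (exp (- v * t)) \<partial>density lborel (exponential_density 1))
      = (\<integral>\<^sup>+t. ennreal (exp (- (a * t))) * indicator {0..} t \<partial>lborel)"
    by (subst nn_integral_density)
       (auto simp: a_def exponential_density_def ennreal_mult'[symmetric] exp_add[symmetric] algebra_simps
          intro!: nn_integral_cong split: split_indicator)
  also have "\<dots> = ennreal (0 - exp (- (a * 0)) * (- 1 / a))"
  proof (rule nn_integral_FTC_atLeast)
    have "filterlim (\<lambda>t. a * t) at_top at_top"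
      using a by (intro filterlim_tendsto_pos_mult_at_top[OF tendsto_const _ filterlim_ident])
    then have "((\<lambda>t. exp (- (a * t))) \<longlongrightarrow> 0) at_top"
      by (intro filterlim_compose[OF exp_at_bot]) (simp add: filterlim_uminus_at_bot)
    then show "((\<lambda>t. exp (- (a * t)) * (- 1 / a)) \<longlongrightarrow> 0) at_top"
      by (rule tendsto_mult_left_zero)
    show "((\<lambda>t. exp (- (a * t)) * (- 1 / a)) has_real_derivative exp (- (a * t))) (at t)" for t
      using a by (auto intro!: derivative_eq_intros)
  qed (use v in auto)
  finally show ?thesis by (simp add: a_def)
qed

text \<open>Accounts for the last, interrupted holding period, with r the time already spent in it.
  The tail P(\<tau> > r) = exp (- r) equals the density at r, so the value agrees with the Laplace
  transform of a completed period.\<close>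

lemma nn_integral_exponential_truncated:
  assumes v: "0 \<le> v"
  shows "(\<integral>\<^sup>+t. (\<integral>\<^sup>+r. indicator {0..<t} r * ennreal (exp (- v * r)) \<partial>lborel) \<partial>density lborel (exponential_density 1))
    = ennreal (1 / (1 + v))"
proof -
  have tail: "(\<integral>\<^sup>+t. ennreal (exponential_density 1 t) * indicator {r<..} t \<partial>lborel) = ennreal (exp (- r))"
    if "0 \<le> r" for r
  proof -
    have "(\<integral>\<^sup>+t. ennreal (exponential_density 1 t) * indicator {r<..} t \<partial>lborel)
       = (\<integral>\<^sup>+t. ennreal (exp (- t)) * indicator {r..} t \<partial>lborel)"
      using that AE_lborel_singleton[of r]
      by (intro nn_integral_cong_AE) (auto simp: exponential_density_def split: split_indicator)
    also have "\<dots> = ennreal (0 - (- exp (- r)))"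
    proof (rule nn_integral_FTC_atLeast)
      show "((\<lambda>t. - exp (- t :: real)) \<longlongrightarrow> 0) at_top"
        using tendsto_minus[OF filterlim_compose[OF exp_at_bot filterlim_uminus_at_bot_at_top]] by simp
    qed (auto intro!: derivative_eq_intros)
    finally show ?thesis by simp
  qed
  have "(\<integral>\<^sup>+t. (\<integral>\<^sup>+r. indicator {0..<t} r * ennreal (exp (- v * r)) \<partial>lborel) \<partial>density lborel (exponential_density 1))
    = (\<integral>\<^sup>+t. (\<integral>\<^sup>+r. ennreal (exponential_density 1 t) * ((if 0 \<le> r \<and> r < t then 1 else 0) * ennreal (exp (- v * r))) \<partial>lborel) \<partial>lborel)"
  proof (subst nn_integral_density)
    have "(\<integral>\<^sup>+r. ennreal (exponential_density 1 t) * ((if 0 \<le> r \<and> r < t then 1 else 0) * ennreal (exp (- v * r))) \<partial>lborel)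
      = ennreal (exponential_density 1 t) * (\<integral>\<^sup>+r. indicator {0..<t} r * ennreal (exp (- v * r)) \<partial>lborel)" for t :: real
      by (subst nn_integral_cmult) (simp_all add: indicator_def of_bool_def)
    then show "(\<integral>\<^sup>+t. ennreal (exponential_density 1 t) * (\<integral>\<^sup>+r. indicator {0..<t} r * ennreal (exp (- v * r)) \<partial>lborel) \<partial>lborel)
      = (\<integral>\<^sup>+t. (\<integral>\<^sup>+r. ennreal (exponential_density 1 t) * ((if 0 \<le> r \<and> r < t then 1 else 0) * ennreal (exp (- v * r))) \<partial>lborel) \<partial>lborel)"
      by simp
    have "(\<lambda>t. \<integral>\<^sup>+r. (if 0 \<le> r \<and> r < t then 1 else 0) * ennreal (exp (- v * r)) \<partial>lborel) \<in> borel_measurable lborel"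
      by measurable
    then show "(\<lambda>t. \<integral>\<^sup>+r. indicator {0..<t} r * ennreal (exp (- v * r)) \<partial>lborel) \<in> borel_measurable lborel"
      by (simp add: indicator_def of_bool_def)
  qed simp_all
  also have "\<dots> = (\<integral>\<^sup>+r. (\<integral>\<^sup>+t. ennreal (exponential_density 1 t) * ((if 0 \<le> r \<and> r < t then 1 else 0) * ennreal (exp (- v * r))) \<partial>lborel) \<partial>lborel)"
    by (rule lborel_pair.Fubini') measurable
  also have "\<dots> = (\<integral>\<^sup>+r. ennreal (exp (- v * r)) * indicator {0..} r * ennreal (exp (- r)) \<partial>lborel)"
  proof (rule nn_integral_cong)
    fix r :: real
    have "(\<integral>\<^sup>+t. ennreal (exponential_density 1 t) * ((if 0 \<le> r \<and> r < t then 1 else 0) * ennreal (exp (- v * r))) \<partial>lborel)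
      = (\<integral>\<^sup>+t. (ennreal (exp (- v * r)) * indicator {0..} r) * (ennreal (exponential_density 1 t) * indicator {r<..} t) \<partial>lborel)"
      by (intro nn_integral_cong) (auto simp: mult_ac split: split_indicator)
    also have "\<dots> = (ennreal (exp (- v * r)) * indicator {0..} r) * (\<integral>\<^sup>+t. (ennreal (exponential_density 1 t) * indicator {r<..} t) \<partial>lborel)"
      by (rule nn_integral_cmult) measurable
    also have "\<dots> = ennreal (exp (- v * r)) * indicator {0..} r * ennreal (exp (- r))"
      by (cases "0 \<le> r") (simp_all add: tail)
    finally show "(\<integral>\<^sup>+t. ennreal (exponential_density 1 t) * ((if 0 \<le> r \<and> r < t then 1 else 0) * ennreal (exp (- v * r))) \<partial>lborel)
      = ennreal (exp (- v * r)) * indicator {0..} r * ennreal (exp (- r))" .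
  qed
  also have "\<dots> = (\<integral>\<^sup>+t. ennreal (exp (- v * t)) \<partial>density lborel (exponential_density 1))"
    by (subst nn_integral_density)
       (auto simp: exponential_density_def mult_ac intro!: nn_integral_cong split: split_indicator)
  finally show ?thesis unfolding nn_integral_exponential_laplace[OF v] .
qed

section \<open>Exponential weight of a single trajectory\<close>

context killed_network
begin

abbreviation jumps :: "(nat \<times> 'x \<Rightarrow> 'x option) measure" where
  "jumps \<equiv> PiM UNIV (\<lambda>(n, z). measure_pmf (jump_pmf C \<kappa> z))"

abbreviation holds :: "(nat \<Rightarrow> real) measure" where
  "holds \<equiv> PiM UNIV (\<lambda>n. density lborel (exponential_density 1))"

sublocale holds: prob_space holds
  by (intro prob_space_PiM prob_space_exponential_density) simp

sublocale jumps: prob_space jumps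
  by (intro prob_space_PiM) (auto simp: prob_space_measure_pmf)

sublocale driving: prob_space "driving_space C \<kappa>"
proof -
  interpret P: pair_prob_space jumps holds ..
  show "prob_space (driving_space C \<kappa>)" unfolding driving_space_def by unfold_locales
qed

lemma nn_integral_driving:
  assumes "f \<in> borel_measurable (driving_space C \<kappa>)"
  shows "(\<integral>\<^sup>+\<omega>. f \<omega> \<partial>driving_space C \<kappa>) = (\<integral>\<^sup>+U. \<integral>\<^sup>+\<tau>. f (U, \<tau>) \<partial>holds \<partial>jumps)"
  using assms unfolding driving_space_def by (intro holds.nn_integral_fst[symmetric]) auto

lemma pmf_jump_Some: "pmf (jump_pmf C \<kappa> x) (Some y) = C x y / lam x"
proof -
  have "(\<integral>\<^sup>+z. ennreal (case z of None \<Rightarrow> \<kappa> x / lam x | Some y \<Rightarrow> C x y / lam x) \<partial>count_space UNIV)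
      = ennreal (\<kappa> x / lam x) + (\<Sum>y\<in>UNIV. ennreal (C x y / lam x))"
    by (subst nn_integral_count_space_finite) (simp_all add: UNIV_option_conv sum.reindex)
  also have "\<dots> = ennreal ((\<kappa> x + (\<Sum>y\<in>UNIV. C x y)) / lam x)"
    using lam_pos[of x] \<kappa>_nonneg[of x] C_nonneg[of x]
    by (simp add: sum_ennreal ennreal_plus[symmetric] sum_nonneg add_divide_distrib sum_divide_distrib less_imp_le del: ennreal_plus)
  also have "\<dots> = 1" using lam_pos[of x] by (simp add: total_rate_def)
  finally show ?thesis
    unfolding jump_pmf_def using lam_pos[of x] \<kappa>_nonneg[of x] C_nonneg[of x]
    by (subst pmf_embed_pmf) (auto split: option.split simp: less_imp_le)
qed

text \<open>The rate at which the pairing of q with the occupation field grows while the chain sits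
  at z; the division comes from the normalisation in \<open>occupation\<close>.\<close>

definition pot :: "('x \<Rightarrow> real) \<Rightarrow> 'x option \<Rightarrow> real" where
  "pot q z = (case z of None \<Rightarrow> 0 | Some z \<Rightarrow> q z / lam z)"

text \<open>Collects the n completed holding periods only; the period in the current state
  \<open>skeleton x U n\<close> is kept apart.\<close>

definition skeleton_weight :: "('x \<Rightarrow> real) \<Rightarrow> 'x \<Rightarrow> nat \<Rightarrow> (nat \<times> 'x \<Rightarrow> 'x option) \<Rightarrow> (nat \<Rightarrow> real) \<Rightarrow> real" where
  "skeleton_weight q x n U \<tau> = (\<Prod>i<n. exp (- pot q (skeleton x U i) * \<tau> i))"

lemma has_bochner_integral_chain:
  fixes V :: "'x option \<Rightarrow> real"
  assumes \<tau>: "\<And>i. 0 < \<tau> i" and t: "(\<Sum>i<n. \<tau> i) \<le> t" "t < (\<Sum>i<Suc n. \<tau> i)"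
  shows "has_bochner_integral lborel (\<lambda>s. indicator {0..t} s * V (chain x (U, \<tau>) s))
     ((\<Sum>i<n. V (skeleton x U i) * \<tau> i) + V (skeleton x U n) * (t - (\<Sum>i<n. \<tau> i)))"
proof -
  define S where "S n = (\<Sum>i<n. \<tau> i)" for n
  have S_mono: "m \<le> n \<Longrightarrow> S m \<le> S n" for m n
    unfolding S_def using \<tau> by (intro sum_mono2) (auto intro: less_imp_le)
  have S0: "0 \<le> S n" for n using S_mono[of 0 n] by (simp add: S_def)
  have chain: "chain x (U, \<tau>) s = skeleton x U n" if "S n \<le> s" "s < S (Suc n)" for s n
  proof (rule chain_eq_skeletonI)
    show "s < sum \<tau> {..n}" using that by (simp add: S_def lessThan_Suc_atMost)
    show "sum \<tau> {..m} \<le> s" if "m < n" for m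
      using S_mono[of "Suc m" n] that \<open>S n \<le> s\<close> by (simp add: S_def lessThan_Suc_atMost)
  qed
  have piece: "has_bochner_integral lborel (\<lambda>s. indicator I s * V (chain x (U, \<tau>) s)) (V (skeleton x U n) * c)"
    if I: "I \<in> sets borel" "emeasure lborel I = ennreal c" "0 \<le> c" "\<And>s. s \<in> I \<Longrightarrow> S n \<le> s \<and> s < S (Suc n)" for I n c
  proof -
    have "has_bochner_integral lborel (indicator I :: real \<Rightarrow> real) c"
      using I has_bochner_integral_real_indicator[of I lborel] by (simp add: measure_def)
    then have "has_bochner_integral lborel (\<lambda>s. V (skeleton x U n) * indicator I s) (V (skeleton x U n) * c)"
      by (rule has_bochner_integral_mult_right)
    also have "(\<lambda>s. V (skeleton x U n) * indicator I s) = (\<lambda>s. indicator I s * V (chain x (U, \<tau>) s))"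
    proof (rule ext)
      fix s
      have "s \<in> I \<Longrightarrow> chain x (U, \<tau>) s = skeleton x U n" using I(4)[of s] chain[of n s] by simp
      then show "V (skeleton x U n) * indicator I s = indicator I s * V (chain x (U, \<tau>) s)"
        by (auto split: split_indicator)
    qed
    finally show ?thesis .
  qed
  have full: "has_bochner_integral lborel (\<lambda>s. indicator {0..<S n} s * V (chain x (U, \<tau>) s))
      (\<Sum>i<n. V (skeleton x U i) * \<tau> i)" for n
  proof (induction n)
    case 0 then show ?case by (simp add: S_def has_bochner_integral_zero)
  next
    case (Suc n)
    have "has_bochner_integral lborel (\<lambda>s. indicator {S n..<S (Suc n)} s * V (chain x (U, \<tau>) s)) (V (skeleton x U n) * \<tau> n)"
      using \<tau>[of n] by (intro piece) (auto simp: S_def)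
    from has_bochner_integral_add[OF Suc this]
    have "has_bochner_integral lborel (\<lambda>s. indicator {0..<S n} s * V (chain x (U, \<tau>) s) + indicator {S n..<S (Suc n)} s * V (chain x (U, \<tau>) s))
      (\<Sum>i<Suc n. V (skeleton x U i) * \<tau> i)" by simp
    also have "(\<lambda>s. indicator {0..<S n} s * V (chain x (U, \<tau>) s) + indicator {S n..<S (Suc n)} s * V (chain x (U, \<tau>) s))
       = (\<lambda>s. indicator {0..<S (Suc n)} s * V (chain x (U, \<tau>) s))"
      using S0[of n] S_mono[of n "Suc n"] by (auto simp: fun_eq_iff split: split_indicator)
    finally show ?case .
  qed
  have "has_bochner_integral lborel (\<lambda>s. indicator {S n..t} s * V (chain x (U, \<tau>) s)) (V (skeleton x U n) * (t - S n))"
    using t by (intro piece) (auto simp: S_def)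
  from has_bochner_integral_add[OF full[of n] this]
  have "has_bochner_integral lborel (\<lambda>s. indicator {0..<S n} s * V (chain x (U, \<tau>) s) + indicator {S n..t} s * V (chain x (U, \<tau>) s))
     ((\<Sum>i<n. V (skeleton x U i) * \<tau> i) + V (skeleton x U n) * (t - S n))" .
  also have "(\<lambda>s. indicator {0..<S n} s * V (chain x (U, \<tau>) s) + indicator {S n..t} s * V (chain x (U, \<tau>) s))
    = (\<lambda>s. indicator {0..t} s * V (chain x (U, \<tau>) s))"
    using S0[of n] t by (auto simp: fun_eq_iff S_def split: split_indicator)
  finally show ?thesis by (simp add: S_def)
qed

text \<open>Cutting \<open>{0..t}\<close> at the jump times, completed periods contribute
  \<open>skeleton_weight\<close> and the interrupted period at y the remaining exponential.\<close>

lemma field_exp_occupation_chain_path: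
  assumes \<tau>: "\<And>i. 0 < \<tau> i" and t: "(\<Sum>i<n. \<tau> i) \<le> t" "t < (\<Sum>i<Suc n. \<tau> i)"
    and y: "skeleton x U n = Some y"
  shows "field_exp q (occupation C \<kappa> (chain_path x t (U, \<tau>)))
    = skeleton_weight q x n U \<tau> * exp (- (q y / lam y) * (t - (\<Sum>i<n. \<tau> i)))"
proof -
  let ?I = "\<lambda>z w. indicator {Some z} w :: real"
  have ct: "chain x (U, \<tau>) t = Some y"
  proof (unfold y[symmetric], rule chain_eq_skeletonI)
    show "t < sum \<tau> {..n}" using t by (simp add: lessThan_Suc_atMost)
    show "sum \<tau> {..m} \<le> t" if "m < n" for m
    proof -
      have "sum \<tau> {..m} \<le> sum \<tau> {..<n}" using \<tau> that by (intro sum_mono2) (auto intro: less_imp_le)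
      then show ?thesis using t by simp
    qed
  qed
  have occ: "occupation C \<kappa> (chain_path x t (U, \<tau>)) $ z =
    ((\<Sum>i<n. ?I z (skeleton x U i) * \<tau> i) + ?I z (Some y) * (t - (\<Sum>i<n. \<tau> i))) / lam z" for z
  proof -
    have "(LINT s:{0..t}|lborel. indicator {z} (snd (chain_path x t (U, \<tau>)) s))
      = (LINT s|lborel. indicator {0..t} s * ?I z (chain x (U, \<tau>) s))"
      unfolding set_lebesgue_integral_def
    proof (rule Bochner_Integration.integral_cong)
      fix s
      show "indicat_real {0..t} s *\<^sub>R indicator {z} (snd (chain_path x t (U, \<tau>)) s) = indicator {0..t} s * ?I z (chain x (U, \<tau>) s)"
        using chain_alive_before[of x "(U, \<tau>)" t s] ct
        by (auto simp: chain_path_def split: split_indicator)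
    qed simp
    also have "\<dots> = (\<Sum>i<n. ?I z (skeleton x U i) * \<tau> i) + ?I z (skeleton x U n) * (t - (\<Sum>i<n. \<tau> i))"
      by (rule has_bochner_integral_integral_eq[OF has_bochner_integral_chain[OF \<tau> t]])
    finally show ?thesis by (simp add: occupation_def chain_path_def y)
  qed
  have pot: "pot q w = (\<Sum>z\<in>UNIV. q z / lam z * ?I z w)" for w
  proof (cases w)
    case None then show ?thesis by (simp add: pot_def)
  next
    case (Some a)
    have "(\<Sum>z\<in>UNIV. q z / lam z * ?I z w) = (\<Sum>z\<in>UNIV. if z = a then q z / lam z else 0)"
      by (intro sum.cong) (auto simp: Some)
    then show ?thesis by (simp add: pot_def Some)
  qed
  have "(\<Sum>z\<in>UNIV. q z * occupation C \<kappa> (chain_path x t (U, \<tau>)) $ z)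
    = (\<Sum>i<n. pot q (skeleton x U i) * \<tau> i) + pot q (Some y) * (t - (\<Sum>i<n. \<tau> i))"
  proof -
    have "q z * occupation C \<kappa> (chain_path x t (U, \<tau>)) $ z
      = (\<Sum>i<n. q z / lam z * ?I z (skeleton x U i) * \<tau> i) + q z / lam z * ?I z (Some y) * (t - (\<Sum>i<n. \<tau> i))" for z
    proof -
      have "(\<Sum>i<n. q z / lam z * ?I z (skeleton x U i) * \<tau> i) = q z / lam z * (\<Sum>i<n. ?I z (skeleton x U i) * \<tau> i)"
        by (simp only: sum_distrib_left mult.assoc)
      then show ?thesis unfolding occ by (simp add: add_divide_distrib distrib_left)
    qed
    then have "(\<Sum>z\<in>UNIV. q z * occupation C \<kappa> (chain_path x t (U, \<tau>)) $ z)
      = (\<Sum>z\<in>UNIV. \<Sum>i<n. q z / lam z * ?I z (skeleton x U i) * \<tau> i)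
        + (\<Sum>z\<in>UNIV. q z / lam z * ?I z (Some y) * (t - (\<Sum>i<n. \<tau> i)))"
      by (simp only: sum.distrib)
    also have "\<dots> = (\<Sum>i<n. pot q (skeleton x U i) * \<tau> i) + pot q (Some y) * (t - (\<Sum>i<n. \<tau> i))"
      unfolding pot sum_distrib_right by (subst sum.swap) (rule refl)
    finally show ?thesis .
  qed
  then show ?thesis
    unfolding field_exp_def skeleton_weight_def
    by (simp add: exp_add[symmetric] exp_sum[symmetric] sum_negf pot_def)
qed

end

section \<open>Neumann series over the number of jumps\<close>

context killed_network
begin

lemma measurable_hold: "(\<lambda>\<tau>. \<tau> i) \<in> borel_measurable holds"
  using measurable_component_singleton[of i UNIV "\<lambda>n::nat. density lborel (exponential_density 1)"] by simp

lemma measurable_jump: "(\<lambda>U. U (n, z)) \<in> jumps \<rightarrow>\<^sub>M count_space UNIV"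
  using measurable_component_singleton[of "(n, z)" UNIV "\<lambda>(n, z). measure_pmf (jump_pmf C \<kappa> z)"] by simp

lemma measurable_skeleton_weight[measurable]:
  "(\<lambda>(U, \<tau>). skeleton_weight q x n U \<tau>) \<in> borel_measurable (jumps \<Otimes>\<^sub>M holds)"
proof -
  have [measurable]: "(\<lambda>w. pot q (skeleton x (fst w) i)) \<in> borel_measurable (jumps \<Otimes>\<^sub>M holds)" for i
    by (rule measurable_compose[OF measurable_compose[OF measurable_fst measurable_skeleton]]) simp
  moreover have "(\<lambda>w. snd w i) \<in> borel_measurable (jumps \<Otimes>\<^sub>M holds)" for i
    by (rule measurable_compose[OF measurable_snd measurable_hold])
  ultimately show ?thesis
    unfolding skeleton_weight_def case_prod_beta
    by (intro borel_measurable_prod borel_measurable_exp[THEN measurable_compose[rotated]]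
         borel_measurable_times borel_measurable_uminus)
qed

lemma measurable_skeleton_weight_holds[measurable]:
  "skeleton_weight q x n U \<in> borel_measurable holds"
  unfolding skeleton_weight_def[abs_def] by measurable

lemma skeleton_weight_nonneg: "0 \<le> skeleton_weight q x n U \<tau>"
  by (simp add: skeleton_weight_def prod_nonneg)

text \<open>The (x, y) entry of the n-th power of D P, where P is the jump matrix and D is diagonal
  with entries \<open>1 / (1 + q z / lam z)\<close>, the mean damping in one holding period.\<close>

definition skeleton_mass :: "('x \<Rightarrow> real) \<Rightarrow> 'x \<Rightarrow> nat \<Rightarrow> 'x \<Rightarrow> ennreal" where
  "skeleton_mass q x n y =
     (\<integral>\<^sup>+U. \<integral>\<^sup>+\<tau>. indicator {Some y} (skeleton x U n) * ennreal (skeleton_weight q x n U \<tau>) \<partial>holds \<partial>jumps)"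

lemma skeleton_mass_0: "skeleton_mass q x 0 y = (if x = y then 1 else 0)"
  by (simp add: skeleton_mass_def skeleton_weight_def holds.emeasure_space_1 jumps.emeasure_space_1)

text \<open>\<open>skeleton_weight\<close> with n periods reads only the holding times of index
  below n, so the n-th one is independent of it.\<close>

lemma nn_integral_holds_coordinate:
  assumes "g \<in> borel_measurable borel"
  shows "(\<integral>\<^sup>+\<tau>. ennreal (skeleton_weight q x n U \<tau>) * g (\<tau> n) \<partial>holds)
    = (\<integral>\<^sup>+\<tau>. ennreal (skeleton_weight q x n U \<tau>) \<partial>holds) * (\<integral>\<^sup>+t. g t \<partial>density lborel (exponential_density 1))"
proof (rule nn_integral_PiM_coordinate)
  show "prob_space (density lborel (exponential_density 1))"
    by (rule prob_space_exponential_density) simp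
  show "g \<in> borel_measurable (density lborel (\<lambda>x. ennreal (exponential_density 1 x)))" using assms by simp
qed (auto simp: skeleton_weight_def)

text \<open>The state after i jumps uses instructions of index below i only; hence the n-th
  instruction is still fresh when the n-th state is known.\<close>

lemma skeleton_upd: "i \<le> n \<Longrightarrow> skeleton x (U((n, z) := u)) i = skeleton x U i"
  by (induction i) (auto cong: bind_option_cong)

lemma skeleton_mass_Suc:
  assumes q: "\<And>x. 0 \<le> q x"
  shows "skeleton_mass q x (Suc n) y
    = (\<Sum>z\<in>UNIV. skeleton_mass q x n z * ennreal (1 / (1 + q z / lam z) * (C z y / lam z)))"
proof -
  let ?w = "skeleton_weight q x n" and ?D = "\<lambda>z. ennreal (1 / (1 + q z / lam z))"
  let ?A = "\<lambda>z U. indicator {Some z} (skeleton x U n) * (\<integral>\<^sup>+\<tau>. ennreal (?w U \<tau>) \<partial>holds)"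
  have v: "0 \<le> q z / lam z" for z using q lam_pos[of z] by (simp add: less_imp_le)
  \<comment> \<open>Splitting over the current state z replaces the random coordinate consulted at
    step n by the fixed one \<open>(n, z)\<close>, to which independence of coordinates
    applies.\<close>
  have expand: "indicator {Some y} (skeleton x U (Suc n)) * ennreal (skeleton_weight q x (Suc n) U \<tau>)
     = (\<Sum>z\<in>UNIV. indicator {Some z} (skeleton x U n) * indicator {Some y} (U (n, z)) *
          (ennreal (?w U \<tau>) * ennreal (exp (- (q z / lam z) * \<tau> n))))" for U \<tau>
  proof (cases "skeleton x U n")
    case None then show ?thesis by simp
  next
    case (Some a)
    have "(\<Sum>z\<in>UNIV. indicator {Some z} (skeleton x U n) * indicator {Some y} (U (n, z)) *
          (ennreal (?w U \<tau>) * ennreal (exp (- (q z / lam z) * \<tau> n))))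
      = (\<Sum>z\<in>UNIV. if z = a then indicator {Some y} (U (n, z)) *
          (ennreal (?w U \<tau>) * ennreal (exp (- (q z / lam z) * \<tau> n))) else 0)"
      by (intro sum.cong) (auto simp: Some)
    then show ?thesis
      by (simp add: Some skeleton_weight_def pot_def ennreal_mult' prod_nonneg)
  qed
  have inner: "(\<integral>\<^sup>+\<tau>. indicator {Some y} (skeleton x U (Suc n)) * ennreal (skeleton_weight q x (Suc n) U \<tau>) \<partial>holds)
     = (\<Sum>z\<in>UNIV. ?D z * (?A z U * indicator {Some y} (U (n, z))))" for U
  proof -
    have "(\<integral>\<^sup>+\<tau>. indicator {Some y} (skeleton x U (Suc n)) * ennreal (skeleton_weight q x (Suc n) U \<tau>) \<partial>holds)
      = (\<Sum>z\<in>UNIV. \<integral>\<^sup>+\<tau>. indicator {Some z} (skeleton x U n) * indicator {Some y} (U (n, z)) *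
          (ennreal (?w U \<tau>) * ennreal (exp (- (q z / lam z) * \<tau> n))) \<partial>holds)"
      unfolding expand by (rule nn_integral_sum) measurable
    also have "\<dots> = (\<Sum>z\<in>UNIV. indicator {Some z} (skeleton x U n) * indicator {Some y} (U (n, z)) *
          ((\<integral>\<^sup>+\<tau>. ennreal (?w U \<tau>) \<partial>holds) * ?D z))"
    proof (rule sum.cong[OF refl])
      fix z
      have "(\<integral>\<^sup>+\<tau>. indicator {Some z} (skeleton x U n) * indicator {Some y} (U (n, z)) *
          (ennreal (?w U \<tau>) * ennreal (exp (- (q z / lam z) * \<tau> n))) \<partial>holds)
        = indicator {Some z} (skeleton x U n) * indicator {Some y} (U (n, z)) *
          (\<integral>\<^sup>+\<tau>. ennreal (?w U \<tau>) * ennreal (exp (- (q z / lam z) * \<tau> n)) \<partial>holds)"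
        by (rule nn_integral_cmult) measurable
      also have "(\<integral>\<^sup>+\<tau>. ennreal (?w U \<tau>) * ennreal (exp (- (q z / lam z) * \<tau> n)) \<partial>holds)
        = (\<integral>\<^sup>+\<tau>. ennreal (?w U \<tau>) \<partial>holds) * ?D z"
        by (subst nn_integral_holds_coordinate) (simp_all only: nn_integral_exponential_laplace[OF v], measurable)
      finally show "(\<integral>\<^sup>+\<tau>. indicator {Some z} (skeleton x U n) * indicator {Some y} (U (n, z)) *
          (ennreal (?w U \<tau>) * ennreal (exp (- (q z / lam z) * \<tau> n))) \<partial>holds)
        = indicator {Some z} (skeleton x U n) * indicator {Some y} (U (n, z)) *
          ((\<integral>\<^sup>+\<tau>. ennreal (?w U \<tau>) \<partial>holds) * ?D z)" .
    qed
    finally show ?thesis by (simp only: mult_ac)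
  qed
  have A[measurable]: "?A z \<in> borel_measurable jumps" for z
    by measurable
  have outer: "(\<integral>\<^sup>+U. ?A z U * indicator {Some y} (U (n, z)) \<partial>jumps) = skeleton_mass q x n z * ennreal (C z y / lam z)" for z
  proof -
    have "(\<integral>\<^sup>+U. ?A z U * indicator {Some y} (U (n, z)) \<partial>jumps)
      = (\<integral>\<^sup>+U. ?A z U \<partial>jumps) * (\<integral>\<^sup>+u. indicator {Some y} u \<partial>(case (n, z) of (n, z) \<Rightarrow> measure_pmf (jump_pmf C \<kappa> z)))"
    proof (rule nn_integral_PiM_coordinate)
      show "prob_space (case i of (n, z) \<Rightarrow> measure_pmf (jump_pmf C \<kappa> z))" for i :: "nat \<times> 'x"
        by (auto simp: prob_space_measure_pmf split: prod.split)
      fix X and u :: "'x option"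
      have "skeleton x (X((n, z) := u)) i = skeleton x X i" if "i \<le> n" for i
        using that by (rule skeleton_upd)
      then show "?A z (X((n, z) := u)) = ?A z X"
        by (simp add: skeleton_weight_def)
    qed auto
    also have "(\<integral>\<^sup>+u. indicator {Some y} u \<partial>(case (n, z) of (n, z) \<Rightarrow> measure_pmf (jump_pmf C \<kappa> z))) = ennreal (C z y / lam z)"
      by (simp add: emeasure_pmf_single pmf_jump_Some)
    also have "(\<integral>\<^sup>+U. ?A z U \<partial>jumps) = skeleton_mass q x n z"
      unfolding skeleton_mass_def by (simp add: nn_integral_cmult)
    finally show ?thesis .
  qed
  have "skeleton_mass q x (Suc n) y = (\<integral>\<^sup>+U. (\<Sum>z\<in>UNIV. ?D z * (?A z U * indicator {Some y} (U (n, z)))) \<partial>jumps)"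
    unfolding skeleton_mass_def inner ..
  also have "\<dots> = (\<Sum>z\<in>UNIV. ?D z * (\<integral>\<^sup>+U. ?A z U * indicator {Some y} (U (n, z)) \<partial>jumps))"
  proof -
    have m: "(\<lambda>U. ?A z U * indicator {Some y} (U (n, z))) \<in> borel_measurable jumps" for z
      using measurable_jump[measurable] by measurable
    have "(\<integral>\<^sup>+U. (\<Sum>z\<in>UNIV. ?D z * (?A z U * indicator {Some y} (U (n, z)))) \<partial>jumps)
      = (\<Sum>z\<in>UNIV. \<integral>\<^sup>+U. ?D z * (?A z U * indicator {Some y} (U (n, z))) \<partial>jumps)"
      by (rule nn_integral_sum) (intro borel_measurable_times_ennreal borel_measurable_const m)
    then show ?thesis by (simp only: nn_integral_cmult[OF m])
  qed
  also have "\<dots> = (\<Sum>z\<in>UNIV. skeleton_mass q x n z * ennreal (1 / (1 + q z / lam z) * (C z y / lam z)))"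
  proof (rule sum.cong[OF refl])
    fix z
    have "ennreal (1 / (1 + q z / lam z) * (C z y / lam z)) = ?D z * ennreal (C z y / lam z)"
      using v[of z] by (intro ennreal_mult) (auto simp: C_nonneg less_imp_le[OF lam_pos])
    then show "?D z * (\<integral>\<^sup>+U. ?A z U * indicator {Some y} (U (n, z)) \<partial>jumps)
      = skeleton_mass q x n z * ennreal (1 / (1 + q z / lam z) * (C z y / lam z))"
      unfolding outer by (simp only: mult_ac)
  qed
  finally show ?thesis .
qed

text \<open>The series of (D P)^n D solves the fixed point equation of
  \<open>lam y * W q x y\<close>. Since the solution is unique only among finite rows, finiteness is
  secured first, by domination.\<close>

lemma suminf_skeleton_mass:
  assumes q: "\<And>x. 0 \<le> q x"
  shows "(\<Sum>n. skeleton_mass q x n y * ennreal (1 / (1 + q y / lam y))) = ennreal (lam y * W q x y)"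
proof -
  let ?D = "\<lambda>z. 1 / (1 + q z / lam z)" and ?P = "\<lambda>z y. C z y / lam z"
  define w where "w y = lam y * W q x y" for y
  define N where "N y = (\<Sum>n. skeleton_mass q x n y * ennreal (?D y))" for y
  have v: "0 \<le> q z / lam z" for z using q lam_pos[of z] by (simp add: less_imp_le)
  have D: "0 \<le> ?D z" for z using v[of z] by simp
  have P: "0 \<le> ?P z y" for z y using C_nonneg lam_pos[of z] by (simp add: less_imp_le)
  have w0: "0 \<le> w y" for y using W_nonneg[OF q] lam_pos[of y] by (simp add: w_def less_imp_le)
  have wP: "0 \<le> w z * C z y / lam z" for z y
    using w0[of z] P[of z y] by (simp add: times_divide_eq_right[symmetric] del: times_divide_eq_right)
  \<comment> \<open>The column equation of the resolvent, rewritten in terms of the jump matrix and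
    the damping.\<close>
  have w_eq: "w y = ?D y * ((if x = y then 1 else 0) + (\<Sum>z\<in>UNIV. w z * ?P z y))" for y
  proof -
    have "(\<Sum>z\<in>UNIV. w z * ?P z y) = (\<Sum>z\<in>UNIV. W q x z * C z y)"
      using lam_pos by (intro sum.cong) (auto simp: w_def less_imp_neq[symmetric])
    also have "\<dots> = W q x y * (lam y + q y) - (if x = y then 1 else 0)"
      using W_right[where q = q, OF q, of x y] by simp
    also have "W q x y * (lam y + q y) = w y * (1 + q y / lam y)"
      using lam_pos[of y] by (simp add: w_def field_simps)
    finally have "(if x = y then 1 else 0) + (\<Sum>z\<in>UNIV. w z * ?P z y) = w y * (1 + q y / lam y)" by simp
    moreover have "1 + q y / lam y \<noteq> 0" using v[of y] by linarith
    ultimately show ?thesis by simp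
  qed
  have step: "skeleton_mass q x (Suc n) y * ennreal (?D y)
     = ennreal (?D y) * (\<Sum>z\<in>UNIV. (skeleton_mass q x n z * ennreal (?D z)) * ennreal (?P z y))" for n y
    unfolding skeleton_mass_Suc[OF q] ennreal_mult[OF D P] by (simp only: mult_ac)
  have zero: "skeleton_mass q x 0 y * ennreal (?D y) = ennreal (?D y) * (if x = y then 1 else 0)" for y
    unfolding skeleton_mass_0 by (simp add: mult.commute)
  \<comment> \<open>Partial sums arise by iterating a monotone affine map from 0, so they stay below
    its nonnegative fixed point w.\<close>
  have part: "(\<Sum>n<k. skeleton_mass q x n y * ennreal (?D y)) \<le> ennreal (w y)" for k y
  proof (induction k arbitrary: y)
    case (Suc k)
    have "(\<Sum>n<Suc k. skeleton_mass q x n y * ennreal (?D y))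
       = skeleton_mass q x 0 y * ennreal (?D y) + (\<Sum>n<k. skeleton_mass q x (Suc n) y * ennreal (?D y))"
      by (rule sum.lessThan_Suc_shift)
    also have "\<dots> = ennreal (?D y) * ((if x = y then 1 else 0) +
        (\<Sum>z\<in>UNIV. (\<Sum>n<k. skeleton_mass q x n z * ennreal (?D z)) * ennreal (?P z y)))"
      unfolding step zero sum_distrib_left[symmetric] distrib_left[symmetric] sum_distrib_right
      by (subst sum.swap) (rule refl)
    also have "\<dots> \<le> ennreal (?D y) * ((if x = y then 1 else 0) + (\<Sum>z\<in>UNIV. ennreal (w z) * ennreal (?P z y)))"
      by (intro mult_left_mono add_left_mono sum_mono mult_right_mono Suc) auto
    also have "(\<Sum>z\<in>UNIV. ennreal (w z) * ennreal (?P z y)) = ennreal (\<Sum>z\<in>UNIV. w z * ?P z y)"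
      using w0 P by (subst sum_ennreal[symmetric]) (simp_all only: ennreal_mult mult_nonneg_nonneg)
    also have "(if x = y then 1 else 0) + \<dots> = ennreal ((if x = y then 1 else 0) + (\<Sum>z\<in>UNIV. w z * ?P z y))"
      using wP by (subst ennreal_plus) (auto intro!: sum_nonneg)
    also have "ennreal (?D y) * \<dots> = ennreal (w y)"
      unfolding w_eq[of y] using wP D[of y]
      by (intro ennreal_mult[symmetric]) (auto intro!: sum_nonneg add_nonneg_nonneg)
    finally show ?case .
  qed simp
  have N_le: "N y \<le> ennreal (w y)" for y
    unfolding N_def suminf_eq_SUP by (rule SUP_least) (rule part)
  have N_eq: "N y = ennreal (?D y) * ((if x = y then 1 else 0) + (\<Sum>z\<in>UNIV. N z * ennreal (?P z y)))" for y
  proof -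
    have "N y = skeleton_mass q x 0 y * ennreal (?D y) + (\<Sum>n. skeleton_mass q x (Suc n) y * ennreal (?D y))"
      unfolding N_def
      using sums_unique[OF sums_Suc[OF summable_sums[OF summableI]], of "\<lambda>n. skeleton_mass q x n y * ennreal (?D y)"]
      by (simp only: add.commute)
    also have "(\<Sum>n. skeleton_mass q x (Suc n) y * ennreal (?D y))
        = ennreal (?D y) * (\<Sum>z\<in>UNIV. (\<Sum>n. skeleton_mass q x n z * ennreal (?D z)) * ennreal (?P z y))"
      unfolding step by (simp only: ennreal_suminf_cmult ennreal_suminf_multc suminf_sum[OF summableI])
    finally show ?thesis unfolding zero N_def[symmetric] by (simp only: distrib_left)
  qed
  \<comment> \<open>Being bounded by w, the sums are finite, and the equation can be moved to the
    reals, where subtraction and \<open>W_unique\<close> are available.\<close>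
  define n where "n y = enn2real (N y)" for y
  have n: "N y = ennreal (n y)" for y
    unfolding n_def using N_le[of y] by (intro ennreal_enn2real[symmetric]) (rule le_less_trans[OF _ ennreal_less_top])
  have n0: "0 \<le> n y" for y by (simp add: n_def)
  have nP: "0 \<le> n z * C z y / lam z" for z y
    using n0[of z] P[of z y] by (simp add: times_divide_eq_right[symmetric] del: times_divide_eq_right)
  have n_eq: "n y = ?D y * ((if x = y then 1 else 0) + (\<Sum>z\<in>UNIV. n z * ?P z y))" for y
  proof -
    have nn: "0 \<le> (if x = y then 1 else 0) + (\<Sum>z\<in>UNIV. n z * ?P z y)"
      using nP by (auto intro!: sum_nonneg add_nonneg_nonneg)
    have s: "(\<Sum>z\<in>UNIV. ennreal (n z) * ennreal (?P z y)) = ennreal (\<Sum>z\<in>UNIV. n z * ?P z y)"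
      using n0 P by (subst sum_ennreal[symmetric]) (simp_all only: ennreal_mult mult_nonneg_nonneg)
    have "ennreal (n y) = ennreal (?D y) * ((if x = y then 1 else 0) + ennreal (\<Sum>z\<in>UNIV. n z * ?P z y))"
      using N_eq[of y] unfolding n s .
    also have "(if x = y then 1 else 0) + ennreal (\<Sum>z\<in>UNIV. n z * ?P z y) = ennreal ((if x = y then 1 else 0) + (\<Sum>z\<in>UNIV. n z * ?P z y))"
      using nP by (subst ennreal_plus) (auto intro!: sum_nonneg)
    also have "ennreal (?D y) * \<dots> = ennreal (?D y * ((if x = y then 1 else 0) + (\<Sum>z\<in>UNIV. n z * ?P z y)))"
      using D[of y] nn by (rule ennreal_mult[symmetric])
    finally show ?thesis using n0 D[of y] nn by (subst (asm) ennreal_inj) (auto intro: mult_nonneg_nonneg)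
  qed
  have "n y / lam y = 1 * W q x y"
  proof (rule W_unique[where v = "\<lambda>y. n y / lam y", OF q])
    fix y
    have ne: "1 + q y / lam y \<noteq> 0" using v[of y] by linarith
    have "n y * (1 + q y / lam y) = (if x = y then 1 else 0) + (\<Sum>z\<in>UNIV. n z * ?P z y)"
      by (subst n_eq) (use ne in simp)
    moreover have "n y * (1 + q y / lam y) = n y / lam y * (lam y + q y)"
      using lam_pos[of y] by (simp add: field_simps)
    ultimately show "n y / lam y * (lam y + q y) - (\<Sum>z\<in>UNIV. n z / lam z * C z y) = 1 * (if x = y then 1 else 0)"
      by simp
  qed
  then have "n y = lam y * W q x y" using lam_pos[of y] by (simp add: field_simps)
  then show ?thesis using n[of y] by (simp add: N_def)
qed

lemma AE_holds_pos: "AE \<tau> in holds. \<forall>i. 0 < \<tau> i"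
proof (subst AE_all_countable, intro allI)
  fix i :: nat
  have "AE t in density lborel (exponential_density 1). 0 < t"
    using AE_lborel_singleton[of 0] by (subst AE_density) (auto simp: exponential_density_def)
  then show "AE \<tau> in holds. 0 < \<tau> i"
    by (intro AE_PiM_component[where P = "\<lambda>t. 0 < t"] prob_space_exponential_density) auto
qed

text \<open>Time is partitioned by the number n of jumps made so far, and t is replaced by the
  elapsed part r = t - \<open>S n\<close> of the current holding period.\<close>

lemma chain_time_integral:
  assumes \<tau>: "\<And>i. 0 < \<tau> i" and U: "U \<in> space jumps" "\<tau> \<in> space holds"
  shows "(\<integral>\<^sup>+t. indicator {0<..} t * (indicator {Some y} (chain x (U, \<tau>) t) *
            ennreal (field_exp q (occupation C \<kappa> (chain_path x t (U, \<tau>))))) \<partial>lborel)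
    = (\<Sum>n. indicator {Some y} (skeleton x U n) * (ennreal (skeleton_weight q x n U \<tau>) *
         (\<integral>\<^sup>+r. indicator {0..<\<tau> n} r * ennreal (exp (- (q y / lam y) * r)) \<partial>lborel)))"
proof -
  define S where "S n = (\<Sum>i<n. \<tau> i)" for n
  have S_mono: "m \<le> n \<Longrightarrow> S m \<le> S n" for m n
    unfolding S_def using \<tau> by (intro sum_mono2) (auto intro: less_imp_le)
  have S0: "0 \<le> S n" for n using S_mono[of 0 n] by (simp add: S_def)
  let ?g = "\<lambda>n t. indicator {Some y} (skeleton x U n) * (ennreal (skeleton_weight q x n U \<tau>) *
      (indicator {0..<\<tau> n} (t - S n) * ennreal (exp (- (q y / lam y) * (t - S n)))))"
  have gm: "(\<lambda>t. indicator {0..<a} (t - b) * ennreal (exp (- c * (t - b)))) \<in> borel_measurable lborel" for a b c :: real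
  proof -
    have "indicator {0..<a} (t - b) = (indicator {b..<b + a} t :: ennreal)" for t
      by (auto split: split_indicator)
    moreover have "(\<lambda>t. indicator {b..<b + a} t * ennreal (exp (- c * (t - b)))) \<in> borel_measurable lborel"
      by measurable
    ultimately show ?thesis by simp
  qed
  have gmeas: "?g n \<in> borel_measurable lborel" for n
    by (intro borel_measurable_times_ennreal borel_measurable_const gm)
  \<comment> \<open>At t = 0 the term n = 0 need not vanish while the left side does; the
    exceptional point is a null set.\<close>
  have point: "indicator {0<..} t * (indicator {Some y} (chain x (U, \<tau>) t) *
            ennreal (field_exp q (occupation C \<kappa> (chain_path x t (U, \<tau>))))) = (\<Sum>n. ?g n t)" if "t \<noteq> 0" for t
  proof (cases "\<exists>n. S n \<le> t \<and> t < S (Suc n)")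
    case True
    then obtain n where n: "S n \<le> t" "t < S (Suc n)" by auto
    have t: "0 < t" using n(1) S0[of n] that by simp
    have other: "?g m t = 0" if "m \<noteq> n" for m
    proof -
      have "t - S m \<notin> {0..<\<tau> m}"
      proof (cases "m < n")
        case True then show ?thesis using S_mono[of "Suc m" n] n by (auto simp: S_def)
      next
        case False then show ?thesis using S_mono[of "Suc n" m] n that by auto
      qed
      then show ?thesis by simp
    qed
    have ch: "chain x (U, \<tau>) t = skeleton x U n"
    proof (rule chain_eq_skeletonI)
      show "t < sum \<tau> {..n}" using n by (simp add: S_def lessThan_Suc_atMost)
      show "sum \<tau> {..m} \<le> t" if "m < n" for m
        using S_mono[of "Suc m" n] that n by (simp add: S_def lessThan_Suc_atMost)
    qed
    have "(\<Sum>n. ?g n t) = ?g n t"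
    proof -
      have "(\<Sum>n. ?g n t) = (\<Sum>n\<in>{n}. ?g n t)"
      proof (rule suminf_finite)
        show "?g m t = 0" if "m \<notin> {n}" for m by (rule other) (use that in simp)
      qed simp
      then show ?thesis by (simp only: sum.insert[OF finite.emptyI] sum.empty empty_iff not_False_eq_True add_0_right)
    qed
    also have "\<dots> = indicator {0<..} t * (indicator {Some y} (chain x (U, \<tau>) t) *
            ennreal (field_exp q (occupation C \<kappa> (chain_path x t (U, \<tau>)))))"
    proof (cases "skeleton x U n = Some y")
      case True
      have "t - S n \<in> {0..<\<tau> n}" using n by (auto simp: S_def)
      moreover have "field_exp q (occupation C \<kappa> (chain_path x t (U, \<tau>)))
        = skeleton_weight q x n U \<tau> * exp (- (q y / lam y) * (t - S n))"
        unfolding S_def by (rule field_exp_occupation_chain_path[OF \<tau> _ _ True]) (use n in \<open>auto simp: S_def\<close>)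
      ultimately show ?thesis using t True ch skeleton_weight_nonneg
        by (simp only: indicator_eq_1_iff[THEN iffD2] ennreal_mult' greaterThan_iff singletonI mult_1 indicator_simps(1))
    next
      case False then show ?thesis by (simp add: ch)
    qed
    finally show ?thesis by simp
  next
    case False
    \<comment> \<open>Here t is negative or lies beyond all partial sums, where the chain is in the
      cemetery by definition. Both sides vanish, so possible accumulation of jumps is
      harmless.\<close>
    have "?g m t = 0" for m
      using False by (auto simp: S_def split: split_indicator)
    then have "(\<Sum>n. ?g n t) = 0" by (simp only: suminf_zero)
    moreover have "chain x (U, \<tau>) t = None" if "0 < t"
    proof (rule ccontr)
      assume "chain x (U, \<tau>) t \<noteq> None"
      then have ex: "\<exists>n. t < (\<Sum>i\<le>n. \<tau> i)" by (auto simp: chain_def split: if_splits)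
      define N where "N = (LEAST n. t < (\<Sum>i\<le>n. \<tau> i))"
      have "t < S (Suc N)" using LeastI_ex[OF ex] by (simp add: N_def S_def lessThan_Suc_atMost)
      moreover have "S N \<le> t"
      proof (cases N)
        case 0 then show ?thesis using that by (simp add: S_def)
      next
        case (Suc k)
        then have "\<not> t < (\<Sum>i\<le>k. \<tau> i)" unfolding N_def using not_less_Least lessI by metis
        then show ?thesis by (simp add: Suc S_def lessThan_Suc_atMost)
      qed
      ultimately show False using False by auto
    qed
    then have "indicator {0<..} t * (indicator {Some y} (chain x (U, \<tau>) t) *
            ennreal (field_exp q (occupation C \<kappa> (chain_path x t (U, \<tau>))))) = 0"
      by (cases "0 < t") auto
    ultimately show ?thesis by (simp only: )
  qed
  have "(\<integral>\<^sup>+t. indicator {0<..} t * (indicator {Some y} (chain x (U, \<tau>) t) *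
            ennreal (field_exp q (occupation C \<kappa> (chain_path x t (U, \<tau>))))) \<partial>lborel) = (\<integral>\<^sup>+t. (\<Sum>n. ?g n t) \<partial>lborel)"
    using AE_lborel_singleton[of "0::real"] point by (intro nn_integral_cong_AE) auto
  also have "\<dots> = (\<Sum>n. \<integral>\<^sup>+t. ?g n t \<partial>lborel)"
    by (rule nn_integral_suminf) (rule gmeas)
  also have "\<dots> = (\<Sum>n. indicator {Some y} (skeleton x U n) * (ennreal (skeleton_weight q x n U \<tau>) *
         (\<integral>\<^sup>+r. indicator {0..<\<tau> n} r * ennreal (exp (- (q y / lam y) * r)) \<partial>lborel)))"
  proof (rule suminf_cong)
    fix n
    \<comment> \<open>Translation by \<open>S n\<close>, written as an affine substitution of slope
      1.\<close>
    have "(\<integral>\<^sup>+t. ?g n t \<partial>lborel) = ennreal \<bar>1\<bar> * (\<integral>\<^sup>+r. ?g n (S n + 1 * r) \<partial>lborel)"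
      by (rule nn_integral_real_affine) (use gmeas[of n] in auto)
    also have "\<dots> = (\<integral>\<^sup>+r. indicator {Some y} (skeleton x U n) * (ennreal (skeleton_weight q x n U \<tau>) *
         (indicator {0..<\<tau> n} r * ennreal (exp (- (q y / lam y) * r)))) \<partial>lborel)"
      by simp
    also have "\<dots> = indicator {Some y} (skeleton x U n) * (ennreal (skeleton_weight q x n U \<tau>) *
         (\<integral>\<^sup>+r. indicator {0..<\<tau> n} r * ennreal (exp (- (q y / lam y) * r)) \<partial>lborel))"
      using gm[of "\<tau> n" 0 "q y / lam y"]
      by (simp only: diff_0_right nn_integral_cmult borel_measurable_times_ennreal borel_measurable_const)
    finally show "(\<integral>\<^sup>+t. ?g n t \<partial>lborel) = indicator {Some y} (skeleton x U n) * (ennreal (skeleton_weight q x n U \<tau>) *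
         (\<integral>\<^sup>+r. indicator {0..<\<tau> n} r * ennreal (exp (- (q y / lam y) * r)) \<partial>lborel))" .
  qed
  finally show ?thesis .
qed

end

section \<open>Bridge and loop integrals\<close>

context killed_network
begin

lemma chain_starts_at:
  assumes "\<And>i. 0 < \<tau> i"
  shows "chain x (U, \<tau>) 0 = Some x"
  using chain_eq_skeletonI[where t = 0 and n = 0 and \<tau> = \<tau> and x = x and U = U] assms[of 0] by simp

lemma AE_driving:
  assumes "{\<omega> \<in> space (driving_space C \<kappa>). P \<omega>} \<in> sets (driving_space C \<kappa>)"
    and "\<And>U \<tau>. (\<And>i. 0 < \<tau> i) \<Longrightarrow> P (U, \<tau>)"
  shows "AE \<omega> in driving_space C \<kappa>. P \<omega>"
  unfolding driving_space_def
proof -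
  interpret P: pair_prob_space jumps holds ..
  show "AE \<omega> in jumps \<Otimes>\<^sub>M holds. P \<omega>"
  proof (rule P.AE_pair_measure)
    show "{\<omega> \<in> space (jumps \<Otimes>\<^sub>M holds). P \<omega>} \<in> sets (jumps \<Otimes>\<^sub>M holds)"
      using assms(1) by (simp add: driving_space_def)
    show "AE U in jumps. AE \<tau> in holds. P (U, \<tau>)"
      using AE_holds_pos by (auto elim!: eventually_mono intro!: assms(2))
  qed
qed

lemma AE_chain_starts_at: "AE \<omega> in driving_space C \<kappa>. chain x \<omega> 0 = Some x"
  by (rule AE_driving) (auto simp: chain_starts_at)

text \<open>Integrand over time and driving randomness that represents \<open>lam y\<close> times
  the bridge integral of f. The indicator at time 0 is almost surely 1; together with the others it
  ensures that \<open>safe_path\<close> is evaluated only where it equals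
  \<open>chain_path\<close>.\<close>

definition bridge_density ::
  "('x path \<Rightarrow> ennreal) \<Rightarrow> 'x \<Rightarrow> 'x \<Rightarrow> real \<Rightarrow> 'x driving \<Rightarrow> ennreal" where
  "bridge_density f x y t \<omega> =
     indicator {0<..} t * (indicator {Some y} (chain x \<omega> t) * (indicator {Some x} (chain x \<omega> 0) *
       f (safe_path x (Some y) t \<omega>)))"

lemma bridge_density_eq:
  assumes "chain x \<omega> 0 = Some x"
  shows "bridge_density f x y t \<omega> = indicator {0<..} t * (indicator {Some y} (chain x \<omega> t) * f (chain_path x t \<omega>))"
  using assms by (auto simp: bridge_density_def safe_path_def split: split_indicator)

lemma measurable_bridge_density[measurable (raw)]:
  assumes f: "f \<in> borel_measurable path_space"
    and g[measurable]: "g \<in> M \<rightarrow>\<^sub>M driving_space C \<kappa>" and s[measurable]: "s \<in> borel_measurable M"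
  shows "(\<lambda>\<omega>. bridge_density f x y (s \<omega>) (g \<omega>)) \<in> borel_measurable M"
proof -
  have [measurable]: "(\<lambda>\<omega>. f (safe_path x (Some y) (s \<omega>) (g \<omega>))) \<in> borel_measurable M"
    by (rule measurable_compose[OF measurable_safe_path[OF g s] f])
  have [measurable]: "(\<lambda>\<omega>. chain x (g \<omega>) (s \<omega>)) \<in> M \<rightarrow>\<^sub>M count_space UNIV"
     "(\<lambda>\<omega>. chain x (g \<omega>) 0) \<in> M \<rightarrow>\<^sub>M count_space UNIV"
    by (rule measurable_chain, measurable)+
  have i: "(\<lambda>\<omega>. indicator {Some y} (chain x (g \<omega>) (s \<omega>)) :: ennreal) \<in> borel_measurable M"
    "(\<lambda>\<omega>. indicator {Some x} (chain x (g \<omega>) 0) :: ennreal) \<in> borel_measurable M"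
    by (rule measurable_compose[where N = "count_space UNIV"], measurable)+
  have "(\<lambda>\<omega>. indicator {0<..} (s \<omega>) :: ennreal) \<in> borel_measurable M" by measurable
  then show ?thesis
    unfolding bridge_density_def using i by (intro borel_measurable_times_ennreal) auto
qed

text \<open>The set function in \<open>bridge_at\<close> is a weighted image under
  \<open>safe_path\<close>, up to the null event that the chain does not start at x; hence it really
  is a measure.\<close>

lemma emeasure_bridge_at:
  assumes t: "0 < t" and A: "A \<in> sets path_space"
  shows "emeasure (bridge_at C \<kappa> t x y) A
    = (\<integral>\<^sup>+\<omega>. ennreal (1 / lam y) * bridge_density (indicator A) x y t \<omega> \<partial>driving_space C \<kappa>)"
proof -
  let ?D = "driving_space C \<kappa>"
  let ?w = "\<lambda>\<omega>. ennreal (1 / lam y) * indicator {\<omega> \<in> space ?D. chain x \<omega> 0 = Some x \<and> chain x \<omega> t = Some y} \<omega>"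
  have E: "{\<omega> \<in> space ?D. chain x \<omega> 0 = Some x \<and> chain x \<omega> t = Some y} \<in> sets ?D"
    by measurable
  have inv: "X / ennreal (lam y) = ennreal (1 / lam y) * X" for X
    using lam_pos[of y] by (simp add: divide_ennreal_def inverse_ennreal inverse_eq_divide mult.commute)
  have "(\<integral>\<^sup>+\<gamma>. indicator A \<gamma> \<partial>bridge_at C \<kappa> t x y) = (\<integral>\<^sup>+\<omega>. ?w \<omega> * indicator A (safe_path x (Some y) t \<omega>) \<partial>?D)"
    unfolding bridge_at_def
  proof (rule nn_integral_measure_of_image)
    show T: "safe_path x (Some y) t \<in> ?D \<rightarrow>\<^sub>M path_space"
      by (rule measurable_safe_path[where C = C and \<kappa> = \<kappa>]) simp_all
    show "?w \<in> borel_measurable ?D" using E by measurable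
    show "indicator A \<in> borel_measurable path_space" using A by simp
    fix B :: "'x path set" assume B: "B \<in> sets path_space"
    let ?S = "safe_path x (Some y) t -` B \<inter> space ?D \<inter> {\<omega> \<in> space ?D. chain x \<omega> 0 = Some x \<and> chain x \<omega> t = Some y}"
    have S: "?S \<in> sets ?D" using E measurable_sets[OF T B] by auto
    have "emeasure ?D {\<omega> \<in> space ?D. chain_path x t \<omega> \<in> B \<and> chain x \<omega> t = Some y} = emeasure ?D ?S"
    proof (rule emeasure_eq_AE)
      show "AE \<omega> in ?D. \<omega> \<in> {\<omega> \<in> space ?D. chain_path x t \<omega> \<in> B \<and> chain x \<omega> t = Some y} \<longleftrightarrow> \<omega> \<in> ?S"
        using AE_chain_starts_at[of x] by eventually_elim (auto simp: safe_path_def t)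
      \<comment> \<open>The event in the definition is measurable because \<open>chain_path\<close>
        is measurable on the restricted space where the chain sits at y.\<close>
      have "(\<lambda>\<omega>. chain_path x t \<omega>) \<in> restrict_space ?D {\<omega>. chain x \<omega> t = Some y} \<rightarrow>\<^sub>M path_space"
        by (rule measurable_chain_path[where C = C and \<kappa> = \<kappa>])
           (auto simp: space_restrict_space t intro: measurable_restrict_space1)
      from measurable_sets[OF this B]
      have "chain_path x t -` B \<inter> ({\<omega>. chain x \<omega> t = Some y} \<inter> space ?D) \<in> sets (restrict_space ?D {\<omega>. chain x \<omega> t = Some y})"
        by (simp add: space_restrict_space)
      moreover have "{\<omega>. chain x \<omega> t = Some y} \<inter> space ?D \<in> sets ?D"
      proof -
        have "{\<omega> \<in> space ?D. chain x \<omega> t = Some y} \<in> sets ?D" by measurable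
        then show ?thesis by (simp add: Collect_conj_eq Int_commute)
      qed
      ultimately have "chain_path x t -` B \<inter> ({\<omega>. chain x \<omega> t = Some y} \<inter> space ?D) \<in> sets ?D"
        by (subst (asm) sets_restrict_space_iff) auto
      then show "{\<omega> \<in> space ?D. chain_path x t \<omega> \<in> B \<and> chain x \<omega> t = Some y} \<in> sets ?D"
        by (rule back_subst[where P = "\<lambda>S. S \<in> sets ?D"]) auto
    qed (rule S)
    also have "\<dots> = (\<integral>\<^sup>+\<omega>. indicator ?S \<omega> \<partial>?D)" using S by simp
    finally have "emeasure ?D {\<omega> \<in> space ?D. chain_path x t \<omega> \<in> B \<and> chain x \<omega> t = Some y} / ennreal (lam y)
      = (\<integral>\<^sup>+\<omega>. ennreal (1 / lam y) * indicator ?S \<omega> \<partial>?D)"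
      using S by (simp add: inv nn_integral_cmult)
    also have "\<dots> = (\<integral>\<^sup>+\<omega>. ?w \<omega> * indicator B (safe_path x (Some y) t \<omega>) \<partial>?D)"
      by (intro nn_integral_cong) (auto split: split_indicator)
    finally show "emeasure ?D {\<omega> \<in> space ?D. chain_path x t \<omega> \<in> B \<and> chain x \<omega> t = Some y} / ennreal (lam y)
      = (\<integral>\<^sup>+\<omega>. ?w \<omega> * indicator B (safe_path x (Some y) t \<omega>) \<partial>?D)" .
  qed
  also have "(\<integral>\<^sup>+\<gamma>. indicator A \<gamma> \<partial>bridge_at C \<kappa> t x y) = emeasure (bridge_at C \<kappa> t x y) A"
    using A by (intro nn_integral_indicator)
      (simp only: bridge_at_def sets_measure_of[OF sets.space_closed] sets.sigma_sets_eq)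
  also have "(\<integral>\<^sup>+\<omega>. ?w \<omega> * indicator A (safe_path x (Some y) t \<omega>) \<partial>?D)
    = (\<integral>\<^sup>+\<omega>. ennreal (1 / lam y) * bridge_density (indicator A) x y t \<omega> \<partial>?D)"
    using t by (intro nn_integral_cong) (auto simp: bridge_density_def split: split_indicator)
  finally show ?thesis .
qed

lemma nn_integral_bridge:
  assumes f: "f \<in> borel_measurable path_space"
  shows "(\<integral>\<^sup>+\<gamma>. f \<gamma> \<partial>bridge_measure C \<kappa> x y)
    = ennreal (1 / lam y) * (\<integral>\<^sup>+t. \<integral>\<^sup>+\<omega>. bridge_density f x y t \<omega> \<partial>driving_space C \<kappa> \<partial>lborel)"
proof -
  let ?D = "driving_space C \<kappa>"
  let ?M = "(lborel :: real measure) \<Otimes>\<^sub>M ?D"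
  let ?w = "\<lambda>p. ennreal (1 / lam y) * bridge_density (\<lambda>_. 1) x y (fst p) (snd p)"
  have bd: "bridge_density f x y t \<omega> = bridge_density (\<lambda>_. 1) x y t \<omega> * f (safe_path x (Some y) t \<omega>)" for f t \<omega>
    by (simp add: bridge_density_def mult_ac)
  have m1[measurable]: "fst \<in> ?M \<rightarrow>\<^sub>M borel" "snd \<in> ?M \<rightarrow>\<^sub>M ?D" by simp_all
  have "(\<integral>\<^sup>+\<gamma>. f \<gamma> \<partial>bridge_measure C \<kappa> x y) = (\<integral>\<^sup>+p. ?w p * f (safe_path x (Some y) (fst p) (snd p)) \<partial>?M)"
    unfolding bridge_measure_def
  proof (rule nn_integral_measure_of_image)
    show "(\<lambda>p. safe_path x (Some y) (fst p) (snd p)) \<in> ?M \<rightarrow>\<^sub>M path_space"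
      by (rule measurable_safe_path[OF m1(2,1)])
    show "?w \<in> borel_measurable ?M"
      by (intro borel_measurable_times_ennreal borel_measurable_const measurable_bridge_density m1)
    show "f \<in> borel_measurable path_space" by fact
    fix A :: "'x path set" assume A: "A \<in> sets path_space"
    have ind: "indicator A \<in> borel_measurable path_space" using A by simp
    have "(\<integral>\<^sup>+t\<in>{0<..}. emeasure (bridge_at C \<kappa> t x y) A \<partial>lborel)
      = (\<integral>\<^sup>+t. \<integral>\<^sup>+\<omega>. ennreal (1 / lam y) * bridge_density (indicator A) x y t \<omega> \<partial>?D \<partial>lborel)"
    proof (rule nn_integral_cong)
      fix t :: real
      show "emeasure (bridge_at C \<kappa> t x y) A * indicator {0<..} t
        = (\<integral>\<^sup>+\<omega>. ennreal (1 / lam y) * bridge_density (indicator A) x y t \<omega> \<partial>?D)"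
        by (cases "0 < t") (simp_all add: emeasure_bridge_at[OF _ A], simp add: bridge_density_def)
    qed
    also have "\<dots> = (\<integral>\<^sup>+p. ennreal (1 / lam y) * bridge_density (indicator A) x y (fst p) (snd p) \<partial>?M)"
      using driving.nn_integral_fst[of "\<lambda>p. ennreal (1 / lam y) * bridge_density (indicator A) x y (fst p) (snd p)" lborel]
      by (simp add: borel_measurable_times_ennreal measurable_bridge_density[OF ind m1(2,1)])
    also have "\<dots> = (\<integral>\<^sup>+p. ?w p * indicator A (safe_path x (Some y) (fst p) (snd p)) \<partial>?M)"
      by (subst bd) (simp only: mult_ac)
    finally show "(\<integral>\<^sup>+t\<in>{0<..}. emeasure (bridge_at C \<kappa> t x y) A \<partial>lborel) = \<dots>" .
  qed
  also have "\<dots> = (\<integral>\<^sup>+p. ennreal (1 / lam y) * bridge_density f x y (fst p) (snd p) \<partial>?M)"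
    by (subst (2) bd) (simp only: mult_ac)
  also have "\<dots> = ennreal (1 / lam y) * (\<integral>\<^sup>+p. bridge_density f x y (fst p) (snd p) \<partial>?M)"
    by (rule nn_integral_cmult) (rule measurable_bridge_density[OF f m1(2,1)])
  also have "(\<integral>\<^sup>+p. bridge_density f x y (fst p) (snd p) \<partial>?M) = (\<integral>\<^sup>+t. \<integral>\<^sup>+\<omega>. bridge_density f x y t \<omega> \<partial>?D \<partial>lborel)"
    using driving.nn_integral_fst[OF measurable_bridge_density[OF f m1(2,1)]] by simp
  finally show ?thesis .
qed

lemma measurable_path_loop_space:
  assumes "f \<in> path_space \<rightarrow>\<^sub>M N" shows "f \<in> loop_space \<rightarrow>\<^sub>M N"
  using assms unfolding loop_space_def by (rule measurable_restrict_space1)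

lemma sets_loop_space_imp: "A \<in> sets loop_space \<Longrightarrow> A \<in> sets (path_space :: 'x path measure)"
proof -
  have "{\<gamma>. snd \<gamma> 0 = snd \<gamma> (fst \<gamma>)} \<inter> space (path_space :: 'x path measure) = {\<gamma> \<in> paths. snd \<gamma> 0 = snd \<gamma> (fst \<gamma>)}"
    by auto
  then have "{\<gamma>. snd \<gamma> 0 = snd \<gamma> (fst \<gamma>)} \<inter> space (path_space :: 'x path measure) \<in> sets path_space"
    using sets_closed_paths by simp
  then show "A \<in> sets loop_space \<Longrightarrow> A \<in> sets (path_space :: 'x path measure)"
    unfolding loop_space_def by (simp add: sets_restrict_space_iff)
qed

text \<open>Valid for every driving configuration, the constant fallback path included, so the image
  map lands in \<open>loop_space\<close> everywhere.\<close>

lemma safe_path_loop: "snd (safe_path x (Some x) t \<omega>) 0 = snd (safe_path x (Some x) t \<omega>) (fst (safe_path x (Some x) t \<omega>))"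
  by (simp add: safe_path_def chain_path_def)

text \<open>The base point becomes a third coordinate under counting measure, so that the whole sum
  is one weighted image. The factor \<open>lam x\<close> of the loop measure cancels the 1 /
  \<open>lam x\<close> of the bridge.\<close>

lemma nn_integral_loop_measure:
  assumes f: "f \<in> borel_measurable path_space"
  shows "(\<integral>\<^sup>+l. f l \<partial>loop_measure C \<kappa>)
    = (\<Sum>x\<in>UNIV. \<integral>\<^sup>+t. ennreal (1 / t) * (\<integral>\<^sup>+\<omega>. bridge_density f x x t \<omega> \<partial>driving_space C \<kappa>) \<partial>lborel)"
proof -
  let ?D = "driving_space C \<kappa>"
  let ?M = "(lborel :: real measure) \<Otimes>\<^sub>M ?D"
  let ?X = "count_space (UNIV :: 'x set)"
  let ?w = "\<lambda>p. ennreal (1 / fst (snd p)) * bridge_density (\<lambda>_. 1) (fst p) (fst p) (fst (snd p)) (snd (snd p))"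
  let ?T = "\<lambda>p. safe_path (fst p) (Some (fst p)) (fst (snd p)) (snd (snd p))"
  interpret M: pair_sigma_finite lborel ?D
    by (intro pair_sigma_finite.intro lborel.sigma_finite_measure_axioms driving.sigma_finite_measure_axioms)
  have bd: "bridge_density f x y t \<omega> = bridge_density (\<lambda>_. 1) x y t \<omega> * f (safe_path x (Some y) t \<omega>)" for f x y t \<omega>
    by (simp add: bridge_density_def mult_ac)
  have m1: "fst \<in> ?M \<rightarrow>\<^sub>M borel" "snd \<in> ?M \<rightarrow>\<^sub>M ?D" by simp_all
  have recip: "(\<lambda>p. ennreal (1 / fst p)) \<in> borel_measurable ?M" by measurable
  have wm: "(\<lambda>p. ennreal (1 / fst (snd p)) * bridge_density h (fst p) (fst p) (fst (snd p)) (snd (snd p))) \<in> borel_measurable (?X \<Otimes>\<^sub>M ?M)"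
    if h: "h \<in> borel_measurable path_space" for h
  proof (rule measurable_pair_measure_countable1, simp)
    fix x :: 'x
    show "(\<lambda>p. ennreal (1 / fst (snd (x, p))) * bridge_density h (fst (x, p)) (fst (x, p)) (fst (snd (x, p))) (snd (snd (x, p)))) \<in> borel_measurable ?M"
      using recip measurable_bridge_density[OF h m1(2,1), of x x] by simp
  qed
  have Fub: "(\<integral>\<^sup>+p. ennreal (1 / fst (snd p)) * bridge_density h (fst p) (fst p) (fst (snd p)) (snd (snd p)) \<partial>(?X \<Otimes>\<^sub>M ?M))
    = (\<Sum>x\<in>UNIV. \<integral>\<^sup>+t. ennreal (1 / t) * (\<integral>\<^sup>+\<omega>. bridge_density h x x t \<omega> \<partial>?D) \<partial>lborel)"
    if h: "h \<in> borel_measurable path_space" for h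
  proof -
    have "(\<integral>\<^sup>+p. ennreal (1 / fst (snd p)) * bridge_density h (fst p) (fst p) (fst (snd p)) (snd (snd p)) \<partial>(?X \<Otimes>\<^sub>M ?M))
      = (\<Sum>x\<in>UNIV. \<integral>\<^sup>+p. ennreal (1 / fst p) * bridge_density h x x (fst p) (snd p) \<partial>?M)"
      by (subst M.nn_integral_fst[OF wm[OF h], symmetric]) (simp add: nn_integral_count_space_finite)
    also have "\<dots> = (\<Sum>x\<in>UNIV. \<integral>\<^sup>+t. ennreal (1 / t) * (\<integral>\<^sup>+\<omega>. bridge_density h x x t \<omega> \<partial>?D) \<partial>lborel)"
    proof (rule sum.cong[OF refl])
      fix x
      have "(\<integral>\<^sup>+p. ennreal (1 / fst p) * bridge_density h x x (fst p) (snd p) \<partial>?M)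
        = (\<integral>\<^sup>+t. \<integral>\<^sup>+\<omega>. ennreal (1 / t) * bridge_density h x x t \<omega> \<partial>?D \<partial>lborel)"
        using driving.nn_integral_fst[of "\<lambda>p. ennreal (1 / fst p) * bridge_density h x x (fst p) (snd p)" lborel]
          recip measurable_bridge_density[OF h m1(2,1), of x x] by simp
      also have "\<dots> = (\<integral>\<^sup>+t. ennreal (1 / t) * (\<integral>\<^sup>+\<omega>. bridge_density h x x t \<omega> \<partial>?D) \<partial>lborel)"
      proof (rule nn_integral_cong)
        fix t :: real
        have "(\<lambda>\<omega>. bridge_density h x x t \<omega>) \<in> borel_measurable ?D"
          by (rule measurable_bridge_density[OF h]) simp_all
        then show "(\<integral>\<^sup>+\<omega>. ennreal (1 / t) * bridge_density h x x t \<omega> \<partial>?D)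
          = ennreal (1 / t) * (\<integral>\<^sup>+\<omega>. bridge_density h x x t \<omega> \<partial>?D)" by (rule nn_integral_cmult)
      qed
      finally show "(\<integral>\<^sup>+p. ennreal (1 / fst p) * bridge_density h x x (fst p) (snd p) \<partial>?M)
        = (\<integral>\<^sup>+t. ennreal (1 / t) * (\<integral>\<^sup>+\<omega>. bridge_density h x x t \<omega> \<partial>?D) \<partial>lborel)" .
    qed
    finally show ?thesis .
  qed
  have w_eq: "?w p * h (?T p) = ennreal (1 / fst (snd p)) * bridge_density h (fst p) (fst p) (fst (snd p)) (snd (snd p))" for h p
    by (subst (2) bd) (simp only: mult_ac)
  have "(\<integral>\<^sup>+l. f l \<partial>loop_measure C \<kappa>) = (\<integral>\<^sup>+p. ?w p * f (?T p) \<partial>(?X \<Otimes>\<^sub>M ?M))"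
    unfolding loop_measure_def
  proof (rule nn_integral_measure_of_image)
    have "?T \<in> ?X \<Otimes>\<^sub>M ?M \<rightarrow>\<^sub>M path_space"
      by (rule measurable_pair_measure_countable1, simp) (simp add: measurable_safe_path[OF m1(2,1)])
    then show "?T \<in> ?X \<Otimes>\<^sub>M ?M \<rightarrow>\<^sub>M loop_space"
      unfolding loop_space_def by (auto simp: measurable_restrict_space2_iff safe_path_loop)
    show "?w \<in> borel_measurable (?X \<Otimes>\<^sub>M ?M)" by (rule wm) simp
    show "f \<in> borel_measurable loop_space" using f by (rule measurable_path_loop_space)
    fix A :: "'x path set" assume A: "A \<in> sets loop_space"
    have A': "A \<in> sets path_space" by (rule sets_loop_space_imp[OF A])
    have ind: "indicator A \<in> borel_measurable path_space" using A' by simp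
    have "(\<Sum>x\<in>UNIV. \<integral>\<^sup>+t\<in>{0<..}. ennreal (1 / t) * emeasure (bridge_at C \<kappa> t x x) A * ennreal (lam x) \<partial>lborel)
      = (\<Sum>x\<in>UNIV. \<integral>\<^sup>+t. ennreal (1 / t) * (\<integral>\<^sup>+\<omega>. bridge_density (indicator A) x x t \<omega> \<partial>?D) \<partial>lborel)"
    proof (intro sum.cong[OF refl] nn_integral_cong)
      fix x and t :: real
      have c: "ennreal (1 / lam x) * ennreal (lam x) = 1"
        using lam_pos[of x] by (simp add: ennreal_mult[symmetric])
      have bm: "(\<lambda>\<omega>. bridge_density (indicator A) x x t \<omega>) \<in> borel_measurable ?D"
        by (rule measurable_bridge_density[OF ind]) simp_all
      show "ennreal (1 / t) * emeasure (bridge_at C \<kappa> t x x) A * ennreal (lam x) * indicator {0<..} t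
        = ennreal (1 / t) * (\<integral>\<^sup>+\<omega>. bridge_density (indicator A) x x t \<omega> \<partial>?D)"
      proof (cases "0 < t")
        case True
        have "ennreal (1 / t) * emeasure (bridge_at C \<kappa> t x x) A * ennreal (lam x)
          = ennreal (1 / t) * (\<integral>\<^sup>+\<omega>. bridge_density (indicator A) x x t \<omega> \<partial>?D) * (ennreal (1 / lam x) * ennreal (lam x))"
          unfolding emeasure_bridge_at[OF True A'] nn_integral_cmult[OF bm] by (simp only: mult_ac)
        then show ?thesis using True by (simp add: c)
      next
        case False then show ?thesis by (simp add: bridge_density_def)
      qed
    qed
    also have "\<dots> = (\<integral>\<^sup>+p. ?w p * indicator A (?T p) \<partial>(?X \<Otimes>\<^sub>M ?M))"
      unfolding w_eq Fub[OF ind] ..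
    finally show "(\<Sum>x\<in>UNIV. \<integral>\<^sup>+t\<in>{0<..}. ennreal (1 / t) * emeasure (bridge_at C \<kappa> t x x) A * ennreal (lam x) \<partial>lborel) = \<dots>" .
  qed
  also have "\<dots> = (\<Sum>x\<in>UNIV. \<integral>\<^sup>+t. ennreal (1 / t) * (\<integral>\<^sup>+\<omega>. bridge_density f x x t \<omega> \<partial>?D) \<partial>lborel)"
    unfolding w_eq Fub[OF f] ..
  finally show ?thesis .
qed

lemma measurable_field_exp_occupation: "(\<lambda>\<gamma>. ennreal (field_exp q (occupation C \<kappa> \<gamma>))) \<in> borel_measurable path_space"
  by (rule measurable_compose[OF measurable_compose[OF measurable_occupation measurable_field_exp] measurable_ennreal])

theorem bridge_laplace:
  assumes q: "\<And>x. 0 \<le> q x"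
  shows "(\<integral>\<^sup>+\<gamma>. ennreal (field_exp q (occupation C \<kappa> \<gamma>)) \<partial>bridge_measure C \<kappa> x y) = ennreal (W q x y)"
proof -
  let ?D = "driving_space C \<kappa>" and ?f = "\<lambda>\<gamma>. ennreal (field_exp q (occupation C \<kappa> \<gamma>))"
  interpret M: pair_sigma_finite lborel ?D
    by (intro pair_sigma_finite.intro lborel.sigma_finite_measure_axioms driving.sigma_finite_measure_axioms)
  have v: "0 \<le> q z / lam z" for z using q lam_pos[of z] by (simp add: less_imp_le)
  have fm: "?f \<in> borel_measurable path_space" by (rule measurable_field_exp_occupation)
  have bm: "(\<lambda>(t, \<omega>). bridge_density ?f x y t \<omega>) \<in> borel_measurable (lborel \<Otimes>\<^sub>M ?D)"
    unfolding case_prod_beta by (rule measurable_bridge_density[OF fm]) simp_all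
  let ?e = "\<lambda>n \<tau>. \<integral>\<^sup>+r. indicator {0..<\<tau> n} r * ennreal (exp (- (q y / lam y) * r)) \<partial>lborel"
  have em: "(\<lambda>t::real. \<integral>\<^sup>+r. indicator {0..<t} r * ennreal (exp (- (q y / lam y) * r)) \<partial>lborel) \<in> borel_measurable borel"
  proof -
    have "(\<lambda>t. \<integral>\<^sup>+r. (if 0 \<le> r \<and> r < t then 1 else 0) * ennreal (exp (- (q y / lam y) * r)) \<partial>lborel) \<in> borel_measurable borel"
      by measurable
    then show ?thesis by (simp add: indicator_def of_bool_def)
  qed
  have em': "(\<lambda>\<tau>. ?e n \<tau>) \<in> borel_measurable holds" for n
    by (rule measurable_compose[OF measurable_hold em])
  have "(\<integral>\<^sup>+t. \<integral>\<^sup>+\<omega>. bridge_density ?f x y t \<omega> \<partial>?D \<partial>lborel) = (\<integral>\<^sup>+\<omega>. \<integral>\<^sup>+t. bridge_density ?f x y t \<omega> \<partial>lborel \<partial>?D)"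
    by (rule M.Fubini'[symmetric]) (rule bm)
  \<comment> \<open>With jumps and holding times as separate variables, the time integral is done
    first, for fixed jumps and almost every sequence of holding times.\<close>
  also have "\<dots> = (\<integral>\<^sup>+U. \<integral>\<^sup>+\<tau>. \<integral>\<^sup>+t. bridge_density ?f x y t (U, \<tau>) \<partial>lborel \<partial>holds \<partial>jumps)"
  proof (rule nn_integral_driving)
    have "(\<lambda>(\<omega>, t). bridge_density ?f x y t \<omega>) \<in> borel_measurable (?D \<Otimes>\<^sub>M lborel)"
      unfolding case_prod_beta by (rule measurable_bridge_density[OF fm]) simp_all
    then show "(\<lambda>\<omega>. \<integral>\<^sup>+t. bridge_density ?f x y t \<omega> \<partial>lborel) \<in> borel_measurable ?D"
      by (rule lborel.borel_measurable_nn_integral)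
  qed
  also have "\<dots> = (\<integral>\<^sup>+U. \<integral>\<^sup>+\<tau>. (\<Sum>n. indicator {Some y} (skeleton x U n) * (ennreal (skeleton_weight q x n U \<tau>) * ?e n \<tau>)) \<partial>holds \<partial>jumps)"
  proof (rule nn_integral_cong, rule nn_integral_cong_AE)
    fix U assume U: "U \<in> space jumps"
    show "AE \<tau> in holds. (\<integral>\<^sup>+t. bridge_density ?f x y t (U, \<tau>) \<partial>lborel)
      = (\<Sum>n. indicator {Some y} (skeleton x U n) * (ennreal (skeleton_weight q x n U \<tau>) * ?e n \<tau>))"
      using AE_holds_pos AE_space
    proof eventually_elim
      case (elim \<tau>)
      then have "\<And>i. 0 < \<tau> i" by simp
      then show ?case
        unfolding bridge_density_eq[OF chain_starts_at[OF \<open>\<And>i. 0 < \<tau> i\<close>]]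
        by (rule chain_time_integral) (use U elim in auto)
    qed
  qed
  also have "\<dots> = (\<integral>\<^sup>+U. (\<Sum>n. (\<integral>\<^sup>+\<tau>. indicator {Some y} (skeleton x U n) * ennreal (skeleton_weight q x n U \<tau>) \<partial>holds) *
      ennreal (1 / (1 + q y / lam y))) \<partial>jumps)"
  proof (rule nn_integral_cong)
    fix U
    have swm: "(\<lambda>\<tau>. ennreal (skeleton_weight q x n U \<tau>)) \<in> borel_measurable holds" for n by measurable
    have "(\<integral>\<^sup>+\<tau>. (\<Sum>n. indicator {Some y} (skeleton x U n) * (ennreal (skeleton_weight q x n U \<tau>) * ?e n \<tau>)) \<partial>holds)
      = (\<Sum>n. \<integral>\<^sup>+\<tau>. indicator {Some y} (skeleton x U n) * (ennreal (skeleton_weight q x n U \<tau>) * ?e n \<tau>) \<partial>holds)"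
      by (rule nn_integral_suminf) (intro borel_measurable_times_ennreal borel_measurable_const swm em')
    also have "\<dots> = (\<Sum>n. (\<integral>\<^sup>+\<tau>. indicator {Some y} (skeleton x U n) * ennreal (skeleton_weight q x n U \<tau>) \<partial>holds) *
      ennreal (1 / (1 + q y / lam y)))"
    proof (rule suminf_cong)
      fix n
      have "(\<integral>\<^sup>+\<tau>. ennreal (skeleton_weight q x n U \<tau>) * ?e n \<tau> \<partial>holds)
        = (\<integral>\<^sup>+\<tau>. ennreal (skeleton_weight q x n U \<tau>) \<partial>holds) * ennreal (1 / (1 + q y / lam y))"
        unfolding nn_integral_exponential_truncated[OF v, symmetric] by (rule nn_integral_holds_coordinate[OF em])
      then show "(\<integral>\<^sup>+\<tau>. indicator {Some y} (skeleton x U n) * (ennreal (skeleton_weight q x n U \<tau>) * ?e n \<tau>) \<partial>holds)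
        = (\<integral>\<^sup>+\<tau>. indicator {Some y} (skeleton x U n) * ennreal (skeleton_weight q x n U \<tau>) \<partial>holds) *
      ennreal (1 / (1 + q y / lam y))"
        by (simp only: nn_integral_cmult borel_measurable_times_ennreal swm em' mult.assoc)
    qed
    finally show "(\<integral>\<^sup>+\<tau>. (\<Sum>n. indicator {Some y} (skeleton x U n) * (ennreal (skeleton_weight q x n U \<tau>) * ?e n \<tau>)) \<partial>holds) = \<dots>" .
  qed
  also have "\<dots> = (\<Sum>n. skeleton_mass q x n y * ennreal (1 / (1 + q y / lam y)))"
  proof -
    have "(\<lambda>U. \<integral>\<^sup>+\<tau>. indicator {Some y} (skeleton x U n) * ennreal (skeleton_weight q x n U \<tau>) \<partial>holds) \<in> borel_measurable jumps" for n
      by measurable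
    then show ?thesis
      unfolding skeleton_mass_def by (subst nn_integral_suminf) (simp_all add: nn_integral_multc)
  qed
  also have "\<dots> = ennreal (lam y * W q x y)" by (rule suminf_skeleton_mass[OF q])
  \<comment> \<open>The normalisation 1 / \<open>lam y\<close> of the bridge measure cancels the
    factor left by the Neumann series.\<close>
  finally have "(\<integral>\<^sup>+\<gamma>. ?f \<gamma> \<partial>bridge_measure C \<kappa> x y) = ennreal (1 / lam y) * ennreal (lam y * W q x y)"
    unfolding nn_integral_bridge[OF fm] by simp
  also have "\<dots> = ennreal (W q x y)"
    using lam_pos[of y] W_nonneg[OF q] by (subst ennreal_mult[symmetric]) (auto simp: less_imp_le)
  finally show ?thesis .
qed

end

section \<open>Laplace transform of the loop measure\<close>

text \<open>One-sided derivatives at the end points suffice; resolvents and Gaussian transforms are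
  differentiated only in nonnegative coupling constants.\<close>

lemma nn_integral_FTC_Icc_within:
  fixes f F :: "real \<Rightarrow> real"
  assumes f[measurable]: "f \<in> borel_measurable borel" and "a \<le> b"
    and F: "\<And>x. a \<le> x \<Longrightarrow> x \<le> b \<Longrightarrow> (F has_real_derivative f x) (at x within {a..b})"
    and nonneg: "\<And>x. a \<le> x \<Longrightarrow> x \<le> b \<Longrightarrow> 0 \<le> f x"
  shows "(\<integral>\<^sup>+x. ennreal (f x) * indicator {a..b} x \<partial>lborel) = ennreal (F b - F a)"
proof -
  have "(f has_integral F b - F a) {a..b}"
    using F \<open>a \<le> b\<close> by (intro fundamental_theorem_of_calculus)
      (auto simp: has_real_derivative_iff_has_vector_derivative[symmetric])
  moreover have "(\<lambda>x. f x * indicator {a..b} x) = (\<lambda>x. if x \<in> {a..b} then f x else 0)"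
    by (auto simp: indicator_def fun_eq_iff)
  ultimately have "((\<lambda>x. f x * indicator {a..b} x) has_integral F b - F a) UNIV"
    by (simp only: has_integral_restrict_UNIV)
  then have "(\<integral>\<^sup>+x. ennreal (f x * indicator {a..b} x) \<partial>lborel) = ennreal (F b - F a)"
    by (intro nn_integral_has_integral_lborel) (auto simp: nonneg split: split_indicator)
  also have "(\<integral>\<^sup>+x. ennreal (f x * indicator {a..b} x) \<partial>lborel) = (\<integral>\<^sup>+x. ennreal (f x) * indicator {a..b} x \<partial>lborel)"
    by (intro nn_integral_cong) (auto split: split_indicator)
  finally show ?thesis .
qed

text \<open>Exhaustion by \<open>{a..a + real n}\<close> and monotone convergence.\<close>

lemma nn_integral_FTC_atLeast_within:
  fixes f F :: "real \<Rightarrow> real"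
  assumes f[measurable]: "f \<in> borel_measurable borel"
    and F: "\<And>x. a \<le> x \<Longrightarrow> (F has_real_derivative f x) (at x within {a..})"
    and nonneg: "\<And>x. a \<le> x \<Longrightarrow> 0 \<le> f x"
    and lim: "(F \<longlongrightarrow> T) at_top"
  shows "(\<integral>\<^sup>+x. ennreal (f x) * indicator {a..} x \<partial>lborel) = ennreal (T - F a)"
proof (rule LIMSEQ_unique)
  let ?f = "\<lambda>(n::nat) x. ennreal (f x) * indicator {a..a + real n} x"
  show "(\<lambda>n. \<integral>\<^sup>+x. ?f n x \<partial>lborel) \<longlonglongrightarrow> (\<integral>\<^sup>+x. ennreal (f x) * indicator {a..} x \<partial>lborel)"
  proof (rule nn_integral_LIMSEQ)
    show "incseq ?f" by (auto simp: incseq_def le_fun_def split: split_indicator)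
    fix x :: real
    obtain N where N: "x - a \<le> real N" using real_arch_simple by blast
    have "?f n x = ennreal (f x) * indicator {a..} x" if "n \<ge> N" for n
      using that N by (auto split: split_indicator)
    then show "(\<lambda>n. ?f n x) \<longlonglongrightarrow> ennreal (f x) * indicator {a..} x"
      by (intro tendsto_eventually eventually_sequentiallyI[of N])
  qed simp
  have "(\<integral>\<^sup>+x. ?f n x \<partial>lborel) = ennreal (F (a + real n) - F a)" for n
    by (intro nn_integral_FTC_Icc_within) (auto simp: nonneg intro: DERIV_subset[OF F])
  moreover have "(\<lambda>n. F (a + real n)) \<longlonglongrightarrow> T"
    by (intro filterlim_compose[OF lim] filterlim_tendsto_add_at_top[OF tendsto_const filterlim_real_sequentially])
  ultimately show "(\<lambda>n. \<integral>\<^sup>+x. ?f n x \<partial>lborel) \<longlonglongrightarrow> ennreal (T - F a)"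
    by (simp add: tendsto_diff)
qed

lemma nn_integral_exp_scaled:
  fixes t :: real
  assumes "0 < t"
  shows "(\<integral>\<^sup>+p. ennreal (exp (- (p * t))) * indicator {0..} p \<partial>lborel) = ennreal (1 / t)"
proof -
  have "filterlim (\<lambda>p. p * t) at_top at_top"
    using assms by (intro filterlim_at_top_mult_tendsto_pos[OF tendsto_const _ filterlim_ident]) auto
  then have "((\<lambda>p. exp (- (p * t))) \<longlongrightarrow> 0) at_top"
    by (intro filterlim_compose[OF exp_at_bot]) (simp add: filterlim_uminus_at_bot)
  then have "((\<lambda>p. exp (- (p * t)) * (- 1 / t)) \<longlongrightarrow> 0) at_top"
    by (rule tendsto_mult_left_zero)
  then have "(\<integral>\<^sup>+p. ennreal (exp (- (p * t))) * indicator {0..} p \<partial>lborel) = ennreal (0 - exp (- (0 * t)) * (- 1 / t))"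
    using assms by (intro nn_integral_FTC_atLeast_within) (auto intro!: derivative_eq_intros)
  then show ?thesis by simp
qed

context killed_network
begin

lemma occupation_nonneg: "occupation C \<kappa> \<gamma> \<in> nonneg_fields"
  unfolding nonneg_fields_def occupation_def set_lebesgue_integral_def
  using lam_pos by (auto intro!: mult_nonneg_nonneg integral_nonneg_AE simp: less_imp_le)

text \<open>Multiplying by \<open>lam\<close> undoes the normalisation of the occupation field.
  Hence exp (- p t), for t the duration, is a \<open>field_exp\<close> with potential
  \<open>p * lam x\<close>.\<close>

lemma total_occupation:
  assumes \<gamma>: "\<gamma> \<in> paths"
  shows "(\<Sum>x\<in>UNIV. lam x * occupation C \<kappa> \<gamma> $ x) = fst \<gamma>"
proof -
  have T: "0 < fst \<gamma>" using \<gamma> by (auto simp: paths_def)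
  let ?l = "\<lambda>s. snd \<gamma> (min (max 0 s) (fst \<gamma>))"
  have l: "?l \<in> borel \<rightarrow>\<^sub>M (count_space UNIV :: 'x measure)"
  proof -
    have "Pair \<gamma> \<in> borel \<rightarrow>\<^sub>M (path_space :: 'x path measure) \<Otimes>\<^sub>M (borel :: real measure)"
      by (rule measurable_Pair1') (simp add: \<gamma>)
    from measurable_compose[OF this measurable_evaluation_joint] show ?thesis by simp
  qed
  have meas: "(\<lambda>s. indicator {x} (?l s) :: real) \<in> borel_measurable borel" for x
    by (rule measurable_compose[OF l]) simp
  have int: "integrable lborel (\<lambda>s. indicator {0..fst \<gamma>} s * indicator {x} (?l s) :: real)" for x
  proof (rule Bochner_Integration.integrable_bound)
    show "integrable lborel (indicator {0..fst \<gamma>} :: real \<Rightarrow> real)"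
      using T by (intro integrable_real_indicator) auto
    show "(\<lambda>s. indicator {0..fst \<gamma>} s * indicator {x} (?l s) :: real) \<in> borel_measurable lborel"
      using meas[of x] by (intro borel_measurable_times) auto
  qed (auto split: split_indicator)
  have occ: "lam x * occupation C \<kappa> \<gamma> $ x = (LINT s|lborel. indicator {0..fst \<gamma>} s * indicator {x} (?l s))" for x
  proof -
    have "indicator {0..fst \<gamma>} s *\<^sub>R indicator {x} (snd \<gamma> s) = indicator {0..fst \<gamma>} s * (indicator {x} (?l s) :: real)" for s
      by (cases "s \<in> {0..fst \<gamma>}") (auto simp: max_def min_def indicator_def)
    then have "(LINT s|lborel. indicator {0..fst \<gamma>} s *\<^sub>R indicator {x} (snd \<gamma> s))
      = (LINT s|lborel. indicator {0..fst \<gamma>} s * (indicator {x} (?l s) :: real))" by (simp only: )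
    then show ?thesis
      unfolding occupation_def set_lebesgue_integral_def vec_lambda_beta using lam_pos[of x] by simp
  qed
  have one: "(\<Sum>x\<in>UNIV. indicator {0..fst \<gamma>} s * indicator {x} (?l s)) = (indicator {0..fst \<gamma>} s :: real)" for s
  proof -
    have "(\<Sum>x\<in>UNIV. indicator {x} (?l s) :: real) = (\<Sum>x\<in>UNIV. if x = ?l s then 1 else 0)"
      by (intro sum.cong) (auto split: split_indicator)
    then show ?thesis by (simp add: sum_distrib_left[symmetric])
  qed
  have "(\<Sum>x\<in>UNIV. lam x * occupation C \<kappa> \<gamma> $ x)
      = (LINT s|lborel. (\<Sum>x\<in>UNIV. indicator {0..fst \<gamma>} s * indicator {x} (?l s)))"
    unfolding occ by (rule Bochner_Integration.integral_sum[symmetric]) (rule int)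
  then show ?thesis using T by (simp add: one)
qed

text \<open>The clamping by \<open>max 0\<close> and the absolute value keep the potential
  nonnegative on the whole plane, so the resolvent is continuous, hence Borel, without side
  conditions on p and s.\<close>

lemma continuous_on_W:
  "continuous_on UNIV (\<lambda>(p, s). W (\<lambda>x. max 0 p * lam x + max 0 s * \<bar>q x\<bar>) x y)"
  unfolding continuous_on_def case_prod_beta
  by (intro ballI tendsto_W always_eventually allI tendsto_intros tendsto_max add_nonneg_nonneg mult_nonneg_nonneg tendsto_fst tendsto_snd)
     (auto simp: less_imp_le[OF lam_pos])

lemma measurable_W:
  assumes [measurable]: "f \<in> borel_measurable M" "g \<in> borel_measurable M"
  shows "(\<lambda>\<omega>. W (\<lambda>x. max 0 (f \<omega>) * lam x + max 0 (g \<omega>) * \<bar>q x\<bar>) x y) \<in> borel_measurable M"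
proof -
  have "(\<lambda>\<omega>. (f \<omega>, g \<omega>)) \<in> M \<rightarrow>\<^sub>M borel" by measurable
  from measurable_compose[OF this borel_measurable_continuous_onI[OF continuous_on_W]]
  show ?thesis by simp
qed

text \<open>The factor \<open>1 / t\<close> of the loop measure is written as the integral of \<open>exp (- p t)\<close> over
  \<open>p \<ge> 0\<close>, which turns loop integrals into bridge integrals with the additional potential
  \<open>p lam\<close>.\<close>

lemma loop_resolvent_integral:
  assumes q: "\<And>x. 0 \<le> q x"
  shows "(\<integral>\<^sup>+l. ennreal (1 - field_exp q (occupation C \<kappa> l)) \<partial>loop_measure C \<kappa>)
    = (\<integral>\<^sup>+p. ennreal (\<Sum>x\<in>UNIV. lam x * (W (\<lambda>y. p * lam y) x x - W (\<lambda>y. p * lam y + q y) x x)) * indicator {0..} p \<partial>lborel)"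
proof -
  let ?D = "driving_space C \<kappa>"
  let ?M = "(lborel :: real measure) \<Otimes>\<^sub>M ?D"
  let ?o = "occupation C \<kappa>"
  let ?f = "\<lambda>\<gamma>. ennreal (1 - field_exp q (?o \<gamma>))"
  let ?g = "\<lambda>p \<gamma>. ennreal (field_exp (\<lambda>y. p * lam y) (?o \<gamma>) - field_exp (\<lambda>y. p * lam y + q y) (?o \<gamma>))"
  interpret M: pair_sigma_finite lborel ?D
    by (intro pair_sigma_finite.intro lborel.sigma_finite_measure_axioms driving.sigma_finite_measure_axioms)
  interpret MP: pair_sigma_finite lborel ?M
    by (intro pair_sigma_finite.intro lborel.sigma_finite_measure_axioms M.P.sigma_finite_measure_axioms)
  have m1: "fst \<in> ?M \<rightarrow>\<^sub>M borel" "snd \<in> ?M \<rightarrow>\<^sub>M ?D" by simp_all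
  have fm: "?f \<in> borel_measurable path_space"
    by (rule measurable_compose[OF measurable_compose[OF measurable_occupation measurable_field_exp]]) simp
  have occ_m: "(\<lambda>\<gamma>. ?o \<gamma> $ x) \<in> borel_measurable path_space" for x
    by (rule measurable_compose[OF measurable_occupation]) simp
  have gm2: "(\<lambda>(p, \<gamma>). ?g p \<gamma>) \<in> borel_measurable (lborel \<Otimes>\<^sub>M path_space)"
  proof -
    have o2: "(\<lambda>w. ?o (snd w) $ x) \<in> borel_measurable (lborel \<Otimes>\<^sub>M path_space)" for x
      by (rule measurable_compose[OF measurable_snd occ_m])
    show ?thesis
      unfolding field_exp_def case_prod_beta
      by (intro measurable_compose[OF _ measurable_ennreal] borel_measurable_diff borel_measurable_exp[THEN measurable_compose[rotated]]
          borel_measurable_uminus borel_measurable_sum borel_measurable_times borel_measurable_add o2) simp_all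
  qed
  have gm: "?g p \<in> borel_measurable path_space" for p
    using measurable_compose[OF measurable_Pair1'[of p lborel path_space] gm2] by simp
  \<comment> \<open>The identity holds pointwise in time and driving randomness: all densities
    vanish off the bridge event, and on it \<open>total_occupation\<close> turns the damping into a
    potential.\<close>
  have pt: "ennreal (1 / t) * bridge_density ?f x x t \<omega>
     = (\<integral>\<^sup>+p. indicator {0..} p * bridge_density (?g p) x x t \<omega> \<partial>lborel)" for x t \<omega>
  proof (cases "0 < t \<and> chain x \<omega> 0 = Some x \<and> chain x \<omega> t = Some x")
    case True
    then have "bridge_density h x x t \<omega> = h (chain_path x t \<omega>)" for h
      by (simp add: bridge_density_def safe_path_def)
    moreover have "?g p (chain_path x t \<omega>) = ?f (chain_path x t \<omega>) * ennreal (exp (- (p * t)))" for p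
    proof -
      have "(\<Sum>y\<in>UNIV. p * lam y * ?o (chain_path x t \<omega>) $ y) = p * t"
        using total_occupation[OF chain_path_in_paths, of t x \<omega>] True
        by (simp add: sum_distrib_left[symmetric] mult.assoc) (simp add: chain_path_def)
      then have "field_exp (\<lambda>y. p * lam y) (?o (chain_path x t \<omega>)) = exp (- (p * t))"
        by (simp add: field_exp_def)
      then have "field_exp (\<lambda>y. p * lam y) (?o (chain_path x t \<omega>)) - field_exp (\<lambda>y. p * lam y + q y) (?o (chain_path x t \<omega>))
        = (1 - field_exp q (?o (chain_path x t \<omega>))) * exp (- (p * t))"
        unfolding field_exp_add_left by (simp add: algebra_simps)
      then show ?thesis
        using field_exp_le_1[where q = q, OF q occupation_nonneg[of "chain_path x t \<omega>"]] by (simp add: ennreal_mult)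
    qed
    ultimately have "(\<integral>\<^sup>+p. indicator {0..} p * bridge_density (?g p) x x t \<omega> \<partial>lborel)
      = (\<integral>\<^sup>+p. ?f (chain_path x t \<omega>) * (ennreal (exp (- (p * t))) * indicator {0..} p) \<partial>lborel)"
      by (simp add: mult_ac)
    also have "\<dots> = ?f (chain_path x t \<omega>) * ennreal (1 / t)"
      using True by (simp add: nn_integral_cmult nn_integral_exp_scaled)
    finally show ?thesis using \<open>\<And>h. bridge_density h x x t \<omega> = h (chain_path x t \<omega>)\<close> by (simp add: mult.commute)
  next
    case False
    then have "bridge_density h x x t \<omega> = 0" for h by (auto simp: bridge_density_def split: split_indicator)
    then show ?thesis by simp
  qed
  have swap: "(\<integral>\<^sup>+t. ennreal (1 / t) * (\<integral>\<^sup>+\<omega>. bridge_density ?f x x t \<omega> \<partial>?D) \<partial>lborel)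
    = (\<integral>\<^sup>+p. indicator {0..} p * (\<integral>\<^sup>+t. \<integral>\<^sup>+\<omega>. bridge_density (?g p) x x t \<omega> \<partial>?D \<partial>lborel) \<partial>lborel)" for x
  proof -
    have bf: "(\<lambda>\<omega>. bridge_density ?f x x t \<omega>) \<in> borel_measurable ?D" for t
      by (rule measurable_bridge_density[OF fm]) simp_all
    have bf2: "(\<lambda>w. ennreal (1 / fst w) * bridge_density ?f x x (fst w) (snd w)) \<in> borel_measurable ?M"
      using measurable_bridge_density[OF fm m1(2,1), of x x] by (intro borel_measurable_times_ennreal) auto
    have bg: "(\<lambda>w. bridge_density (?g p) x x (fst w) (snd w)) \<in> borel_measurable ?M" for p
      by (rule measurable_bridge_density[OF gm m1(2,1)])
    have bg2: "(\<lambda>(p, w). indicator {0..} p * bridge_density (?g p) x x (fst w) (snd w)) \<in> borel_measurable (lborel \<Otimes>\<^sub>M ?M)"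
    proof -
      let ?N = "(lborel :: real measure) \<Otimes>\<^sub>M ?M"
      have c: "(\<lambda>v. fst (snd v)) \<in> borel_measurable ?N" "(\<lambda>v. snd (snd v)) \<in> ?N \<rightarrow>\<^sub>M ?D" "fst \<in> borel_measurable ?N" by simp_all
      have a: "(\<lambda>v. bridge_density (\<lambda>_. 1) x x (fst (snd v)) (snd (snd v))) \<in> borel_measurable ?N"
        by (rule measurable_bridge_density[OF _ c(2,1)]) simp
      have "(\<lambda>v. (fst v, safe_path x (Some x) (fst (snd v)) (snd (snd v)))) \<in> ?N \<rightarrow>\<^sub>M lborel \<Otimes>\<^sub>M path_space"
        by (intro measurable_Pair measurable_safe_path[OF c(2,1)]) simp
      from measurable_compose[OF this gm2]
      have b: "(\<lambda>v. ?g (fst v) (safe_path x (Some x) (fst (snd v)) (snd (snd v)))) \<in> borel_measurable ?N" by simp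
      have i: "(\<lambda>v. indicator {0..} (fst v) :: ennreal) \<in> borel_measurable ?N"
        by (rule measurable_compose[OF c(3)]) simp
      have "bridge_density (?g p) x x t \<omega> = bridge_density (\<lambda>_. 1) x x t \<omega> * ?g p (safe_path x (Some x) t \<omega>)" for p t \<omega>
        by (simp add: bridge_density_def mult_ac)
      then show ?thesis
        unfolding case_prod_beta using a b i by (simp only: borel_measurable_times_ennreal)
    qed
    have "(\<integral>\<^sup>+t. ennreal (1 / t) * (\<integral>\<^sup>+\<omega>. bridge_density ?f x x t \<omega> \<partial>?D) \<partial>lborel)
      = (\<integral>\<^sup>+t. \<integral>\<^sup>+\<omega>. ennreal (1 / t) * bridge_density ?f x x t \<omega> \<partial>?D \<partial>lborel)"
      by (simp only: nn_integral_cmult[OF bf])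
    also have "\<dots> = (\<integral>\<^sup>+w. ennreal (1 / fst w) * bridge_density ?f x x (fst w) (snd w) \<partial>?M)"
      using driving.nn_integral_fst[OF bf2] by simp
    also have "\<dots> = (\<integral>\<^sup>+w. \<integral>\<^sup>+p. indicator {0..} p * bridge_density (?g p) x x (fst w) (snd w) \<partial>lborel \<partial>?M)"
      unfolding pt ..
    also have "\<dots> = (\<integral>\<^sup>+p. \<integral>\<^sup>+w. indicator {0..} p * bridge_density (?g p) x x (fst w) (snd w) \<partial>?M \<partial>lborel)"
      by (rule MP.Fubini') (rule bg2)
    also have "\<dots> = (\<integral>\<^sup>+p. indicator {0..} p * (\<integral>\<^sup>+w. bridge_density (?g p) x x (fst w) (snd w) \<partial>?M) \<partial>lborel)"
      by (simp only: nn_integral_cmult[OF bg])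
    also have "\<dots> = (\<integral>\<^sup>+p. indicator {0..} p * (\<integral>\<^sup>+t. \<integral>\<^sup>+\<omega>. bridge_density (?g p) x x t \<omega> \<partial>?D \<partial>lborel) \<partial>lborel)"
      by (subst driving.nn_integral_fst[OF bg, symmetric]) simp
    finally show ?thesis .
  qed
  \<comment> \<open>Both Laplace transforms are finite by \<open>bridge_laplace\<close>, so they may
    be subtracted; multiplication by \<open>lam x\<close> removes the 1 / \<open>lam x\<close> of
    the bridge integral.\<close>
  have inner: "(\<integral>\<^sup>+t. \<integral>\<^sup>+\<omega>. bridge_density (?g p) x x t \<omega> \<partial>?D \<partial>lborel)
      = ennreal (lam x * (W (\<lambda>y. p * lam y) x x - W (\<lambda>y. p * lam y + q y) x x))" if p: "0 \<le> p" for p x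
  proof -
    let ?B = "bridge_measure C \<kappa> x x"
    have pl: "0 \<le> p * lam y" for y using p lam_pos[of y] by (simp add: less_imp_le)
    have plq: "0 \<le> p * lam y + q y" for y using pl[of y] q[of y] by simp
    have B: "sets ?B = sets path_space"
      by (simp only: bridge_measure_def sets_measure_of[OF sets.space_closed] sets.sigma_sets_eq)
    have fe: "(\<lambda>\<gamma>. ennreal (field_exp r (?o \<gamma>))) \<in> borel_measurable ?B" for r
      using measurable_field_exp_occupation[of r] by (simp cong: measurable_cong_sets[OF B refl])
    have "(\<integral>\<^sup>+\<gamma>. ?g p \<gamma> \<partial>?B) = (\<integral>\<^sup>+\<gamma>. ennreal (field_exp (\<lambda>y. p * lam y) (?o \<gamma>)) - ennreal (field_exp (\<lambda>y. p * lam y + q y) (?o \<gamma>)) \<partial>?B)"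
      by (intro nn_integral_cong ennreal_minus[symmetric]) (simp add: less_imp_le[OF field_exp_pos])
    also have "\<dots> = (\<integral>\<^sup>+\<gamma>. ennreal (field_exp (\<lambda>y. p * lam y) (?o \<gamma>)) \<partial>?B) - (\<integral>\<^sup>+\<gamma>. ennreal (field_exp (\<lambda>y. p * lam y + q y) (?o \<gamma>)) \<partial>?B)"
    proof (rule nn_integral_diff[OF fe fe])
      show "(\<integral>\<^sup>+\<gamma>. ennreal (field_exp (\<lambda>y. p * lam y + q y) (?o \<gamma>)) \<partial>?B) \<noteq> \<infinity>"
        using bridge_laplace[where q = "\<lambda>y. p * lam y + q y", OF plq] by simp
      show "AE \<gamma> in ?B. ennreal (field_exp (\<lambda>y. p * lam y + q y) (?o \<gamma>)) \<le> ennreal (field_exp (\<lambda>y. p * lam y) (?o \<gamma>))"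
        unfolding field_exp_add_left
        by (intro AE_I2 ennreal_leI mult_right_le_one_le less_imp_le[OF field_exp_pos]
            field_exp_le_1[where q = q, OF q occupation_nonneg])
    qed
    also have "\<dots> = ennreal (W (\<lambda>y. p * lam y) x x - W (\<lambda>y. p * lam y + q y) x x)"
      unfolding bridge_laplace[where q = "\<lambda>y. p * lam y", OF pl] bridge_laplace[where q = "\<lambda>y. p * lam y + q y", OF plq]
      by (rule ennreal_minus[OF W_nonneg[OF plq]])
    finally have eq: "ennreal (1 / lam x) * (\<integral>\<^sup>+t. \<integral>\<^sup>+\<omega>. bridge_density (?g p) x x t \<omega> \<partial>?D \<partial>lborel)
       = ennreal (W (\<lambda>y. p * lam y) x x - W (\<lambda>y. p * lam y + q y) x x)"
      by (simp only: nn_integral_bridge[OF gm])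
    have c: "ennreal (lam x) * ennreal (1 / lam x) = 1"
      using lam_pos[of x] by (simp add: ennreal_mult[symmetric])
    have le: "W (\<lambda>y. p * lam y + q y) x x \<le> W (\<lambda>y. p * lam y) x x"
      using pl q by (intro W_antimono) auto
    have "ennreal (lam x) * (ennreal (1 / lam x) * (\<integral>\<^sup>+t. \<integral>\<^sup>+\<omega>. bridge_density (?g p) x x t \<omega> \<partial>?D \<partial>lborel))
      = ennreal (lam x * (W (\<lambda>y. p * lam y) x x - W (\<lambda>y. p * lam y + q y) x x))"
      unfolding eq using lam_pos[of x] le by (intro ennreal_mult[symmetric]) auto
    then show ?thesis by (simp only: mult.assoc[symmetric] c mult_1)
  qed
  have pos: "0 \<le> lam x * (W (\<lambda>y. p * lam y) x x - W (\<lambda>y. p * lam y + q y) x x)" if "0 \<le> p" for p x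
    using that lam_pos q by (intro mult_nonneg_nonneg) (auto intro!: W_antimono simp: less_imp_le)
  \<comment> \<open>Measurability in p is read off from the resolvent formula, with the coupling
    constants 0 and 1 in the clamped form of \<open>measurable_W\<close>.\<close>
  have mW: "(\<lambda>p. indicator {0..} p * (\<integral>\<^sup>+t. \<integral>\<^sup>+\<omega>. bridge_density (?g p) x x t \<omega> \<partial>?D \<partial>lborel)) \<in> borel_measurable lborel" for x
  proof -
    have "(\<lambda>p. indicator {0..} p * ennreal (lam x * (W (\<lambda>y. max 0 p * lam y + max 0 0 * \<bar>q y\<bar>) x x - W (\<lambda>y. max 0 p * lam y + max 0 1 * \<bar>q y\<bar>) x x))) \<in> borel_measurable lborel"
      by (intro borel_measurable_times_ennreal measurable_compose[OF _ measurable_ennreal] borel_measurable_times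
          borel_measurable_diff borel_measurable_const measurable_W) simp_all
    moreover have "indicator {0..} p * (\<integral>\<^sup>+t. \<integral>\<^sup>+\<omega>. bridge_density (?g p) x x t \<omega> \<partial>?D \<partial>lborel)
       = indicator {0..} p * ennreal (lam x * (W (\<lambda>y. max 0 p * lam y + max 0 0 * \<bar>q y\<bar>) x x - W (\<lambda>y. max 0 p * lam y + max 0 1 * \<bar>q y\<bar>) x x))" for p
      using q by (cases "0 \<le> p") (simp_all add: inner)
    ultimately show ?thesis by simp
  qed
  have "(\<integral>\<^sup>+l. ?f l \<partial>loop_measure C \<kappa>)
    = (\<Sum>x\<in>UNIV. \<integral>\<^sup>+p. indicator {0..} p * (\<integral>\<^sup>+t. \<integral>\<^sup>+\<omega>. bridge_density (?g p) x x t \<omega> \<partial>?D \<partial>lborel) \<partial>lborel)"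
    unfolding nn_integral_loop_measure[OF fm] swap ..
  also have "\<dots> = (\<integral>\<^sup>+p. (\<Sum>x\<in>UNIV. indicator {0..} p * (\<integral>\<^sup>+t. \<integral>\<^sup>+\<omega>. bridge_density (?g p) x x t \<omega> \<partial>?D \<partial>lborel)) \<partial>lborel)"
    by (rule nn_integral_sum[symmetric]) (rule mW)
  also have "\<dots> = (\<integral>\<^sup>+p. ennreal (\<Sum>x\<in>UNIV. lam x * (W (\<lambda>y. p * lam y) x x - W (\<lambda>y. p * lam y + q y) x x)) * indicator {0..} p \<partial>lborel)"
  proof (rule nn_integral_cong)
    fix p :: real
    show "(\<Sum>x\<in>UNIV. indicator {0..} p * (\<integral>\<^sup>+t. \<integral>\<^sup>+\<omega>. bridge_density (?g p) x x t \<omega> \<partial>?D \<partial>lborel))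
      = ennreal (\<Sum>x\<in>UNIV. lam x * (W (\<lambda>y. p * lam y) x x - W (\<lambda>y. p * lam y + q y) x x)) * indicator {0..} p"
      by (cases "0 \<le> p") (simp_all add: inner sum_ennreal pos)
  qed
  finally show ?thesis .
qed

text \<open>Differentiating the integrand in the coupling constant \<open>s\<close> of the potential \<open>s q\<close> gives the
  \<open>p\<close>-derivative of \<open>\<Sum>z. q z W z z\<close>; the \<open>p\<close>-integral is then explicit.\<close>

theorem loop_laplace:
  assumes q: "\<And>x. 0 \<le> q x"
  shows "(\<integral>\<^sup>+l. ennreal (1 - field_exp q (occupation C \<kappa> l)) \<partial>loop_measure C \<kappa>)
    = (\<integral>\<^sup>+s. ennreal (\<Sum>z\<in>UNIV. q z * W (\<lambda>y. s * q y) z z) * indicator {0..1} s \<partial>lborel)"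
proof -
  define R where "R p s = W (\<lambda>y. max 0 p * lam y + max 0 s * \<bar>q y\<bar>)" for p s
  \<comment> \<open>Symmetric in the roles of the two parameters: k is minus the s-derivative of the
    sum of \<open>lam x * W x x\<close>, and also minus the p-derivative of the sum of
    \<open>q z * W z z\<close>, at the potential \<open>p * lam y + s * q y\<close>.\<close>
  define k where "k p s = (\<Sum>x\<in>UNIV. \<Sum>z\<in>UNIV. lam x * R p s x z * q z * R p s z x)" for p s
  have R_eq: "R p s = W (\<lambda>y. p * lam y + s * q y)" if "0 \<le> p" "0 \<le> s" for p s
    using that q by (simp add: R_def)
  have pot: "0 \<le> p * lam y + s * q y" if "0 \<le> p" "0 \<le> s" for p s y
    using that q lam_pos[of y] by (simp add: less_imp_le)
  have R_nonneg: "0 \<le> R p s x y" for p s x y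
    unfolding R_def using lam_pos by (intro W_nonneg) (simp add: less_imp_le)
  have k_nonneg: "0 \<le> k p s" for p s
    unfolding k_def using lam_pos q by (intro sum_nonneg mult_nonneg_nonneg R_nonneg) (auto simp: less_imp_le)
  have R_meas: "(\<lambda>\<omega>. R (f \<omega>) (g \<omega>) x y) \<in> borel_measurable M"
    if "f \<in> borel_measurable M" "g \<in> borel_measurable M" for f g x y and M :: "'m measure"
    unfolding R_def by (rule measurable_W[OF that])
  have k1: "(\<lambda>p. k p s) \<in> borel_measurable borel" and k2: "(\<lambda>s. k p s) \<in> borel_measurable borel" for p s
    unfolding k_def R_def by (intro borel_measurable_sum borel_measurable_times borel_measurable_const measurable_W; simp)+
  have k12: "(\<lambda>(p, s). ennreal (k p s) * indicator {0..1} s * indicator {0..} p) \<in> borel_measurable (lborel \<Otimes>\<^sub>M lborel)"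
  proof -
    have "(\<lambda>w. k (fst w) (snd w)) \<in> borel_measurable (lborel \<Otimes>\<^sub>M lborel)"
      unfolding k_def R_def
      by (intro borel_measurable_sum borel_measurable_times borel_measurable_const measurable_W; simp)
    moreover have "(\<lambda>w. indicator {0..1::real} (snd w) :: ennreal) \<in> borel_measurable (lborel \<Otimes>\<^sub>M lborel)"
      by (rule measurable_compose[OF measurable_snd]) simp
    moreover have "(\<lambda>w. indicator {0::real..} (fst w) :: ennreal) \<in> borel_measurable (lborel \<Otimes>\<^sub>M lborel)"
      by (rule measurable_compose[OF measurable_fst]) simp
    ultimately show ?thesis
      unfolding case_prod_beta by (intro borel_measurable_times_ennreal measurable_compose[OF _ measurable_ennreal]) simp_all
  qed
  have s_int: "(\<integral>\<^sup>+s. ennreal (k p s) * indicator {0..1} s \<partial>lborel)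
     = ennreal (\<Sum>x\<in>UNIV. lam x * (W (\<lambda>y. p * lam y) x x - W (\<lambda>y. p * lam y + q y) x x))" if p: "0 \<le> p" for p
  proof -
    let ?F = "\<lambda>s. - (\<Sum>x\<in>UNIV. lam x * W (\<lambda>y. p * lam y + s * q y) x x)"
    have "(\<integral>\<^sup>+s. ennreal (k p s) * indicator {0..1} s \<partial>lborel) = ennreal (?F 1 - ?F 0)"
    proof (rule nn_integral_FTC_Icc_within[OF k2])
      fix s :: real assume s: "0 \<le> s" "s \<le> 1"
      have d: "((\<lambda>s. W (\<lambda>y. p * lam y + s * q y) x x) has_real_derivative - (\<Sum>z\<in>UNIV. R p s x z * q z * R p s z x)) (at s within {0..1})" for x
        unfolding R_eq[OF p s(1)]
        by (rule DERIV_subset[OF W_has_derivative]) (use p s q lam_pos in \<open>auto simp: less_imp_le\<close>)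
      have "(?F has_real_derivative - (\<Sum>x\<in>UNIV. lam x * - (\<Sum>z\<in>UNIV. R p s x z * q z * R p s z x))) (at s within {0..1})"
        by (intro DERIV_minus DERIV_sum DERIV_cmult d)
      then show "(?F has_real_derivative k p s) (at s within {0..1})"
        by (simp add: k_def sum_distrib_left sum_negf mult.assoc)
    qed (use k_nonneg in auto)
    also have "?F 1 - ?F 0 = (\<Sum>x\<in>UNIV. lam x * (W (\<lambda>y. p * lam y) x x - W (\<lambda>y. p * lam y + q y) x x))"
      by (simp add: right_diff_distrib sum_subtractf)
    finally show ?thesis .
  qed
  \<comment> \<open>Only the boundary term at p = 0 survives, since the resolvent tends to 0 as p
    grows.\<close>
  have p_int: "(\<integral>\<^sup>+p. ennreal (k p s) * indicator {0..} p \<partial>lborel) = ennreal (\<Sum>z\<in>UNIV. q z * W (\<lambda>y. s * q y) z z)"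
    if s: "0 \<le> s" for s
  proof -
    let ?F = "\<lambda>p. - (\<Sum>z\<in>UNIV. q z * W (\<lambda>y. s * q y + p * lam y) z z)"
    have "(\<integral>\<^sup>+p. ennreal (k p s) * indicator {0..} p \<partial>lborel) = ennreal (0 - ?F 0)"
    proof (rule nn_integral_FTC_atLeast_within[OF k1])
      fix p :: real assume p: "0 \<le> p"
      have "((\<lambda>p. W (\<lambda>y. s * q y + p * lam y) z z) has_real_derivative
         - (\<Sum>x\<in>UNIV. W (\<lambda>y. s * q y + p * lam y) z x * lam x * W (\<lambda>y. s * q y + p * lam y) x z)) (at p within {0..})" for z
        using p s q lam_pos by (intro W_has_derivative) (auto simp: less_imp_le)
      then have d: "((\<lambda>p. W (\<lambda>y. s * q y + p * lam y) z z) has_real_derivative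
         - (\<Sum>x\<in>UNIV. R p s z x * lam x * R p s x z)) (at p within {0..})" for z
        unfolding R_eq[OF p s] by (simp only: add.commute)
      have "(?F has_real_derivative - (\<Sum>z\<in>UNIV. q z * - (\<Sum>x\<in>UNIV. R p s z x * lam x * R p s x z))) (at p within {0..})"
        by (intro DERIV_minus DERIV_sum DERIV_cmult d)
      also have "- (\<Sum>z\<in>UNIV. q z * - (\<Sum>x\<in>UNIV. R p s z x * lam x * R p s x z)) = k p s"
        unfolding k_def by (subst sum.swap) (simp add: sum_distrib_left sum_negf mult_ac)
      finally show "(?F has_real_derivative k p s) (at p within {0..})" .
    next
      have "((\<lambda>p. - (\<Sum>z\<in>UNIV. q z * W (\<lambda>y. s * q y + p * lam y) z z)) \<longlongrightarrow> - (\<Sum>z\<in>UNIV. q z * 0)) at_top"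
        using s q by (intro tendsto_minus tendsto_sum tendsto_mult tendsto_const W_tendsto_0) simp
      then show "(?F \<longlongrightarrow> 0) at_top" by simp
    qed (use k_nonneg in auto)
    then show ?thesis by simp
  qed
  have "(\<integral>\<^sup>+l. ennreal (1 - field_exp q (occupation C \<kappa> l)) \<partial>loop_measure C \<kappa>)
    = (\<integral>\<^sup>+p. (\<integral>\<^sup>+s. ennreal (k p s) * indicator {0..1} s \<partial>lborel) * indicator {0..} p \<partial>lborel)"
    unfolding loop_resolvent_integral[OF q] by (intro nn_integral_cong) (simp add: s_int split: split_indicator)
  also have "\<dots> = (\<integral>\<^sup>+p. \<integral>\<^sup>+s. ennreal (k p s) * indicator {0..1} s * indicator {0..} p \<partial>lborel \<partial>lborel)"
    by (subst nn_integral_multc) (use k2 in auto)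
  also have "\<dots> = (\<integral>\<^sup>+s. \<integral>\<^sup>+p. ennreal (k p s) * indicator {0..1} s * indicator {0..} p \<partial>lborel \<partial>lborel)"
    by (rule lborel_pair.Fubini'[symmetric]) (use k12 in \<open>simp add: case_prod_beta\<close>)
  also have "\<dots> = (\<integral>\<^sup>+s. (\<integral>\<^sup>+p. ennreal (k p s) * indicator {0..} p \<partial>lborel) * indicator {0..1} s \<partial>lborel)"
  proof (rule nn_integral_cong)
    fix s :: real
    show "(\<integral>\<^sup>+p. ennreal (k p s) * indicator {0..1} s * indicator {0..} p \<partial>lborel)
      = (\<integral>\<^sup>+p. ennreal (k p s) * indicator {0..} p \<partial>lborel) * indicator {0..1} s"
      by (cases "s \<in> {0..1}") simp_all
  qed
  also have "\<dots> = (\<integral>\<^sup>+s. ennreal (\<Sum>z\<in>UNIV. q z * W (\<lambda>y. s * q y) z z) * indicator {0..1} s \<partial>lborel)"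
    by (intro nn_integral_cong) (simp add: p_int split: split_indicator)
  finally show ?thesis .
qed

end

section \<open>Gaussian integration by parts\<close>

lemma norm_iexp_diff_le: "cmod (iexp (u + t) - iexp u) \<le> \<bar>t\<bar>"
proof -
  have "iexp (u + t) - iexp u = iexp u * (iexp t - 1)"
    by (simp add: exp_add algebra_simps)
  then have "cmod (iexp (u + t) - iexp u) = cmod (iexp t - 1)"
    by (simp add: norm_mult)
  also have "\<dots> \<le> \<bar>t\<bar>" using iexp_approx1[of t 0] by simp
  finally show ?thesis .
qed

lemma tendsto_iexp_quotient:
  assumes h: "h \<longlonglongrightarrow> 0" "\<And>n. h n \<noteq> (0::real)"
  shows "(\<lambda>n. (iexp (u + h n * t) - iexp u) / complex_of_real (h n)) \<longlonglongrightarrow> \<i> * complex_of_real t * iexp u"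
proof -
  have "(\<lambda>n. (iexp (u + h n * t) - iexp u) / complex_of_real (h n) - \<i> * complex_of_real t * iexp u) \<longlonglongrightarrow> 0"
  proof (rule Lim_null_comparison)
    have "(\<lambda>n. \<bar>h n\<bar> * t\<^sup>2 / 2) \<longlonglongrightarrow> \<bar>0\<bar> * t\<^sup>2 / 2" by (intro tendsto_intros h) simp
    then show "(\<lambda>n. \<bar>h n\<bar> * t\<^sup>2 / 2) \<longlonglongrightarrow> 0" by simp
    show "\<forall>\<^sub>F n in sequentially. cmod ((iexp (u + h n * t) - iexp u) / complex_of_real (h n) - \<i> * complex_of_real t * iexp u) \<le> \<bar>h n\<bar> * t\<^sup>2 / 2"
    proof (intro always_eventually allI)
      fix n
      have hn: "complex_of_real (h n) \<noteq> 0" using h(2) by simp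
      have "(iexp (u + h n * t) - iexp u) / complex_of_real (h n) - \<i> * complex_of_real t * iexp u
        = iexp u * ((iexp (h n * t) - (1 + \<i> * complex_of_real (h n * t))) / complex_of_real (h n))"
        using hn by (simp add: exp_add field_simps)
      then have "cmod ((iexp (u + h n * t) - iexp u) / complex_of_real (h n) - \<i> * complex_of_real t * iexp u)
        = cmod (iexp (h n * t) - (1 + \<i> * complex_of_real (h n * t))) / \<bar>h n\<bar>"
        by (simp add: norm_mult norm_divide)
      also have "\<dots> \<le> (\<bar>h n * t\<bar>\<^sup>2 / 2) / \<bar>h n\<bar>"
        using iexp_approx1[of "h n * t" 1] by (intro divide_right_mono) (simp_all add: numeral_2_eq_2)
      also have "\<dots> = \<bar>h n\<bar> * t\<^sup>2 / 2"
        using h(2)[of n] by (simp add: abs_mult power2_eq_square field_simps)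
      finally show "cmod ((iexp (u + h n * t) - iexp u) / complex_of_real (h n) - \<i> * complex_of_real t * iexp u) \<le> \<bar>h n\<bar> * t\<^sup>2 / 2" .
    qed
  qed
  then show ?thesis by (simp add: LIM_zero_iff)
qed

text \<open>Differentiation of a characteristic function under the integral, dominated by |X Y|. The
  prefactor Y allows repetition: Y = 1 gives first moments, Y a coordinate of the field gives second
  ones.\<close>

lemma tendsto_integral_iexp_quotient:
  fixes X Y U :: "'a \<Rightarrow> real"
  assumes [measurable]: "X \<in> borel_measurable M" "U \<in> borel_measurable M"
    and Y: "integrable M Y" and XY: "integrable M (\<lambda>\<omega>. X \<omega> * Y \<omega>)"
    and h: "h \<longlonglongrightarrow> 0" "\<And>n. h n \<noteq> (0::real)"
  shows "(\<lambda>n. ((LINT \<omega>|M. complex_of_real (Y \<omega>) * iexp (U \<omega> + h n * X \<omega>)) - (LINT \<omega>|M. complex_of_real (Y \<omega>) * iexp (U \<omega>))) / complex_of_real (h n))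
    \<longlonglongrightarrow> (LINT \<omega>|M. \<i> * complex_of_real (X \<omega> * Y \<omega>) * iexp (U \<omega>))"
proof -
  have [measurable]: "Y \<in> borel_measurable M" using Y by (rule borel_measurable_integrable)
  have int: "integrable M (\<lambda>\<omega>. complex_of_real (Y \<omega>) * iexp (V \<omega>))" if [measurable]: "V \<in> borel_measurable M" for V
    by (rule Bochner_Integration.integrable_bound[OF Y]) (measurable, simp add: norm_mult)
  let ?F = "\<lambda>n \<omega>. complex_of_real (Y \<omega>) * ((iexp (U \<omega> + h n * X \<omega>) - iexp (U \<omega>)) / complex_of_real (h n))"
  have "((LINT \<omega>|M. complex_of_real (Y \<omega>) * iexp (U \<omega> + h n * X \<omega>)) - (LINT \<omega>|M. complex_of_real (Y \<omega>) * iexp (U \<omega>))) / complex_of_real (h n)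
    = (LINT \<omega>|M. ?F n \<omega>)" for n
  proof -
    have "(LINT \<omega>|M. ?F n \<omega>) = (LINT \<omega>|M. (complex_of_real (Y \<omega>) * iexp (U \<omega> + h n * X \<omega>) - complex_of_real (Y \<omega>) * iexp (U \<omega>)) / complex_of_real (h n))"
      by (simp add: right_diff_distrib)
    also have "\<dots> = ((LINT \<omega>|M. complex_of_real (Y \<omega>) * iexp (U \<omega> + h n * X \<omega>)) - (LINT \<omega>|M. complex_of_real (Y \<omega>) * iexp (U \<omega>))) / complex_of_real (h n)"
    proof -
      have "(\<lambda>\<omega>. U \<omega> + h n * X \<omega>) \<in> borel_measurable M" by measurable
      from Bochner_Integration.integral_diff[OF int[OF this] int[of U]]
      show ?thesis unfolding integral_divide_zero by simp
    qed
    finally show ?thesis by (rule sym)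
  qed
  moreover have "(\<lambda>n. LINT \<omega>|M. ?F n \<omega>) \<longlonglongrightarrow> (LINT \<omega>|M. \<i> * complex_of_real (X \<omega> * Y \<omega>) * iexp (U \<omega>))"
  proof (rule integral_dominated_convergence[where w = "\<lambda>\<omega>. \<bar>X \<omega> * Y \<omega>\<bar>"])
    show "integrable M (\<lambda>\<omega>. \<bar>X \<omega> * Y \<omega>\<bar>)" using XY by simp
    show "AE \<omega> in M. (\<lambda>n. ?F n \<omega>) \<longlonglongrightarrow> \<i> * complex_of_real (X \<omega> * Y \<omega>) * iexp (U \<omega>)"
    proof (rule AE_I2)
      fix \<omega>
      have "(\<lambda>n. ?F n \<omega>) \<longlonglongrightarrow> complex_of_real (Y \<omega>) * (\<i> * complex_of_real (X \<omega>) * iexp (U \<omega>))"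
        by (intro tendsto_mult tendsto_const tendsto_iexp_quotient h)
      then show "(\<lambda>n. ?F n \<omega>) \<longlonglongrightarrow> \<i> * complex_of_real (X \<omega> * Y \<omega>) * iexp (U \<omega>)"
        by (simp add: mult_ac)
    qed
    show "AE \<omega> in M. cmod (?F n \<omega>) \<le> \<bar>X \<omega> * Y \<omega>\<bar>" for n
    proof (rule AE_I2)
      fix \<omega>
      have "cmod (?F n \<omega>) \<le> \<bar>Y \<omega>\<bar> * (\<bar>h n * X \<omega>\<bar> / \<bar>h n\<bar>)"
        unfolding norm_mult norm_divide norm_of_real
        by (intro mult_left_mono divide_right_mono norm_iexp_diff_le) auto
      also have "\<dots> = \<bar>X \<omega> * Y \<omega>\<bar>" using h(2)[of n] by (simp add: abs_mult)
      finally show "cmod (?F n \<omega>) \<le> \<bar>X \<omega> * Y \<omega>\<bar>" .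
    qed
  qed measurable
  ultimately show ?thesis by (simp only: )
qed

lemma tendsto_quotient_of_DERIV:
  fixes r :: "real \<Rightarrow> real"
  assumes "(r has_real_derivative D) (at 0)" and h: "h \<longlonglongrightarrow> 0" "\<And>n. h n \<noteq> (0::real)"
  shows "(\<lambda>n. (complex_of_real (r (h n)) - complex_of_real (r 0)) / complex_of_real (h n)) \<longlonglongrightarrow> complex_of_real D"
proof -
  have "((\<lambda>y. (r y - r 0) / (y - 0)) \<longlongrightarrow> D) (at 0)"
    using assms(1) by (simp add: has_field_derivative_iff)
  moreover have "filterlim h (at 0) sequentially"
    using h by (auto simp: filterlim_at intro: always_eventually)
  ultimately have "(\<lambda>n. (r (h n) - r 0) / (h n - 0)) \<longlonglongrightarrow> D" by (rule filterlim_compose)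
  then have "(\<lambda>n. complex_of_real ((r (h n) - r 0) / (h n - 0))) \<longlonglongrightarrow> complex_of_real D" by (rule tendsto_of_real)
  then show ?thesis by simp
qed

lemma inverse_Suc_seq: "(\<lambda>n. inverse (real (Suc n))) \<longlonglongrightarrow> 0" "inverse (real (Suc n)) \<noteq> 0"
  by (rule LIMSEQ_inverse_real_of_nat) simp

lemma std_normal_iexp: "(LINT x|std_normal_distribution. iexp (t * x)) = complex_of_real (exp (- t\<^sup>2 / 2))"
  using fun_cong[OF char_std_normal_distribution, of t] by (simp add: char_def)

lemma integrable_std_normal_moment_distribution: "integrable std_normal_distribution (\<lambda>x. x ^ k)"
  using integrable_std_normal_moment[of k] by (subst integrable_density) (auto simp: ac_simps)

lemma std_normal_moment_iexp:
  "(LINT x|std_normal_distribution. complex_of_real x * iexp (t * x)) = \<i> * complex_of_real (t * exp (- t\<^sup>2 / 2))"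
proof -
  interpret prob_space std_normal_distribution by (rule prob_space_normal_density) simp
  let ?h = "\<lambda>n. inverse (real (Suc n))"
  have i1: "integrable std_normal_distribution (\<lambda>x. x * 1)" using integrable_std_normal_moment_distribution[of 1] by simp
  have "(\<lambda>n. ((LINT x|std_normal_distribution. complex_of_real 1 * iexp (t * x + ?h n * x)) - (LINT x|std_normal_distribution. complex_of_real 1 * iexp (t * x))) / complex_of_real (?h n))
    \<longlonglongrightarrow> (LINT x|std_normal_distribution. \<i> * complex_of_real (x * 1) * iexp (t * x))"
    by (rule tendsto_integral_iexp_quotient[OF _ _ _ i1 inverse_Suc_seq]) auto
  moreover have "(\<lambda>n. ((LINT x|std_normal_distribution. complex_of_real 1 * iexp (t * x + ?h n * x)) - (LINT x|std_normal_distribution. complex_of_real 1 * iexp (t * x))) / complex_of_real (?h n))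
    = (\<lambda>n. (complex_of_real (exp (- (t + ?h n)\<^sup>2 / 2)) - complex_of_real (exp (- (t + 0)\<^sup>2 / 2))) / complex_of_real (?h n))"
    by (simp only: distrib_right[symmetric] std_normal_iexp of_real_1 mult_1 add_0_right)
  moreover have "(\<lambda>n. (complex_of_real (exp (- (t + ?h n)\<^sup>2 / 2)) - complex_of_real (exp (- (t + 0)\<^sup>2 / 2))) / complex_of_real (?h n))
     \<longlonglongrightarrow> complex_of_real (- t * exp (- t\<^sup>2 / 2))"
    by (rule tendsto_quotient_of_DERIV[OF _ inverse_Suc_seq]) (auto intro!: derivative_eq_intros)
  ultimately have "(LINT x|std_normal_distribution. \<i> * complex_of_real (x * 1) * iexp (t * x)) = complex_of_real (- t * exp (- t\<^sup>2 / 2))"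
    by (simp only: LIMSEQ_unique)
  then have "\<i> * (LINT x|std_normal_distribution. complex_of_real x * iexp (t * x)) = \<i> * (\<i> * complex_of_real (t * exp (- t\<^sup>2 / 2)))"
    by (simp add: mult.assoc)
  then show ?thesis by (simp only: mult_left_cancel[OF complex_i_not_zero])
qed

section \<open>Characteristic functions and moments of Gaussian variables and vectors\<close>

context
  fixes M :: "'p measure" and Y :: "'p \<Rightarrow> real"
  assumes prob: "prob_space M" and gauss: "gaussian_rv M Y"
begin

interpretation prob_space M by (rule prob)

lemma gaussian_integrable: "integrable M Y" and gaussian_square_integrable: "integrable M (\<lambda>\<omega>. (Y \<omega>)\<^sup>2)"
proof -
  have [measurable]: "Y \<in> borel_measurable M" using gauss by (simp add: gaussian_rv_def)
  consider m where "AE \<omega> in M. Y \<omega> = m" | m \<sigma> where "0 < \<sigma>" "distributed M lborel Y (normal_density m \<sigma>)"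
    using gauss by (auto simp: gaussian_rv_def)
  then have "integrable M Y \<and> integrable M (\<lambda>\<omega>. (Y \<omega>)\<^sup>2)"
  proof cases
    case 1
    have "integrable M Y"
      by (rule integrable_cong_AE_imp[where g = "\<lambda>_. m"]) (use 1 in \<open>auto elim!: eventually_mono\<close>)
    moreover have "integrable M (\<lambda>\<omega>. (Y \<omega>)\<^sup>2)"
      by (rule integrable_cong_AE_imp[where g = "\<lambda>_. m\<^sup>2"]) (use 1 in \<open>auto elim!: eventually_mono\<close>)
    ultimately show ?thesis by simp
  next
    case 2
    have c: "integrable M (\<lambda>\<omega>. (Y \<omega> - m) ^ k)" for k
    proof -
      have "integrable lborel (\<lambda>x. normal_density m \<sigma> x * (x - m) ^ k)"
        using integrable_normal_moment[OF 2(1)] .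
      then show ?thesis
        using distributed_integrable[OF 2(2), of "\<lambda>x. (x - m) ^ k"] by simp
    qed
    have "integrable M (\<lambda>\<omega>. (Y \<omega> - m) ^ 1 + m)" "integrable M (\<lambda>\<omega>. (Y \<omega> - m) ^ 2 + (2 * m * (Y \<omega> - m) ^ 1 + m\<^sup>2))"
      by (intro Bochner_Integration.integrable_add integrable_mult_right c integrable_const)+
    moreover have "(Y \<omega> - m) ^ 2 + (2 * m * (Y \<omega> - m) ^ 1 + m\<^sup>2) = (Y \<omega>)\<^sup>2" for \<omega>
      by (simp add: power2_eq_square algebra_simps)
    ultimately show ?thesis by simp
  qed
  then show "integrable M Y" "integrable M (\<lambda>\<omega>. (Y \<omega>)\<^sup>2)" by auto
qed

text \<open>A degenerate variable with mean 0 is almost surely 0, so v = 0; otherwise rescaling by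
  \<sigma> reduces to the standard normal law.\<close>

lemma gaussian_char:
  assumes mean: "expectation Y = 0" and var: "expectation (\<lambda>\<omega>. (Y \<omega>)\<^sup>2) = v"
  shows "(LINT \<omega>|M. iexp (Y \<omega>)) = complex_of_real (exp (- v / 2))"
proof -
  have [measurable]: "Y \<in> borel_measurable M" using gauss by (simp add: gaussian_rv_def)
  consider m where "AE \<omega> in M. Y \<omega> = m" | m \<sigma> where "0 < \<sigma>" "distributed M lborel Y (normal_density m \<sigma>)"
    using gauss by (auto simp: gaussian_rv_def)
  then show ?thesis
  proof cases
    case 1
    have "expectation Y = expectation (\<lambda>_. m)" using 1 by (intro integral_cong_AE) auto
    then have m: "m = 0" using mean by (simp add: prob_space)
    have "expectation (\<lambda>\<omega>. (Y \<omega>)\<^sup>2) = expectation (\<lambda>_. 0)" using 1 m by (intro integral_cong_AE) auto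
    then have v: "v = 0" using var by simp
    have "(LINT \<omega>|M. iexp (Y \<omega>)) = (LINT \<omega>|M. 1)" using 1 m by (intro integral_cong_AE) auto
    then show ?thesis by (simp add: v prob_space)
  next
    case 2
    have m: "m = 0"
      using distributed_integral[OF 2(2), of "\<lambda>x. x"] integral_normal_moment_nz_1[OF 2(1), of m] mean by simp
    have "expectation (\<lambda>\<omega>. (Y \<omega>)\<^sup>2) = (LINT x|lborel. normal_density m \<sigma> x * (x - m) ^ (2 * 1))"
      using distributed_integral[OF 2(2), of "\<lambda>x. x\<^sup>2"] by (simp add: m)
    also have "\<dots> = \<sigma>\<^sup>2" using integral_normal_moment_even[OF 2(1), of m 1] by simp
    finally have v: "v = \<sigma>\<^sup>2" using var by simp
    have "distributed M lborel (\<lambda>\<omega>. Y \<omega> / \<sigma>) std_normal_density"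
      using 2 normal_standard_normal_convert[OF 2(1), of Y m] by (simp add: m)
    then have d: "distr M lborel (\<lambda>\<omega>. Y \<omega> / \<sigma>) = std_normal_distribution"
      by (rule distributed_distr_eq_density)
    have "(LINT \<omega>|M. iexp (Y \<omega>)) = (LINT \<omega>|M. iexp (\<sigma> * (Y \<omega> / \<sigma>)))" using 2(1) by simp
    also have "\<dots> = (LINT x|distr M lborel (\<lambda>\<omega>. Y \<omega> / \<sigma>). iexp (\<sigma> * x))"
      by (subst integral_distr) simp_all
    also have "\<dots> = complex_of_real (exp (- \<sigma>\<^sup>2 / 2))" unfolding d by (rule std_normal_iexp)
    finally show ?thesis by (simp add: v)
  qed
qed

end

locale gaussian_vector =
  fixes M :: "'p measure" and K :: "real^'x::finite^'x" and \<phi> :: "'p \<Rightarrow> real^'x"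
  assumes centered: "centered_gaussian_vector M K \<phi>"
begin

sublocale prob_space M
  using centered by (simp add: centered_gaussian_vector_def)

lemma gaussian_inner: "gaussian_rv M (\<lambda>\<omega>. a \<bullet> \<phi> \<omega>)"
  using centered by (simp add: centered_gaussian_vector_def)

lemma gaussian_component: "gaussian_rv M (\<lambda>\<omega>. \<phi> \<omega> $ x)"
  using gaussian_inner[of "axis x 1"] by (simp add: inner_axis')

lemma measurable_component[measurable]: "(\<lambda>\<omega>. \<phi> \<omega> $ x) \<in> borel_measurable M"
  using gaussian_component by (simp add: gaussian_rv_def)

lemma measurable_inner[measurable]: "(\<lambda>\<omega>. a \<bullet> \<phi> \<omega>) \<in> borel_measurable M"
  using gaussian_inner by (simp add: gaussian_rv_def)

lemma measurable_field[measurable]: "\<phi> \<in> borel_measurable M"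
  by (rule borel_measurable_vecI) simp

lemma integrable_component: "integrable M (\<lambda>\<omega>. \<phi> \<omega> $ x)"
  by (rule gaussian_integrable[OF prob_space_axioms gaussian_component])

lemma integrable_square: "integrable M (\<lambda>\<omega>. (\<phi> \<omega> $ x)\<^sup>2)"
  by (rule gaussian_square_integrable[OF prob_space_axioms gaussian_component])

lemma integrable_product: "integrable M (\<lambda>\<omega>. \<phi> \<omega> $ x * \<phi> \<omega> $ y)"
proof (rule Bochner_Integration.integrable_bound)
  show "integrable M (\<lambda>\<omega>. (\<phi> \<omega> $ x)\<^sup>2 + (\<phi> \<omega> $ y)\<^sup>2)"
    by (intro Bochner_Integration.integrable_add integrable_square)
  show "AE \<omega> in M. norm (\<phi> \<omega> $ x * \<phi> \<omega> $ y) \<le> norm ((\<phi> \<omega> $ x)\<^sup>2 + (\<phi> \<omega> $ y)\<^sup>2)"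
  proof (rule AE_I2)
    fix \<omega>
    have "\<bar>a * b\<bar> \<le> a\<^sup>2 + b\<^sup>2" for a b :: real
    proof -
      have "2 * (\<bar>a\<bar> * \<bar>b\<bar>) \<le> a\<^sup>2 + b\<^sup>2"
        using sum_squares_bound[of "\<bar>a\<bar>" "\<bar>b\<bar>"] by (simp add: mult.assoc)
      moreover have "0 \<le> \<bar>a\<bar> * \<bar>b\<bar>" by simp
      ultimately show ?thesis unfolding abs_mult by linarith
    qed
    then show "norm (\<phi> \<omega> $ x * \<phi> \<omega> $ y) \<le> norm ((\<phi> \<omega> $ x)\<^sup>2 + (\<phi> \<omega> $ y)\<^sup>2)" by simp
  qed
qed simp

lemma mean_zero: "expectation (\<lambda>\<omega>. \<phi> \<omega> $ x) = 0"
  using centered by (simp add: centered_gaussian_vector_def)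

lemma covariance: "expectation (\<lambda>\<omega>. \<phi> \<omega> $ x * \<phi> \<omega> $ y) = K $ x $ y"
  using centered by (simp add: centered_gaussian_vector_def)

lemma K_sym: "K $ x $ y = K $ y $ x"
  unfolding covariance[symmetric] by (simp add: mult.commute)

text \<open>Each linear functional of the field is a centered Gaussian variable, with variance the
  quadratic form of K.\<close>

lemma char_field: "(LINT \<omega>|M. iexp (a \<bullet> \<phi> \<omega>)) = complex_of_real (exp (- (a \<bullet> (K *v a)) / 2))"
proof (rule gaussian_char[OF prob_space_axioms gaussian_inner])
  show "expectation (\<lambda>\<omega>. a \<bullet> \<phi> \<omega>) = 0"
    by (simp add: inner_vec_def integrable_component mean_zero)
  have "(a \<bullet> \<phi> \<omega>)\<^sup>2 = (\<Sum>x\<in>UNIV. \<Sum>y\<in>UNIV. a $ x * a $ y * (\<phi> \<omega> $ x * \<phi> \<omega> $ y))" for \<omega>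
    by (simp add: inner_vec_def power2_eq_square sum_product mult_ac)
  then have "expectation (\<lambda>\<omega>. (a \<bullet> \<phi> \<omega>)\<^sup>2) = (\<Sum>x\<in>UNIV. \<Sum>y\<in>UNIV. a $ x * a $ y * K $ x $ y)"
    by (simp add: integrable_product covariance)
  also have "\<dots> = a \<bullet> (K *v a)"
    by (simp add: inner_vec_def matrix_vector_mult_def sum_distrib_left mult_ac)
  finally show "expectation (\<lambda>\<omega>. (a \<bullet> \<phi> \<omega>)\<^sup>2) = a \<bullet> (K *v a)" .
qed

lemma inner_shift: "(a + h *\<^sub>R axis x 1) \<bullet> v = a \<bullet> v + h * v $ x"
  by (simp add: inner_add_left inner_axis')

lemma K_shift: "K *v (a + h *\<^sub>R axis x 1) = K *v a + h *\<^sub>R (\<chi> y. K $ y $ x)"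
  by (simp add: matrix_vector_right_distrib vec_eq_iff matrix_vector_mult_def axis_def
      if_distrib[of "\<lambda>t. _ * t"] distrib_left sum.distrib cong: if_cong)

lemma quadratic_shift:
  "(a + h *\<^sub>R axis x 1) \<bullet> (K *v (a + h *\<^sub>R axis x 1)) = a \<bullet> (K *v a) + 2 * h * (K *v a) $ x + h\<^sup>2 * K $ x $ x"
proof -
  have "a \<bullet> (\<chi> y. K $ y $ x) = (K *v a) $ x"
    by (simp add: inner_vec_def matrix_vector_mult_def K_sym[of _ x] mult.commute)
  then show ?thesis
    unfolding inner_shift unfolding K_shift by (simp add: inner_add_right power2_eq_square algebra_simps)
qed

lemma first_moment_iexp:
  "(LINT \<omega>|M. complex_of_real (\<phi> \<omega> $ x) * iexp (a \<bullet> \<phi> \<omega>))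
    = \<i> * complex_of_real ((K *v a) $ x * exp (- (a \<bullet> (K *v a)) / 2))"
proof -
  let ?h = "\<lambda>n. inverse (real (Suc n))"
  \<comment> \<open>The characteristic function at a shifted by h along the axis of x; its
    derivative at h = 0 produces the coordinate of \<open>K *v a\<close>.\<close>
  let ?r = "\<lambda>h. exp (- (a \<bullet> (K *v a) + 2 * h * (K *v a) $ x + h\<^sup>2 * K $ x $ x) / 2)"
  have i1: "integrable M (\<lambda>\<omega>. \<phi> \<omega> $ x * 1)" using integrable_component by simp
  have "(\<lambda>n. ((LINT \<omega>|M. complex_of_real 1 * iexp (a \<bullet> \<phi> \<omega> + ?h n * \<phi> \<omega> $ x)) - (LINT \<omega>|M. complex_of_real 1 * iexp (a \<bullet> \<phi> \<omega>))) / complex_of_real (?h n))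
    \<longlonglongrightarrow> (LINT \<omega>|M. \<i> * complex_of_real (\<phi> \<omega> $ x * 1) * iexp (a \<bullet> \<phi> \<omega>))"
    by (rule tendsto_integral_iexp_quotient[OF _ _ _ i1 inverse_Suc_seq]) auto
  moreover have "(\<lambda>n. ((LINT \<omega>|M. complex_of_real 1 * iexp (a \<bullet> \<phi> \<omega> + ?h n * \<phi> \<omega> $ x)) - (LINT \<omega>|M. complex_of_real 1 * iexp (a \<bullet> \<phi> \<omega>))) / complex_of_real (?h n))
    = (\<lambda>n. (complex_of_real (?r (?h n)) - complex_of_real (?r 0)) / complex_of_real (?h n))"
    unfolding inner_shift[symmetric] of_real_1 mult_1 char_field quadratic_shift by simp
  moreover have "(\<lambda>n. (complex_of_real (?r (?h n)) - complex_of_real (?r 0)) / complex_of_real (?h n))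
     \<longlonglongrightarrow> complex_of_real (- (K *v a) $ x * exp (- (a \<bullet> (K *v a)) / 2))"
    by (rule tendsto_quotient_of_DERIV[OF _ inverse_Suc_seq]) (auto intro!: derivative_eq_intros)
  ultimately have "(LINT \<omega>|M. \<i> * complex_of_real (\<phi> \<omega> $ x * 1) * iexp (a \<bullet> \<phi> \<omega>)) = complex_of_real (- (K *v a) $ x * exp (- (a \<bullet> (K *v a)) / 2))"
    by (simp only: LIMSEQ_unique)
  then have "\<i> * (LINT \<omega>|M. complex_of_real (\<phi> \<omega> $ x) * iexp (a \<bullet> \<phi> \<omega>))
      = \<i> * (\<i> * complex_of_real ((K *v a) $ x * exp (- (a \<bullet> (K *v a)) / 2)))"
    by (simp add: mult.assoc)
  then show ?thesis by (simp only: mult_left_cancel[OF complex_i_not_zero])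
qed

lemma second_moment_iexp:
  "(LINT \<omega>|M. complex_of_real (\<phi> \<omega> $ x * \<phi> \<omega> $ y) * iexp (a \<bullet> \<phi> \<omega>))
    = complex_of_real ((K $ x $ y - (K *v a) $ x * (K *v a) $ y) * exp (- (a \<bullet> (K *v a)) / 2))"
proof -
  let ?h = "\<lambda>n. inverse (real (Suc n))"
  \<comment> \<open>The first moment at the shifted point, divided by the imaginary unit;
    differentiating it once more gives the mixed second moment.\<close>
  let ?r = "\<lambda>h. ((K *v a) $ y + h * K $ y $ x) * exp (- (a \<bullet> (K *v a) + 2 * h * (K *v a) $ x + h\<^sup>2 * K $ x $ x) / 2)"
  have "(\<lambda>n. ((LINT \<omega>|M. complex_of_real (\<phi> \<omega> $ y) * iexp (a \<bullet> \<phi> \<omega> + ?h n * \<phi> \<omega> $ x)) - (LINT \<omega>|M. complex_of_real (\<phi> \<omega> $ y) * iexp (a \<bullet> \<phi> \<omega>))) / complex_of_real (?h n))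
    \<longlonglongrightarrow> (LINT \<omega>|M. \<i> * complex_of_real (\<phi> \<omega> $ x * \<phi> \<omega> $ y) * iexp (a \<bullet> \<phi> \<omega>))"
    by (rule tendsto_integral_iexp_quotient[OF _ _ integrable_component integrable_product inverse_Suc_seq]) auto
  moreover have "(\<lambda>n. ((LINT \<omega>|M. complex_of_real (\<phi> \<omega> $ y) * iexp (a \<bullet> \<phi> \<omega> + ?h n * \<phi> \<omega> $ x)) - (LINT \<omega>|M. complex_of_real (\<phi> \<omega> $ y) * iexp (a \<bullet> \<phi> \<omega>))) / complex_of_real (?h n))
    = (\<lambda>n. \<i> * ((complex_of_real (?r (?h n)) - complex_of_real (?r 0)) / complex_of_real (?h n)))"
  proof
    fix n
    have "(LINT \<omega>|M. complex_of_real (\<phi> \<omega> $ y) * iexp (a \<bullet> \<phi> \<omega> + ?h n * \<phi> \<omega> $ x)) = \<i> * complex_of_real (?r (?h n))"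
      unfolding inner_shift[symmetric] first_moment_iexp quadratic_shift unfolding K_shift by simp
    moreover have "(LINT \<omega>|M. complex_of_real (\<phi> \<omega> $ y) * iexp (a \<bullet> \<phi> \<omega>)) = \<i> * complex_of_real (?r 0)"
      unfolding first_moment_iexp by simp
    ultimately show "((LINT \<omega>|M. complex_of_real (\<phi> \<omega> $ y) * iexp (a \<bullet> \<phi> \<omega> + ?h n * \<phi> \<omega> $ x)) - (LINT \<omega>|M. complex_of_real (\<phi> \<omega> $ y) * iexp (a \<bullet> \<phi> \<omega>))) / complex_of_real (?h n)
      = \<i> * ((complex_of_real (?r (?h n)) - complex_of_real (?r 0)) / complex_of_real (?h n))"
      by (simp only: right_diff_distrib times_divide_eq_right)
  qed
  moreover have "(\<lambda>n. \<i> * ((complex_of_real (?r (?h n)) - complex_of_real (?r 0)) / complex_of_real (?h n)))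
     \<longlonglongrightarrow> \<i> * complex_of_real ((K $ x $ y - (K *v a) $ x * (K *v a) $ y) * exp (- (a \<bullet> (K *v a)) / 2))"
    by (intro tendsto_mult tendsto_const tendsto_quotient_of_DERIV[OF _ inverse_Suc_seq])
       (auto intro!: derivative_eq_intros simp: K_sym[of y x] algebra_simps)
  ultimately have "(LINT \<omega>|M. \<i> * complex_of_real (\<phi> \<omega> $ x * \<phi> \<omega> $ y) * iexp (a \<bullet> \<phi> \<omega>))
     = \<i> * complex_of_real ((K $ x $ y - (K *v a) $ x * (K *v a) $ y) * exp (- (a \<bullet> (K *v a)) / 2))"
    by (simp only: LIMSEQ_unique)
  then have "\<i> * (LINT \<omega>|M. complex_of_real (\<phi> \<omega> $ x * \<phi> \<omega> $ y) * iexp (a \<bullet> \<phi> \<omega>))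
     = \<i> * complex_of_real ((K $ x $ y - (K *v a) $ x * (K *v a) $ y) * exp (- (a \<bullet> (K *v a)) / 2))"
    by (simp add: mult.assoc)
  then show ?thesis by (simp only: mult_left_cancel[OF complex_i_not_zero])
qed

text \<open>Gaussian integration by parts, E(\<phi> x * f) = sum over z of K x z * E(d f / d z), for
  f(u) = u y * iexp (a \<bullet> u). Each term contains at most one explicit factor
  \<open>a $ z\<close>, which is what the averaging over a can handle.\<close>

lemma stein_iexp:
  "(LINT \<omega>|M. complex_of_real (\<phi> \<omega> $ x * \<phi> \<omega> $ y) * iexp (a \<bullet> \<phi> \<omega>))
    = complex_of_real (K $ x $ y) * (LINT \<omega>|M. iexp (a \<bullet> \<phi> \<omega>))
      + (\<Sum>z\<in>UNIV. complex_of_real (K $ x $ z) * (\<i> * complex_of_real (a $ z) * (LINT \<omega>|M. complex_of_real (\<phi> \<omega> $ y) * iexp (a \<bullet> \<phi> \<omega>))))"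
proof -
  have "(K *v a) $ x = (\<Sum>z\<in>UNIV. K $ x $ z * a $ z)" by (simp add: matrix_vector_mult_def)
  let ?e = "exp (- (a \<bullet> (K *v a)) / 2)"
  have trm: "complex_of_real (K $ x $ z) * (\<i> * complex_of_real (a $ z) * (\<i> * complex_of_real ((K *v a) $ y * ?e)))
      = complex_of_real (- (K $ x $ z * a $ z * ((K *v a) $ y * ?e)))" for z
  proof -
    have "k * (\<i> * b * (\<i> * c)) = - (k * b * c)" for k b c :: complex
    proof -
      have "k * (\<i> * b * (\<i> * c)) = (\<i> * \<i>) * (k * b * c)" by (simp only: mult_ac)
      then show ?thesis by simp
    qed
    from this[of "complex_of_real (K $ x $ z)" "complex_of_real (a $ z)" "complex_of_real ((K *v a) $ y * ?e)"]
    show ?thesis by (simp only: of_real_mult[symmetric] of_real_minus[symmetric])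
  qed
  have "(\<Sum>z\<in>UNIV. complex_of_real (K $ x $ z) * (\<i> * complex_of_real (a $ z) * (\<i> * complex_of_real ((K *v a) $ y * ?e))))
      = complex_of_real (- ((K *v a) $ x * ((K *v a) $ y * ?e)))"
    unfolding trm of_real_sum[symmetric] sum_negf sum_distrib_right[symmetric] \<open>(K *v a) $ x = _\<close>[symmetric] ..
  then show ?thesis
    unfolding second_moment_iexp first_moment_iexp char_field
    by (simp only: of_real_mult[symmetric] of_real_add[symmetric]) (simp add: left_diff_distrib)
qed

text \<open>The Gaussian weight \<open>exp (- (\<Sum>z. q z * (u $ z)\<^sup>2) / 2)\<close> is an average of characters
  \<open>u \<mapsto> iexp (a \<bullet> u)\<close> with \<open>a $ z = sqrt (q z) * \<xi> z\<close> for independent standard normal \<open>\<xi> z\<close>. Hence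
  the integration by parts formula for characters yields the one for the weight.\<close>

abbreviation normals :: "('x \<Rightarrow> real) measure" where
  "normals \<equiv> PiM UNIV (\<lambda>_. std_normal_distribution)"

definition mixed :: "('x \<Rightarrow> real) \<Rightarrow> ('x \<Rightarrow> real) \<Rightarrow> real^'x" where
  "mixed q \<xi> = (\<chi> z. sqrt (q z) * \<xi> z)"

definition weight :: "('x \<Rightarrow> real) \<Rightarrow> real^'x \<Rightarrow> real" where
  "weight q u = exp (- (\<Sum>z\<in>UNIV. q z * (u $ z)\<^sup>2) / 2)"

sublocale normals: prob_space normals
  by (intro prob_space_PiM prob_space_normal_density) simp

lemma measurable_normals_component: "(\<lambda>\<xi>. \<xi> z) \<in> borel_measurable normals"
  using measurable_component_singleton[of z UNIV "\<lambda>_. std_normal_distribution"] by simp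

lemma measurable_mixed: "mixed q \<in> borel_measurable normals"
  by (rule borel_measurable_vecI) (simp add: mixed_def measurable_normals_component borel_measurable_times)

lemma iexp_mixed: "iexp (mixed q \<xi> \<bullet> u) = (\<Prod>z\<in>UNIV. iexp (sqrt (q z) * u $ z * \<xi> z))"
  by (simp add: mixed_def inner_vec_def exp_sum[symmetric] sum_distrib_left mult_ac)

lemma integrable_std_normal_iexp:
  "integrable std_normal_distribution (\<lambda>x. iexp (t * x))"
  "integrable std_normal_distribution (\<lambda>x. complex_of_real x * iexp (t * x))"
proof -
  interpret S: prob_space std_normal_distribution by (rule prob_space_normal_density) simp
  show "integrable std_normal_distribution (\<lambda>x. iexp (t * x))"
    by (rule S.integrable_const_bound[where B = 1]) auto
  have "integrable std_normal_distribution (\<lambda>x. x ^ 1)" by (rule integrable_std_normal_moment_distribution)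
  then show "integrable std_normal_distribution (\<lambda>x. complex_of_real x * iexp (t * x))"
    by (rule Bochner_Integration.integrable_bound) (auto simp: norm_mult)
qed

lemma product_sigma_finite_normal: "product_sigma_finite (\<lambda>_::'x. std_normal_distribution)"
proof -
  interpret S: prob_space std_normal_distribution by (rule prob_space_normal_density) simp
  show ?thesis by unfold_locales
qed

lemma exp_of_real_prod: "(\<Prod>z\<in>UNIV. complex_of_real (exp (f (z::'x)))) = complex_of_real (exp (\<Sum>z\<in>UNIV. f z))"
  unfolding of_real_prod[symmetric] by (subst exp_sum) (rule finite, rule refl)

text \<open>The Hubbard-Stratonovich transformation: the coordinates of \<xi> are independent, so
  the average of the character factors into standard normal characteristic functions.\<close>

lemma integral_iexp_mixed:
  assumes q: "\<And>z. 0 \<le> q z"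
  shows "(LINT \<xi>|normals. iexp (mixed q \<xi> \<bullet> u)) = complex_of_real (weight q u)"
proof -
  interpret product_sigma_finite "\<lambda>_::'x. std_normal_distribution" by (rule product_sigma_finite_normal)
  have "(LINT \<xi>|normals. iexp (mixed q \<xi> \<bullet> u)) = (\<Prod>z\<in>UNIV. LINT x|std_normal_distribution. iexp (sqrt (q z) * u $ z * x))"
    unfolding iexp_mixed by (rule product_integral_prod[OF finite]) (rule integrable_std_normal_iexp)
  also have "\<dots> = complex_of_real (weight q u)"
    unfolding std_normal_iexp exp_of_real_prod weight_def
    using q by (simp add: power_mult_distrib sum_negf sum_divide_distrib)
  finally show ?thesis .
qed

text \<open>Under the average, \<i> times the z-th coordinate of a acts as d / d z on the weight,
  which equals - \<open>q z * u $ z\<close> times the weight.\<close>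

lemma integral_mixed_iexp_mixed:
  assumes q: "\<And>z. 0 \<le> q z"
  shows "(LINT \<xi>|normals. complex_of_real (mixed q \<xi> $ z) * iexp (mixed q \<xi> \<bullet> u))
    = \<i> * complex_of_real (q z * u $ z * weight q u)"
proof -
  interpret product_sigma_finite "\<lambda>_::'x. std_normal_distribution" by (rule product_sigma_finite_normal)
  let ?t = "\<lambda>y. sqrt (q y) * u $ y"
  \<comment> \<open>Only the factor of coordinate z carries the extra variable, so the integral
    still factors over the coordinates.\<close>
  let ?f = "\<lambda>y x. if y = z then complex_of_real x * iexp (?t y * x) else iexp (?t y * x)"
  have "(\<Prod>y\<in>UNIV. ?f y (\<xi> y)) = complex_of_real (\<xi> z) * iexp (mixed q \<xi> \<bullet> u)" for \<xi>
  proof -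
    have "(\<Prod>y\<in>UNIV. ?f y (\<xi> y)) = ?f z (\<xi> z) * (\<Prod>y\<in>UNIV - {z}. ?f y (\<xi> y))"
      by (rule prod.remove) auto
    also have "(\<Prod>y\<in>UNIV - {z}. ?f y (\<xi> y)) = (\<Prod>y\<in>UNIV - {z}. iexp (?t y * \<xi> y))"
      by (rule prod.cong) auto
    also have "?f z (\<xi> z) * \<dots> = complex_of_real (\<xi> z) * (\<Prod>y\<in>UNIV. iexp (?t y * \<xi> y))"
    proof -
      have rem: "(\<Prod>y\<in>UNIV. iexp (?t y * \<xi> y)) = iexp (?t z * \<xi> z) * (\<Prod>y\<in>UNIV - {z}. iexp (?t y * \<xi> y))"
        by (rule prod.remove) auto
      show ?thesis unfolding rem by (simp only: simp_thms if_True mult.assoc)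
    qed
    finally show ?thesis unfolding iexp_mixed .
  qed
  then have "(LINT \<xi>|normals. complex_of_real (\<xi> z) * iexp (mixed q \<xi> \<bullet> u)) = (LINT \<xi>|normals. (\<Prod>y\<in>UNIV. ?f y (\<xi> y)))"
    by (simp only: )
  also have "\<dots> = (\<Prod>y\<in>UNIV. LINT x|std_normal_distribution. ?f y x)"
  proof (rule product_integral_prod[OF finite])
    show "integrable std_normal_distribution (?f y)" for y
      by (cases "y = z") (simp_all only: simp_thms if_True if_False integrable_std_normal_iexp)
  qed
  also have "\<dots> = (LINT x|std_normal_distribution. ?f z x) * (\<Prod>y\<in>UNIV - {z}. LINT x|std_normal_distribution. ?f y x)"
    by (rule prod.remove) auto
  also have "(\<Prod>y\<in>UNIV - {z}. LINT x|std_normal_distribution. ?f y x) = (\<Prod>y\<in>UNIV - {z}. complex_of_real (exp (- (?t y)\<^sup>2 / 2)))"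
    unfolding std_normal_iexp[symmetric] by (rule prod.cong) auto
  also have "(LINT x|std_normal_distribution. ?f z x) = \<i> * complex_of_real (?t z) * complex_of_real (exp (- (?t z)\<^sup>2 / 2))"
    using std_normal_moment_iexp[of "?t z"] by (simp add: mult.assoc)
  also have "\<i> * complex_of_real (?t z) * complex_of_real (exp (- (?t z)\<^sup>2 / 2)) * (\<Prod>y\<in>UNIV - {z}. complex_of_real (exp (- (?t y)\<^sup>2 / 2)))
      = \<i> * complex_of_real (?t z) * (\<Prod>y\<in>UNIV. complex_of_real (exp (- (?t y)\<^sup>2 / 2)))"
  proof -
    have rem: "(\<Prod>y\<in>UNIV. complex_of_real (exp (- (?t y)\<^sup>2 / 2)))
        = complex_of_real (exp (- (?t z)\<^sup>2 / 2)) * (\<Prod>y\<in>UNIV - {z}. complex_of_real (exp (- (?t y)\<^sup>2 / 2)))"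
      by (rule prod.remove) auto
    show ?thesis unfolding rem by (simp only: mult.assoc)
  qed
  also have "(\<Prod>y\<in>UNIV. complex_of_real (exp (- (?t y)\<^sup>2 / 2))) = complex_of_real (weight q u)"
    unfolding exp_of_real_prod weight_def using q by (simp add: power_mult_distrib sum_negf sum_divide_distrib)
  finally have eq: "(LINT \<xi>|normals. complex_of_real (\<xi> z) * iexp (mixed q \<xi> \<bullet> u)) = \<i> * complex_of_real (?t z) * complex_of_real (weight q u)" .
  have "(LINT \<xi>|normals. complex_of_real (mixed q \<xi> $ z) * iexp (mixed q \<xi> \<bullet> u))
    = complex_of_real (sqrt (q z)) * (LINT \<xi>|normals. complex_of_real (\<xi> z) * iexp (mixed q \<xi> \<bullet> u))"
    by (subst integral_mult_right_zero[symmetric]) (simp only: mixed_def vec_lambda_beta of_real_mult mult.assoc)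
  also have "\<dots> = \<i> * complex_of_real ((sqrt (q z) * sqrt (q z)) * u $ z * weight q u)"
    unfolding eq by (simp only: of_real_mult mult_ac)
  finally show ?thesis using q by simp
qed

text \<open>Characters have modulus 1, so the product of |f| and |g| dominates on the product
  space.\<close>

lemma integrable_pair_normals:
  fixes f :: "'p \<Rightarrow> real" and g :: "('x \<Rightarrow> real) \<Rightarrow> real"
  assumes f: "integrable M f" and g: "integrable normals g"
  shows "integrable (M \<Otimes>\<^sub>M normals) (\<lambda>(\<omega>, \<xi>). complex_of_real (f \<omega> * g \<xi>) * iexp (mixed q \<xi> \<bullet> \<phi> \<omega>))"
proof -
  interpret P: pair_sigma_finite M normals ..
  have fm: "(\<lambda>w. f (fst w)) \<in> borel_measurable (M \<Otimes>\<^sub>M normals)"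
    by (rule measurable_compose[OF measurable_fst borel_measurable_integrable[OF f]])
  have gm: "(\<lambda>w. g (snd w)) \<in> borel_measurable (M \<Otimes>\<^sub>M normals)"
    by (rule measurable_compose[OF measurable_snd borel_measurable_integrable[OF g]])
  have mm: "(\<lambda>w. mixed q (snd w)) \<in> borel_measurable (M \<Otimes>\<^sub>M normals)"
    by (rule measurable_compose[OF measurable_snd measurable_mixed])
  have pm: "(\<lambda>w. \<phi> (fst w)) \<in> borel_measurable (M \<Otimes>\<^sub>M normals)"
    by (rule measurable_compose[OF measurable_fst measurable_field])
  have "integrable (M \<Otimes>\<^sub>M normals) (\<lambda>w. f (fst w) * g (snd w))"
  proof (rule P.Fubini_integrable)
    show "(\<lambda>w. f (fst w) * g (snd w)) \<in> borel_measurable (M \<Otimes>\<^sub>M normals)" using fm gm by (rule borel_measurable_times)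
    show "integrable M (\<lambda>\<omega>. LINT \<xi>|normals. norm (f (fst (\<omega>, \<xi>)) * g (snd (\<omega>, \<xi>))))"
      using f g by (simp add: abs_mult)
    show "AE \<omega> in M. integrable normals (\<lambda>\<xi>. f (fst (\<omega>, \<xi>)) * g (snd (\<omega>, \<xi>)))"
      using g by simp
  qed
  then show ?thesis
  proof (rule Bochner_Integration.integrable_bound)
    have "(\<lambda>w. mixed q (snd w) \<bullet> \<phi> (fst w)) \<in> borel_measurable (M \<Otimes>\<^sub>M normals)"
      using mm pm by (rule borel_measurable_inner)
    then have "(\<lambda>w. iexp (mixed q (snd w) \<bullet> \<phi> (fst w))) \<in> borel_measurable (M \<Otimes>\<^sub>M normals)"
      by (rule measurable_compose) simp
    moreover have "(\<lambda>w. complex_of_real (f (fst w) * g (snd w))) \<in> borel_measurable (M \<Otimes>\<^sub>M normals)"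
      by (rule measurable_compose[OF borel_measurable_times[OF fm gm]]) simp
    ultimately show "(\<lambda>(\<omega>, \<xi>). complex_of_real (f \<omega> * g \<xi>) * iexp (mixed q \<xi> \<bullet> \<phi> \<omega>)) \<in> borel_measurable (M \<Otimes>\<^sub>M normals)"
      unfolding case_prod_beta by (intro borel_measurable_times)
    show "AE w in M \<Otimes>\<^sub>M normals. cmod (case w of (\<omega>, \<xi>) \<Rightarrow> complex_of_real (f \<omega> * g \<xi>) * iexp (mixed q \<xi> \<bullet> \<phi> \<omega>)) \<le> norm (f (fst w) * g (snd w))"
      by (rule AE_I2) (simp add: case_prod_beta norm_mult del: of_real_mult)
  qed
qed

lemma swap_mixed:
  fixes f :: "'p \<Rightarrow> real" and g :: "('x \<Rightarrow> real) \<Rightarrow> real"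
  assumes f: "integrable M f" and g: "integrable normals g"
  shows "(LINT \<xi>|normals. complex_of_real (g \<xi>) * (LINT \<omega>|M. complex_of_real (f \<omega>) * iexp (mixed q \<xi> \<bullet> \<phi> \<omega>)))
    = (LINT \<omega>|M. complex_of_real (f \<omega>) * (LINT \<xi>|normals. complex_of_real (g \<xi>) * iexp (mixed q \<xi> \<bullet> \<phi> \<omega>)))"
    and "integrable normals (\<lambda>\<xi>. complex_of_real (g \<xi>) * (LINT \<omega>|M. complex_of_real (f \<omega>) * iexp (mixed q \<xi> \<bullet> \<phi> \<omega>)))"
proof -
  interpret P: pair_sigma_finite M normals ..
  let ?h = "\<lambda>\<omega> \<xi>. complex_of_real (f \<omega> * g \<xi>) * iexp (mixed q \<xi> \<bullet> \<phi> \<omega>)"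
  have i: "integrable (M \<Otimes>\<^sub>M normals) (case_prod ?h)" by (rule integrable_pair_normals[OF f g])
  have e1: "(LINT \<omega>|M. ?h \<omega> \<xi>) = complex_of_real (g \<xi>) * (LINT \<omega>|M. complex_of_real (f \<omega>) * iexp (mixed q \<xi> \<bullet> \<phi> \<omega>))" for \<xi>
    by (subst integral_mult_right_zero[symmetric]) (simp only: of_real_mult mult_ac)
  have e2: "(LINT \<xi>|normals. ?h \<omega> \<xi>) = complex_of_real (f \<omega>) * (LINT \<xi>|normals. complex_of_real (g \<xi>) * iexp (mixed q \<xi> \<bullet> \<phi> \<omega>))" for \<omega>
    by (subst integral_mult_right_zero[symmetric]) (simp only: of_real_mult mult.assoc)
  show "(LINT \<xi>|normals. complex_of_real (g \<xi>) * (LINT \<omega>|M. complex_of_real (f \<omega>) * iexp (mixed q \<xi> \<bullet> \<phi> \<omega>)))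
    = (LINT \<omega>|M. complex_of_real (f \<omega>) * (LINT \<xi>|normals. complex_of_real (g \<xi>) * iexp (mixed q \<xi> \<bullet> \<phi> \<omega>)))"
    unfolding e1[symmetric] e2[symmetric] by (rule P.Fubini_integral[OF i])
  show "integrable normals (\<lambda>\<xi>. complex_of_real (g \<xi>) * (LINT \<omega>|M. complex_of_real (f \<omega>) * iexp (mixed q \<xi> \<bullet> \<phi> \<omega>)))"
    unfolding e1[symmetric] by (rule P.integrable_snd[OF i])
qed

lemma integrable_mixed_component: "integrable normals (\<lambda>\<xi>. mixed q \<xi> $ z)"
proof -
  interpret S: prob_space std_normal_distribution by (rule prob_space_normal_density) simp
  have "integrable std_normal_distribution (\<lambda>x. x)"
    using integrable_std_normal_moment_distribution[of 1] by simp
  moreover have "distr normals std_normal_distribution (\<lambda>\<xi>. \<xi> z) = std_normal_distribution"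
    by (rule distr_PiM_component) (auto intro: S.prob_space_axioms)
  ultimately have "integrable (distr normals std_normal_distribution (\<lambda>\<xi>. \<xi> z)) (\<lambda>x. x)" by simp
  then have "integrable normals (\<lambda>\<xi>. \<xi> z)"
    by (subst (asm) integrable_distr_eq) (auto intro: measurable_component_singleton)
  then show ?thesis by (simp add: mixed_def)
qed

text \<open>\<open>stein_iexp\<close> averaged over a = \<open>mixed q \<xi>\<close>. The minus sign
  is the product of the \<i> from the derivative of a character and the \<i> from
  \<open>integral_mixed_iexp_mixed\<close>.\<close>

theorem stein_weight:
  assumes q: "\<And>z. 0 \<le> q z"
  shows "(LINT \<omega>|M. \<phi> \<omega> $ x * \<phi> \<omega> $ y * weight q (\<phi> \<omega>))
    = K $ x $ y * (LINT \<omega>|M. weight q (\<phi> \<omega>))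
      - (\<Sum>z\<in>UNIV. K $ x $ z * q z * (LINT \<omega>|M. \<phi> \<omega> $ z * \<phi> \<omega> $ y * weight q (\<phi> \<omega>)))"
proof -
  let ?I = "\<lambda>f. LINT \<omega>|M. complex_of_real (f \<omega>) * complex_of_real (weight q (\<phi> \<omega>))"
  have one: "integrable M (\<lambda>_. 1 :: real)" "integrable normals (\<lambda>_. 1 :: real)" by simp_all
  have a: "(LINT \<xi>|normals. (LINT \<omega>|M. complex_of_real (f \<omega>) * iexp (mixed q \<xi> \<bullet> \<phi> \<omega>))) = ?I f"
    and a': "integrable normals (\<lambda>\<xi>. LINT \<omega>|M. complex_of_real (f \<omega>) * iexp (mixed q \<xi> \<bullet> \<phi> \<omega>))"
    if "integrable M f" for f
    using swap_mixed[OF that one(2), of q] by (simp_all add: integral_iexp_mixed[OF q])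
  let ?b = "\<lambda>z \<xi>. complex_of_real (mixed q \<xi> $ z) * (LINT \<omega>|M. complex_of_real (\<phi> \<omega> $ y) * iexp (mixed q \<xi> \<bullet> \<phi> \<omega>))"
  have b: "(LINT \<xi>|normals. ?b z \<xi>) = \<i> * (complex_of_real (q z) * ?I (\<lambda>\<omega>. \<phi> \<omega> $ z * \<phi> \<omega> $ y))" for z
  proof -
    have "(LINT \<xi>|normals. ?b z \<xi>) = (LINT \<omega>|M. complex_of_real (\<phi> \<omega> $ y) * (\<i> * complex_of_real (q z * \<phi> \<omega> $ z * weight q (\<phi> \<omega>))))"
      unfolding swap_mixed(1)[OF integrable_component integrable_mixed_component] integral_mixed_iexp_mixed[OF q] ..
    also have "\<dots> = (LINT \<omega>|M. (\<i> * complex_of_real (q z)) * (complex_of_real (\<phi> \<omega> $ z * \<phi> \<omega> $ y) * complex_of_real (weight q (\<phi> \<omega>))))"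
      by (simp only: of_real_mult mult_ac)
    also have "\<dots> = \<i> * (complex_of_real (q z) * ?I (\<lambda>\<omega>. \<phi> \<omega> $ z * \<phi> \<omega> $ y))"
      by (simp only: integral_mult_right_zero mult.assoc)
    finally show ?thesis .
  qed
  have b': "integrable normals (?b z)" for z
    by (rule swap_mixed(2)[OF integrable_component integrable_mixed_component])
  let ?w = "LINT \<omega>|M. complex_of_real (weight q (\<phi> \<omega>))"
  have c: "(LINT \<xi>|normals. (LINT \<omega>|M. iexp (mixed q \<xi> \<bullet> \<phi> \<omega>))) = ?w"
    and c': "integrable normals (\<lambda>\<xi>. LINT \<omega>|M. iexp (mixed q \<xi> \<bullet> \<phi> \<omega>))"
    using a[OF one(1)] a'[OF one(1)] by (simp_all only: of_real_1 mult_1)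
  have neg: "(complex_of_real (K $ x $ z) * \<i>) * (\<i> * (complex_of_real (q z) * d)) = - (complex_of_real (K $ x $ z * q z) * d)" for z d
  proof -
    have "(complex_of_real (K $ x $ z) * \<i>) * (\<i> * (complex_of_real (q z) * d))
      = (\<i> * \<i>) * (complex_of_real (K $ x $ z * q z) * d)" by (simp only: of_real_mult mult_ac)
    then show ?thesis by simp
  qed
  have i1: "integrable normals (\<lambda>\<xi>. complex_of_real (K $ x $ y) * (LINT \<omega>|M. iexp (mixed q \<xi> \<bullet> \<phi> \<omega>)))"
    using c' by (rule integrable_mult_right)
  have i2: "integrable normals (\<lambda>\<xi>. (complex_of_real (K $ x $ z) * \<i>) * ?b z \<xi>)" for z
    using b' by (rule integrable_mult_right)
  have i3: "integrable normals (\<lambda>\<xi>. \<Sum>z\<in>UNIV. (complex_of_real (K $ x $ z) * \<i>) * ?b z \<xi>)"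
    by (rule Bochner_Integration.integrable_sum) (rule i2)
  have "?I (\<lambda>\<omega>. \<phi> \<omega> $ x * \<phi> \<omega> $ y)
    = (LINT \<xi>|normals. complex_of_real (K $ x $ y) * (LINT \<omega>|M. iexp (mixed q \<xi> \<bullet> \<phi> \<omega>))
        + (\<Sum>z\<in>UNIV. (complex_of_real (K $ x $ z) * \<i>) * ?b z \<xi>))"
    unfolding a[OF integrable_product, symmetric] stein_iexp by (simp only: mult.assoc)
  also have "\<dots> = complex_of_real (K $ x $ y) * ?w + (\<Sum>z\<in>UNIV. (complex_of_real (K $ x $ z) * \<i>) * (\<i> * (complex_of_real (q z) * ?I (\<lambda>\<omega>. \<phi> \<omega> $ z * \<phi> \<omega> $ y))))"
    unfolding Bochner_Integration.integral_add[OF i1 i3] Bochner_Integration.integral_sum[OF i2] integral_mult_right_zero c b ..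
  also have "\<dots> = complex_of_real (K $ x $ y) * ?w - (\<Sum>z\<in>UNIV. complex_of_real (K $ x $ z * q z) * ?I (\<lambda>\<omega>. \<phi> \<omega> $ z * \<phi> \<omega> $ y))"
    unfolding neg sum_negf by simp
  finally have "complex_of_real (LINT \<omega>|M. \<phi> \<omega> $ x * \<phi> \<omega> $ y * weight q (\<phi> \<omega>))
    = complex_of_real (K $ x $ y * (LINT \<omega>|M. weight q (\<phi> \<omega>))
      - (\<Sum>z\<in>UNIV. K $ x $ z * q z * (LINT \<omega>|M. \<phi> \<omega> $ z * \<phi> \<omega> $ y * weight q (\<phi> \<omega>))))"
    by (simp only: of_real_mult[symmetric] integral_complex_of_real of_real_sum[symmetric] of_real_diff[symmetric])
  then show ?thesis by (simp only: of_real_eq_iff)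
qed

end

section \<open>The isomorphism theorem\<close>

lemma (in gaussian_vector) weight_half_square: "field_exp q (half_square u) = weight q u"
  by (simp add: field_exp_def weight_def half_square_def sum_divide_distrib)

lemma half_square_nonneg: "half_square u \<in> nonneg_fields"
  by (simp add: half_square_def nonneg_fields_def)

text \<open>Supplies the dominating function for difference quotients of s \<mapsto> exp (- s E)
  with E \<ge> 0.\<close>

lemma abs_exp_minus_diff_le:
  fixes a b :: real
  assumes "0 \<le> a" "0 \<le> b"
  shows "\<bar>exp (- a) - exp (- b)\<bar> \<le> \<bar>a - b\<bar>"
proof -
  have le: "exp (- a) - exp (- b) \<le> b - a" if "0 \<le> a" "a \<le> b" for a b :: real
  proof -
    have "exp (- a) - exp (- b) = exp (- a) * (1 - exp (- (b - a)))"
      by (simp add: right_diff_distrib exp_add[symmetric])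
    also have "\<dots> \<le> 1 * (1 - exp (- (b - a)))"
      using that by (intro mult_right_mono) auto
    also have "\<dots> \<le> b - a"
    proof -
      have "1 - exp (- d) \<le> d" for d :: real
        using exp_ge_add_one_self[of "- d"] by linarith
      from this[of "b - a"] show ?thesis by simp
    qed
    finally show ?thesis .
  qed
  show ?thesis
  proof (cases "a \<le> b")
    case True
    then show ?thesis using le[OF assms(1) True] by simp
  next
    case False
    then show ?thesis using le[OF assms(2), of a] by simp
  qed
qed

locale field_network = killed_network C \<kappa> + gaussian_vector M\<^sub>\<phi> "green C \<kappa>" \<phi>
  for C :: "'x::finite \<Rightarrow> 'x \<Rightarrow> real" and \<kappa> and M\<^sub>\<phi> :: "'p measure" and \<phi> :: "'p \<Rightarrow> real^'x"
begin

section \<open>Laplace transform of the squared Gaussian field\<close>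

definition gaussian_laplace :: "('x \<Rightarrow> real) \<Rightarrow> real" where
  "gaussian_laplace q = (LINT \<omega>|M\<^sub>\<phi>. weight q (\<phi> \<omega>))"

lemma weight_pos: "0 < weight q u"
  by (simp add: weight_def)

lemma weight_le_1: "(\<And>x. 0 \<le> q x) \<Longrightarrow> weight q u \<le> 1"
  by (simp add: weight_def sum_nonneg)

lemma measurable_weight[measurable]: "(\<lambda>\<omega>. weight q (\<phi> \<omega>)) \<in> borel_measurable M\<^sub>\<phi>"
  unfolding weight_def by measurable

lemma integrable_weight: "(\<And>x. 0 \<le> q x) \<Longrightarrow> integrable M\<^sub>\<phi> (\<lambda>\<omega>. weight q (\<phi> \<omega>))"
  using weight_le_1[of q] weight_pos by (intro integrable_const_bound[where B = 1]) (auto simp: less_imp_le)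

lemma gaussian_laplace_le_1: "(\<And>x. 0 \<le> q x) \<Longrightarrow> gaussian_laplace q \<le> 1"
  unfolding gaussian_laplace_def using integral_mono[OF integrable_weight[of q] integrable_const, of 1] weight_le_1[of q]
  by (simp add: prob_space)

lemma gaussian_laplace_pos:
  assumes "\<And>x. 0 \<le> q x"
  shows "0 < gaussian_laplace q"
proof -
  have "gaussian_laplace q \<noteq> 0"
  proof
    assume "gaussian_laplace q = 0"
    then have "AE \<omega> in M\<^sub>\<phi>. weight q (\<phi> \<omega>) = 0"
      unfolding gaussian_laplace_def using integrable_weight[OF assms]
      by (subst (asm) integral_nonneg_eq_0_iff_AE) (auto simp: weight_pos less_imp_le)
    then have "AE \<omega> in M\<^sub>\<phi>. False"
    proof eventually_elim
      case (elim \<omega>)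
      then show ?case using weight_pos[of q "\<phi> \<omega>"] by simp
    qed
    then show False by simp
  qed
  moreover have "0 \<le> gaussian_laplace q"
    unfolding gaussian_laplace_def by (rule integral_nonneg_AE) (auto simp: weight_pos less_imp_le)
  ultimately show ?thesis by simp
qed

text \<open>Integration by parts says k = G g - G Q k, where k is the matrix on the left, G the
  Green function, Q the diagonal matrix of q and g = \<open>gaussian_laplace q\<close>. Multiplying
  by the inverse of G shows that k / g inverts the perturbed matrix.\<close>

lemma weighted_covariance:
  assumes q: "\<And>x. 0 \<le> q x"
  shows "(LINT \<omega>|M\<^sub>\<phi>. \<phi> \<omega> $ x * \<phi> \<omega> $ y * weight q (\<phi> \<omega>)) = gaussian_laplace q * W q x y"
proof -
  define k where "k x y = (LINT \<omega>|M\<^sub>\<phi>. \<phi> \<omega> $ x * \<phi> \<omega> $ y * weight q (\<phi> \<omega>))" for x y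
  let ?K = "W (\<lambda>_. 0)"
  have k_sym: "k x y = k y x" for x y by (simp add: k_def mult.commute)
  have stein: "k x y = ?K x y * gaussian_laplace q - (\<Sum>z\<in>UNIV. ?K x z * (q z * k z y))" for x y
    unfolding k_def gaussian_laplace_def using stein_weight[OF q, of x y] by (simp add: green_eq_potential_green mult.assoc)
  have eq: "lam w * k w y - (\<Sum>x\<in>UNIV. C w x * k x y) = (if w = y then 1 else 0) * gaussian_laplace q - q w * k w y" for w y
  proof -
    have A: "lam w * ?K w z - (\<Sum>x\<in>UNIV. C w x * ?K x z) = (if w = z then 1 else 0)" for z
      using W_left[where q = "\<lambda>_. 0"] by simp
    let ?r = "\<lambda>x. ?K x y * gaussian_laplace q - (\<Sum>z\<in>UNIV. ?K x z * (q z * k z y))"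
    have "(\<Sum>x\<in>UNIV. C w x * k x y) = (\<Sum>x\<in>UNIV. C w x * ?r x)"
    proof (rule sum.cong[OF refl])
      fix x show "C w x * k x y = C w x * ?r x" by (rule arg_cong[where f = "\<lambda>t. C w x * t", OF stein])
    qed
    moreover have "lam w * k w y = lam w * ?r w" by (rule arg_cong[where f = "\<lambda>t. lam w * t", OF stein])
    ultimately have "lam w * k w y - (\<Sum>x\<in>UNIV. C w x * k x y) = lam w * ?r w - (\<Sum>x\<in>UNIV. C w x * ?r x)"
      by (rule arg_cong2[where f = "\<lambda>s t. t - s"])
    also have "\<dots> = (lam w * ?K w y - (\<Sum>x\<in>UNIV. C w x * ?K x y)) * gaussian_laplace q
        - (lam w * (\<Sum>z\<in>UNIV. ?K w z * (q z * k z y)) - (\<Sum>x\<in>UNIV. C w x * (\<Sum>z\<in>UNIV. ?K x z * (q z * k z y))))"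
      by (simp add: right_diff_distrib left_diff_distrib sum_subtractf sum_distrib_right mult.assoc)
    also have "lam w * (\<Sum>z\<in>UNIV. ?K w z * (q z * k z y)) - (\<Sum>x\<in>UNIV. C w x * (\<Sum>z\<in>UNIV. ?K x z * (q z * k z y)))
      = (\<Sum>z\<in>UNIV. (lam w * ?K w z - (\<Sum>x\<in>UNIV. C w x * ?K x z)) * (q z * k z y))"
    proof -
      have "(\<Sum>x\<in>UNIV. C w x * (\<Sum>z\<in>UNIV. ?K x z * (q z * k z y))) = (\<Sum>z\<in>UNIV. (\<Sum>x\<in>UNIV. C w x * ?K x z) * (q z * k z y))"
        by (simp only: sum_distrib_left sum_distrib_right mult.assoc) (rule sum.swap)
      then show ?thesis by (simp only: left_diff_distrib sum_subtractf sum_distrib_left mult.assoc)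
    qed
    also have "\<dots> = q w * k w y" unfolding A by (rule sum_indicator_mult)
    finally show ?thesis unfolding A .
  qed
  \<comment> \<open>\<open>W_unique\<close> speaks about rows, while the equation above concerns
    columns; the symmetry of k and C converts one into the other.\<close>
  have "k y x = gaussian_laplace q * W q x y"
  proof (rule W_unique[where v = "\<lambda>w. k w x", OF q])
    fix w
    have "k w x * (lam w + q w) - (\<Sum>z\<in>UNIV. k z x * C z w) = (lam w * k w x - (\<Sum>z\<in>UNIV. C w z * k z x)) + q w * k w x"
      by (simp add: algebra_simps C_sym[of _ w])
    then show "k w x * (lam w + q w) - (\<Sum>z\<in>UNIV. k z x * C z w) = gaussian_laplace q * (if x = w then 1 else 0)"
      unfolding eq by (cases "w = x") auto
  qed
  then show ?thesis by (simp add: k_sym[of y x] k_def[symmetric])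
qed

lemma weight_scale: "weight (\<lambda>x. s * q x) u = exp (- (s * ((\<Sum>z\<in>UNIV. q z * (u $ z)\<^sup>2) / 2)))"
  by (simp add: weight_def sum_distrib_left mult.assoc)

lemma integrable_energy: "integrable M\<^sub>\<phi> (\<lambda>\<omega>. (\<Sum>z\<in>UNIV. q z * (\<phi> \<omega> $ z)\<^sup>2) / 2)"
  by (intro integrable_divide_zero Bochner_Integration.integrable_sum integrable_mult_right integrable_square)

text \<open>Differentiation under the expectation of exp (- s E), where E is half the q-weighted sum
  of squares. The resulting moments are diagonal entries of
  \<open>weighted_covariance\<close>.\<close>

lemma gaussian_laplace_has_derivative:
  assumes q: "\<And>x. 0 \<le> q x" and s: "s \<in> {0..1}"
  shows "((\<lambda>s. gaussian_laplace (\<lambda>x. s * q x)) has_real_derivative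
     - (gaussian_laplace (\<lambda>x. s * q x) * (\<Sum>z\<in>UNIV. q z * W (\<lambda>x. s * q x) z z) / 2)) (at s within {0..1})"
proof -
  define E where "E \<omega> = (\<Sum>z\<in>UNIV. q z * (\<phi> \<omega> $ z)\<^sup>2) / 2" for \<omega>
  have E0: "0 \<le> E \<omega>" for \<omega> unfolding E_def using q by (auto intro!: sum_nonneg divide_nonneg_nonneg mult_nonneg_nonneg)
  have E_int: "integrable M\<^sub>\<phi> E" unfolding E_def[abs_def] by (rule integrable_energy)
  have [measurable]: "E \<in> borel_measurable M\<^sub>\<phi>" using E_int by (rule borel_measurable_integrable)
  have g_eq: "gaussian_laplace (\<lambda>x. r * q x) = (LINT \<omega>|M\<^sub>\<phi>. exp (- (r * E \<omega>)))" for r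
    unfolding gaussian_laplace_def weight_scale E_def ..
  have exp_int: "integrable M\<^sub>\<phi> (\<lambda>\<omega>. exp (- (r * E \<omega>)))" if "0 \<le> r" for r
    using that E0 by (intro integrable_const_bound[where B = 1]) auto
  have D: "(LINT \<omega>|M\<^sub>\<phi>. - E \<omega> * exp (- (s * E \<omega>))) = - (gaussian_laplace (\<lambda>x. s * q x) * (\<Sum>z\<in>UNIV. q z * W (\<lambda>x. s * q x) z z) / 2)"
  proof -
    have sq: "0 \<le> s * q x" for x using s q by simp
    have i: "integrable M\<^sub>\<phi> (\<lambda>\<omega>. \<phi> \<omega> $ z * \<phi> \<omega> $ z * weight (\<lambda>x. s * q x) (\<phi> \<omega>))" for z
    proof (rule Bochner_Integration.integrable_bound[OF integrable_product[of z z]])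
      show "AE \<omega> in M\<^sub>\<phi>. norm (\<phi> \<omega> $ z * \<phi> \<omega> $ z * weight (\<lambda>x. s * q x) (\<phi> \<omega>)) \<le> norm (\<phi> \<omega> $ z * \<phi> \<omega> $ z)"
      proof (rule AE_I2)
        fix \<omega>
        show "norm (\<phi> \<omega> $ z * \<phi> \<omega> $ z * weight (\<lambda>x. s * q x) (\<phi> \<omega>)) \<le> norm (\<phi> \<omega> $ z * \<phi> \<omega> $ z)"
          unfolding real_norm_def abs_mult[of "\<phi> \<omega> $ z * \<phi> \<omega> $ z"]
          using weight_le_1[where q = "\<lambda>x. s * q x" and u = "\<phi> \<omega>", OF sq] weight_pos[of "\<lambda>x. s * q x" "\<phi> \<omega>"]
          by (intro mult_left_le) auto
      qed
    qed measurable
    have "(LINT \<omega>|M\<^sub>\<phi>. - E \<omega> * exp (- (s * E \<omega>)))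
      = (LINT \<omega>|M\<^sub>\<phi>. (\<Sum>z\<in>UNIV. (- q z / 2) * (\<phi> \<omega> $ z * \<phi> \<omega> $ z * weight (\<lambda>x. s * q x) (\<phi> \<omega>))))"
      unfolding weight_scale E_def[symmetric]
      by (intro Bochner_Integration.integral_cong refl)
         (simp add: E_def sum_distrib_right sum_negf[symmetric] sum_divide_distrib power2_eq_square mult_ac)
    also have "\<dots> = (\<Sum>z\<in>UNIV. (- q z / 2) * (gaussian_laplace (\<lambda>x. s * q x) * W (\<lambda>x. s * q x) z z))"
      using i by (subst Bochner_Integration.integral_sum)
        (simp_all only: integral_mult_right_zero integrable_mult_right weighted_covariance[where q = "\<lambda>x. s * q x", OF sq])
    also have "\<dots> = - (gaussian_laplace (\<lambda>x. s * q x) * (\<Sum>z\<in>UNIV. q z * W (\<lambda>x. s * q x) z z) / 2)"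
      by (simp add: sum_distrib_left sum_negf[symmetric] sum_divide_distrib mult_ac)
    finally show ?thesis .
  qed
  show ?thesis
    unfolding has_field_derivative_iff D[symmetric] tendsto_at_iff_sequentially comp_def
  proof (intro allI impI)
    fix r :: "nat \<Rightarrow> real" assume r: "\<forall>i. r i \<in> {0..1} - {s}" and lim: "r \<longlonglongrightarrow> s"
    have "(gaussian_laplace (\<lambda>x. r n * q x) - gaussian_laplace (\<lambda>x. s * q x)) / (r n - s)
       = (LINT \<omega>|M\<^sub>\<phi>. (exp (- (r n * E \<omega>)) - exp (- (s * E \<omega>))) / (r n - s))" for n
    proof -
      have "0 \<le> r n" using r by auto
      then show ?thesis
        unfolding g_eq integral_divide_zero using s
        by (subst Bochner_Integration.integral_diff) (auto intro: exp_int)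
    qed
    moreover have "(\<lambda>n. LINT \<omega>|M\<^sub>\<phi>. (exp (- (r n * E \<omega>)) - exp (- (s * E \<omega>))) / (r n - s)) \<longlonglongrightarrow> (LINT \<omega>|M\<^sub>\<phi>. - E \<omega> * exp (- (s * E \<omega>)))"
    proof (rule integral_dominated_convergence[where w = E])
      show "AE \<omega> in M\<^sub>\<phi>. (\<lambda>n. (exp (- (r n * E \<omega>)) - exp (- (s * E \<omega>))) / (r n - s)) \<longlonglongrightarrow> - E \<omega> * exp (- (s * E \<omega>))"
      proof (rule AE_I2)
        fix \<omega>
        have "((\<lambda>r. exp (- (r * E \<omega>))) has_real_derivative - E \<omega> * exp (- (s * E \<omega>))) (at s)"
          by (auto intro!: derivative_eq_intros)
        then have "((\<lambda>r. (exp (- (r * E \<omega>)) - exp (- (s * E \<omega>))) / (r - s)) \<longlongrightarrow> - E \<omega> * exp (- (s * E \<omega>))) (at s)"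
          by (simp only: has_field_derivative_iff)
        moreover have "filterlim r (at s) sequentially"
          using lim r by (auto simp: filterlim_at intro: always_eventually)
        ultimately show "(\<lambda>n. (exp (- (r n * E \<omega>)) - exp (- (s * E \<omega>))) / (r n - s)) \<longlonglongrightarrow> - E \<omega> * exp (- (s * E \<omega>))"
          by (rule filterlim_compose)
      qed
      show "AE \<omega> in M\<^sub>\<phi>. norm ((exp (- (r n * E \<omega>)) - exp (- (s * E \<omega>))) / (r n - s)) \<le> E \<omega>" for n
      proof (rule AE_I2)
        fix \<omega>
        have ne: "r n \<noteq> s" "0 \<le> r n" using r by auto
        have "\<bar>exp (- (r n * E \<omega>)) - exp (- (s * E \<omega>))\<bar> \<le> \<bar>r n * E \<omega> - s * E \<omega>\<bar>"
          using ne s E0 by (intro abs_exp_minus_diff_le) auto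
        also have "\<dots> = E \<omega> * \<bar>r n - s\<bar>" using E0[of \<omega>] by (simp add: left_diff_distrib[symmetric] abs_mult)
        finally show "norm ((exp (- (r n * E \<omega>)) - exp (- (s * E \<omega>))) / (r n - s)) \<le> E \<omega>"
          using ne by (simp add: divide_le_eq)
      qed
    qed (use E_int in measurable)
    ultimately show "(\<lambda>n. (gaussian_laplace (\<lambda>x. r n * q x) - gaussian_laplace (\<lambda>x. s * q x)) / (r n - s)) \<longlonglongrightarrow> (LINT \<omega>|M\<^sub>\<phi>. - E \<omega> * exp (- (s * E \<omega>)))"
      by (simp only: )
  qed
qed

lemma gaussian_laplace_zero: "gaussian_laplace (\<lambda>_. 0) = 1"
  by (simp add: gaussian_laplace_def weight_def prob_space)

theorem loop_laplace_gaussian: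
  assumes q: "\<And>x. 0 \<le> q x"
  shows "(\<integral>\<^sup>+l. ennreal (1 - field_exp q (occupation C \<kappa> l)) \<partial>loop_measure C \<kappa>) = ennreal (- 2 * ln (gaussian_laplace q))"
proof -
  \<comment> \<open>Written in the clamped form of \<open>measurable_W\<close>, so that the
    integrand is Borel on the whole line; it is the intended one for s \<ge> 0.\<close>
  let ?f = "\<lambda>s. \<Sum>z\<in>UNIV. q z * W (\<lambda>y. max 0 0 * lam y + max 0 s * \<bar>q y\<bar>) z z"
  let ?F = "\<lambda>s. - 2 * ln (gaussian_laplace (\<lambda>x. s * q x))"
  have f_eq: "?f s = (\<Sum>z\<in>UNIV. q z * W (\<lambda>y. s * q y) z z)" if "0 \<le> s" for s
    using that q by simp
  have "(\<integral>\<^sup>+s. ennreal (?f s) * indicator {0..1} s \<partial>lborel) = ennreal (?F 1 - ?F 0)"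
  proof (rule nn_integral_FTC_Icc_within)
    show "?f \<in> borel_measurable borel"
      by (intro borel_measurable_sum borel_measurable_times borel_measurable_const measurable_W) simp_all
    fix s :: real assume s: "0 \<le> s" "s \<le> 1"
    have sq: "0 \<le> s * q x" for x using s q by simp
    have pos: "0 < gaussian_laplace (\<lambda>x. s * q x)" using sq by (rule gaussian_laplace_pos)
    have "((\<lambda>s. ln (gaussian_laplace (\<lambda>x. s * q x))) has_real_derivative
      (1 / gaussian_laplace (\<lambda>x. s * q x)) * - (gaussian_laplace (\<lambda>x. s * q x) * (\<Sum>z\<in>UNIV. q z * W (\<lambda>x. s * q x) z z) / 2)) (at s within {0..1})"
      by (rule DERIV_chain2[OF DERIV_ln_divide[OF pos] gaussian_laplace_has_derivative[OF q]]) (use s in simp)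
    from DERIV_cmult[OF this, of "- 2"]
    show "(?F has_real_derivative ?f s) (at s within {0..1})"
      unfolding f_eq[OF s(1)] using pos by simp
    show "0 \<le> ?f s" unfolding f_eq[OF s(1)] by (intro sum_nonneg mult_nonneg_nonneg q W_nonneg sq)
  qed simp
  also have "?F 1 - ?F 0 = - 2 * ln (gaussian_laplace q)" by (simp add: gaussian_laplace_zero)
  also have "(\<integral>\<^sup>+s. ennreal (?f s) * indicator {0..1} s \<partial>lborel)
    = (\<integral>\<^sup>+s. ennreal (\<Sum>z\<in>UNIV. q z * W (\<lambda>y. s * q y) z z) * indicator {0..1} s \<partial>lborel)"
    using f_eq by (intro nn_integral_cong) (simp split: split_indicator)
  finally show ?thesis unfolding loop_laplace[OF q] .
qed

section \<open>Laplace transform of the loop ensemble and comparison of the fields\<close>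

context
  fixes M :: "'w measure" and L :: "'w \<Rightarrow> 'x path measure"
  assumes ppp: "poisson_point_process M (scale_measure (1/2) (loop_measure C \<kappa>)) L"
begin

interpretation M: prob_space M
  using ppp by (rule ppp_prob)

abbreviation "Z x \<omega> \<equiv> \<integral>\<^sup>+l. ennreal (occupation C \<kappa> l $ x) \<partial>L \<omega>"
abbreviation "ens \<omega> \<equiv> ensemble_occupation C \<kappa> (L \<omega>)"

lemma sets_loop_measure: "sets (scale_measure (1/2) (loop_measure C \<kappa>)) = sets loop_space"
  by (simp only: sets_scale_measure loop_measure_def sets_measure_of[OF sets.space_closed] sets.sigma_sets_eq)

lemma measurable_occ_loop: "(\<lambda>l. ennreal (occupation C \<kappa> l $ x)) \<in> borel_measurable (scale_measure (1/2) (loop_measure C \<kappa>))"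
proof -
  have "(\<lambda>l. ennreal (occupation C \<kappa> l $ x)) \<in> borel_measurable (path_space :: 'x path measure)"
    by (rule measurable_compose[OF measurable_occupation]) simp
  then have "(\<lambda>l. ennreal (occupation C \<kappa> l $ x)) \<in> borel_measurable (loop_space :: 'x path measure)"
    by (rule measurable_path_loop_space)
  then show ?thesis by (simp cong: measurable_cong_sets[OF sets_loop_measure refl])
qed

lemma measurable_Z: "Z x \<in> borel_measurable M"
  by (rule measurable_ppp_nn_integral[OF ppp measurable_occ_loop])

lemma measurable_ens: "ens \<in> borel_measurable M"
  by (rule borel_measurable_vecI)
     (simp add: ensemble_occupation_def borel_measurable_enn2real measurable_Z)

lemma ens_nonneg: "ens \<omega> \<in> nonneg_fields"
  by (simp add: ensemble_occupation_def nonneg_fields_def)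

text \<open>Campbell's formula has to be applied to the extended field Z, since
  \<open>ensemble_occupation\<close> would replace infinite values by 0 and finiteness is not known
  at this stage.\<close>

lemma nexp_Z:
  assumes q: "\<And>x. 0 \<le> q x"
  shows "(\<integral>\<^sup>+\<omega>. nexp (\<Sum>x\<in>UNIV. ennreal (q x) * Z x \<omega>) \<partial>M) = ennreal (gaussian_laplace q)"
proof -
  let ?\<nu> = "scale_measure (1/2) (loop_measure C \<kappa>)"
  let ?f = "\<lambda>l. \<Sum>x\<in>UNIV. ennreal (q x) * ennreal (occupation C \<kappa> l $ x)"
  have fm: "?f \<in> borel_measurable ?\<nu>"
    by (intro borel_measurable_sum borel_measurable_times_ennreal borel_measurable_const measurable_occ_loop)
  have occ0: "0 \<le> occupation C \<kappa> l $ x" for l x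
    using occupation_nonneg[of l] by (simp add: nonneg_fields_def)
  have f_eq: "?f l = ennreal (\<Sum>x\<in>UNIV. q x * occupation C \<kappa> l $ x)" for l
    using q occ0 by (subst sum_ennreal[symmetric]) (simp_all add: ennreal_mult)
  have nf: "1 - nexp (?f l) = ennreal (1 - field_exp q (occupation C \<kappa> l))" for l
  proof -
    have "0 \<le> (\<Sum>x\<in>UNIV. q x * occupation C \<kappa> l $ x)" using q occ0 by (intro sum_nonneg mult_nonneg_nonneg)
    then have "nexp (?f l) = ennreal (field_exp q (occupation C \<kappa> l))"
      unfolding f_eq by (simp add: nexp_ennreal field_exp_def)
    then have "1 - nexp (?f l) = ennreal 1 - ennreal (field_exp q (occupation C \<kappa> l))" by simp
    also have "\<dots> = ennreal (1 - field_exp q (occupation C \<kappa> l))"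
      by (rule ennreal_minus) (simp add: less_imp_le[OF field_exp_pos])
    finally show ?thesis .
  qed
  have Zf: "(\<Sum>x\<in>UNIV. ennreal (q x) * Z x \<omega>) = (\<integral>\<^sup>+l. ?f l \<partial>L \<omega>)" if "\<omega> \<in> space M" for \<omega>
  proof -
    have m: "(\<lambda>l. ennreal (occupation C \<kappa> l $ x)) \<in> borel_measurable (L \<omega>)" for x
      using measurable_occ_loop by (simp cong: measurable_cong_sets[OF ppp_sets[OF ppp that] refl])
    show ?thesis
      by (subst nn_integral_sum) (intro borel_measurable_times_ennreal borel_measurable_const m, simp only: nn_integral_cmult[OF m])
  qed
  have "(\<integral>\<^sup>+\<omega>. nexp (\<Sum>x\<in>UNIV. ennreal (q x) * Z x \<omega>) \<partial>M) = (\<integral>\<^sup>+\<omega>. nexp (\<integral>\<^sup>+l. ?f l \<partial>L \<omega>) \<partial>M)"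
    by (intro nn_integral_cong) (simp only: Zf)
  also have "\<dots> = nexp (\<integral>\<^sup>+l. (1 - nexp (?f l)) \<partial>?\<nu>)" by (rule poisson_laplace[OF ppp fm])
  also have "(\<integral>\<^sup>+l. (1 - nexp (?f l)) \<partial>?\<nu>) = (1/2) * ennreal (- 2 * ln (gaussian_laplace q))"
  proof -
    have "(\<lambda>\<gamma>. ennreal (1 - field_exp q (occupation C \<kappa> \<gamma>))) \<in> borel_measurable path_space"
      by (rule measurable_compose[OF measurable_compose[OF measurable_occupation measurable_field_exp]]) simp
    from measurable_path_loop_space[OF this]
    have "(\<lambda>\<gamma>. ennreal (1 - field_exp q (occupation C \<kappa> \<gamma>))) \<in> borel_measurable (loop_measure C \<kappa>)"
      using sets_loop_measure by (simp cong: measurable_cong_sets)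
    then show ?thesis
      unfolding nf by (subst nn_integral_scale_measure) (simp_all only: loop_laplace_gaussian[OF q])
  qed
  \<comment> \<open>The intensity 1/2 cancels the factor 2 in front of the logarithm, leaving
    exactly the Gaussian transform.\<close>
  also have "(1/2 :: ennreal) * ennreal (- 2 * ln (gaussian_laplace q)) = ennreal (- ln (gaussian_laplace q))"
  proof -
    have half: "(1/2 :: ennreal) = ennreal (1/2)" by (subst divide_ennreal[symmetric]) simp_all
    have "ln (gaussian_laplace q) \<le> 0" using gaussian_laplace_le_1[OF q] gaussian_laplace_pos[OF q] by simp
    then show ?thesis unfolding half by (subst ennreal_mult[symmetric]) simp_all
  qed
  also have "nexp (ennreal (- ln (gaussian_laplace q))) = ennreal (gaussian_laplace q)"
    using gaussian_laplace_le_1[OF q] gaussian_laplace_pos[OF q] by (simp add: nexp_ennreal)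
  finally show ?thesis .
qed

text \<open>\<open>nexp\<close> vanishes on infinite total field, so the probability of finiteness
  is at least the Laplace transform at a constant potential s, which tends to 1 as s decreases to
  0.\<close>

lemma Z_finite: "AE \<omega> in M. \<forall>x. Z x \<omega> < \<top>"
proof -
  let ?S = "\<lambda>\<omega>. \<Sum>x\<in>UNIV. Z x \<omega>"
  let ?B = "{\<omega> \<in> space M. ?S \<omega> < \<top>}"
  have Sm: "?S \<in> borel_measurable M" by (intro borel_measurable_sum measurable_Z)
  then have B: "?B \<in> sets M" by measurable
  define E where "E = (LINT \<omega>|M\<^sub>\<phi>. (\<Sum>z\<in>UNIV. 1 * (\<phi> \<omega> $ z)\<^sup>2) / 2)"
  \<comment> \<open>The inequality exp (- u) \<ge> 1 - u under the Gaussian expectation gives the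
    explicit lower bound; E is half the expected total squared field.\<close>
  have bound: "ennreal (1 - s * E) \<le> emeasure M ?B" if s: "0 < s" for s
  proof -
    have ie: "integrable M\<^sub>\<phi> (\<lambda>\<omega>. s * ((\<Sum>z\<in>UNIV. 1 * (\<phi> \<omega> $ z)\<^sup>2) / 2))"
      by (rule integrable_mult_right) (rule integrable_energy)
    have "1 - s * E = (LINT \<omega>|M\<^sub>\<phi>. 1 - s * ((\<Sum>z\<in>UNIV. 1 * (\<phi> \<omega> $ z)\<^sup>2) / 2))"
      unfolding E_def Bochner_Integration.integral_diff[OF integrable_const ie] integral_mult_right_zero
      by (simp add: prob_space)
    also have "\<dots> \<le> (LINT \<omega>|M\<^sub>\<phi>. weight (\<lambda>_. s) (\<phi> \<omega>))"
    proof (rule integral_mono)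
      show "integrable M\<^sub>\<phi> (\<lambda>\<omega>. 1 - s * ((\<Sum>z\<in>UNIV. 1 * (\<phi> \<omega> $ z)\<^sup>2) / 2))"
        by (rule Bochner_Integration.integrable_diff[OF integrable_const ie])
      show "integrable M\<^sub>\<phi> (\<lambda>\<omega>. weight (\<lambda>_. s) (\<phi> \<omega>))" using s by (intro integrable_weight) simp
      show "1 - s * ((\<Sum>z\<in>UNIV. 1 * (\<phi> \<omega> $ z)\<^sup>2) / 2) \<le> weight (\<lambda>_. s) (\<phi> \<omega>)" for \<omega>
        using exp_ge_add_one_self[of "- (s * ((\<Sum>z\<in>UNIV. 1 * (\<phi> \<omega> $ z)\<^sup>2) / 2))"] weight_scale[of s "\<lambda>_. 1" "\<phi> \<omega>"] by simp
    qed
    also have "\<dots> = gaussian_laplace (\<lambda>_. s)" by (simp add: gaussian_laplace_def)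
    finally have "ennreal (1 - s * E) \<le> ennreal (gaussian_laplace (\<lambda>_. s))" by (rule ennreal_leI)
    also have "\<dots> = (\<integral>\<^sup>+\<omega>. nexp (\<Sum>x\<in>UNIV. ennreal s * Z x \<omega>) \<partial>M)"
      using s by (intro nexp_Z[symmetric]) simp
    also have "\<dots> \<le> (\<integral>\<^sup>+\<omega>. indicator ?B \<omega> \<partial>M)"
    proof (rule nn_integral_mono)
      fix \<omega> assume "\<omega> \<in> space M"
      show "nexp (\<Sum>x\<in>UNIV. ennreal s * Z x \<omega>) \<le> indicator ?B \<omega>"
      proof (cases "?S \<omega> < \<top>")
        case True then show ?thesis using \<open>\<omega> \<in> space M\<close> by (simp add: nexp_le_1)
      next
        case False
        then have S: "?S \<omega> = \<top>" by (simp only: not_less top_unique)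
        have "(\<Sum>x\<in>UNIV. ennreal s * Z x \<omega>) = \<top>"
          unfolding sum_distrib_left[symmetric] S using s by (simp add: ennreal_mult_top)
        then show ?thesis by (simp only: nexp_top zero_le)
      qed
    qed
    also have "\<dots> = emeasure M ?B" using B by simp
    finally show ?thesis .
  qed
  have "ennreal 1 \<le> emeasure M ?B"
  proof (rule LIMSEQ_le_const2)
    have "(\<lambda>n. 1 - inverse (real (Suc n)) * E) \<longlonglongrightarrow> 1 - 0 * E"
      by (intro tendsto_intros LIMSEQ_inverse_real_of_nat)
    then show "(\<lambda>n. ennreal (1 - inverse (real (Suc n)) * E)) \<longlonglongrightarrow> ennreal 1"
      by (intro tendsto_ennrealI) simp
    show "\<exists>N. \<forall>n\<ge>N. ennreal (1 - inverse (real (Suc n)) * E) \<le> emeasure M ?B"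
      by (intro exI[of _ 0] allI impI bound) simp
  qed
  then have "emeasure M ?B = 1" using M.emeasure_le_1[of ?B] by (simp add: antisym)
  then have "AE \<omega> in M. \<omega> \<in> ?B"
    using B by (intro M.AE_prob_1) (simp add: measure_def)
  then show ?thesis
  proof eventually_elim
    case (elim \<omega>)
    show ?case
    proof
      fix x
      have "Z x \<omega> \<le> ?S \<omega>" by (rule member_le_sum) auto
      then show "Z x \<omega> < \<top>" using elim by (auto intro: le_less_trans)
    qed
  qed
qed

theorem ensemble_laplace:
  assumes q: "\<And>x. 0 \<le> q x"
  shows "(LINT \<omega>|M. field_exp q (ens \<omega>)) = gaussian_laplace q"
proof -
  have "(\<integral>\<^sup>+\<omega>. ennreal (field_exp q (ens \<omega>)) \<partial>M) = (\<integral>\<^sup>+\<omega>. nexp (\<Sum>x\<in>UNIV. ennreal (q x) * Z x \<omega>) \<partial>M)"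
  proof (rule nn_integral_cong_AE)
    show "AE \<omega> in M. ennreal (field_exp q (ens \<omega>)) = nexp (\<Sum>x\<in>UNIV. ennreal (q x) * Z x \<omega>)"
      using Z_finite
    proof eventually_elim
      case (elim \<omega>)
      have z: "Z x \<omega> = ennreal (ens \<omega> $ x)" for x
        using elim by (simp add: ensemble_occupation_def)
      have e0: "0 \<le> ens \<omega> $ x" for x by (simp add: ensemble_occupation_def)
      have "(\<Sum>x\<in>UNIV. ennreal (q x) * Z x \<omega>) = ennreal (\<Sum>x\<in>UNIV. q x * ens \<omega> $ x)"
        unfolding z using q e0 by (subst sum_ennreal[symmetric]) (simp_all add: ennreal_mult)
      moreover have "0 \<le> (\<Sum>x\<in>UNIV. q x * ens \<omega> $ x)" using q e0 by (intro sum_nonneg mult_nonneg_nonneg)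
      ultimately show ?case by (simp add: nexp_ennreal field_exp_def)
    qed
  qed
  then have "(\<integral>\<^sup>+\<omega>. ennreal (field_exp q (ens \<omega>)) \<partial>M) = ennreal (gaussian_laplace q)" unfolding nexp_Z[OF q] .
  then show ?thesis
    using gaussian_laplace_pos[OF q] measurable_compose[OF measurable_ens measurable_field_exp]
    by (intro integral_eq_nn_integral[THEN trans]) (auto simp: less_imp_le[OF field_exp_pos])
qed

theorem isomorphism_distr: "distr M borel ens = distr M\<^sub>\<phi> borel (\<lambda>\<omega>. half_square (\<phi> \<omega>))"
proof (rule measure_eqI)
  have hm: "(\<lambda>\<omega>. half_square (\<phi> \<omega>)) \<in> borel_measurable M\<^sub>\<phi>"
    by (rule borel_measurable_vecI) (simp add: half_square_def)
  fix A :: "(real^'x) set" assume "A \<in> sets (distr M borel ens)"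
  then have A: "A \<in> sets borel" by simp
  have "(LINT \<omega>|M. 1 * indicator A (ens \<omega>)) = (LINT \<omega>|M\<^sub>\<phi>. 1 * (indicator A (half_square (\<phi> \<omega>)) :: real))"
  proof (rule laplace_uniqueness[where B = 1])
    fix q :: "'x \<Rightarrow> real" assume q: "\<And>x. 0 \<le> q x"
    show "(LINT \<omega>|M. 1 * field_exp q (ens \<omega>)) = (LINT \<omega>|M\<^sub>\<phi>. 1 * field_exp q (half_square (\<phi> \<omega>)))"
      using ensemble_laplace[OF q] by (simp add: weight_half_square gaussian_laplace_def)
  qed (use A hm in \<open>auto simp: measurable_ens ens_nonneg half_square_nonneg indicator_le_1\<close>)
  then have "measure (distr M borel ens) A = measure (distr M\<^sub>\<phi> borel (\<lambda>\<omega>. half_square (\<phi> \<omega>))) A"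
  proof -
    assume eq: "(LINT \<omega>|M. 1 * indicator A (ens \<omega>)) = (LINT \<omega>|M\<^sub>\<phi>. 1 * (indicator A (half_square (\<phi> \<omega>)) :: real))"
    have "(LINT \<omega>|M. indicator A (ens \<omega>)) = measure (distr M borel ens) A"
      using A integral_distr[OF measurable_ens, of "indicator A :: _ \<Rightarrow> real"] by simp
    moreover have "(LINT \<omega>|M\<^sub>\<phi>. indicator A (half_square (\<phi> \<omega>))) = measure (distr M\<^sub>\<phi> borel (\<lambda>\<omega>. half_square (\<phi> \<omega>))) A"
      using A integral_distr[OF hm, of "indicator A :: _ \<Rightarrow> real"] by simp
    ultimately show ?thesis using eq by simp
  qed
  then show "emeasure (distr M borel ens) A = emeasure (distr M\<^sub>\<phi> borel (\<lambda>\<omega>. half_square (\<phi> \<omega>))) A"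
    using finite_measure.emeasure_eq_measure[OF M.finite_measure_distr[OF measurable_ens]]
      finite_measure.emeasure_eq_measure[OF finite_measure_distr[OF hm]] by simp
qed simp

lemma sets_bridge_measure: "sets (bridge_measure C \<kappa> x y) = sets path_space"
  by (simp only: bridge_measure_def sets_measure_of[OF sets.space_closed] sets.sigma_sets_eq)

text \<open>The case q = 0 of the bridge transform: the total mass is the Green function.\<close>

lemma finite_bridge_measure: "finite_measure (bridge_measure C \<kappa> x y)"
proof
  have "emeasure (bridge_measure C \<kappa> x y) (space (bridge_measure C \<kappa> x y)) = ennreal (W (\<lambda>_. 0) x y)"
    using bridge_laplace[where q = "\<lambda>_. 0" and x = x and y = y] by (simp add: field_exp_def)
  then show "emeasure (bridge_measure C \<kappa> x y) (space (bridge_measure C \<kappa> x y)) \<noteq> \<infinity>" by simp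
qed

text \<open>On the product of bridge measure and loop probability, the summed field has Laplace
  transform \<open>gaussian_laplace q * W q x y\<close>; by \<open>weighted_covariance\<close> this
  is also the transform of the signed Gaussian law.\<close>

theorem isomorphism_bridge:
  assumes F: "F \<in> borel_measurable (restrict_space borel nonneg_fields)" and bd: "bounded (F ` nonneg_fields)"
  shows "(LINT \<omega>|M\<^sub>\<phi>. \<phi> \<omega> $ x * \<phi> \<omega> $ y * F (half_square (\<phi> \<omega>)))
    = (LINT \<gamma>|bridge_measure C \<kappa> x y. LINT \<omega>|M. F (ens \<omega> + occupation C \<kappa> \<gamma>))"
proof -
  let ?B = "bridge_measure C \<kappa> x y"
  let ?Z = "\<lambda>p. ens (snd p) + occupation C \<kappa> (fst p)"
  interpret B: finite_measure ?B by (rule finite_bridge_measure)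
  interpret P: pair_sigma_finite ?B M ..
  interpret BM: finite_measure "?B \<Otimes>\<^sub>M M"
  proof
    have "emeasure (?B \<Otimes>\<^sub>M M) (space (?B \<Otimes>\<^sub>M M)) = emeasure ?B (space ?B) * emeasure M (space M)"
      unfolding space_pair_measure by (rule M.emeasure_pair_measure_Times) auto
    then show "emeasure (?B \<Otimes>\<^sub>M M) (space (?B \<Otimes>\<^sub>M M)) \<noteq> \<infinity>"
      by (simp add: M.emeasure_space_1)
  qed
  have N: "nonneg_fields \<in> sets (borel :: (real^'x) measure)"
  proof -
    have "nonneg_fields = (\<Inter>x\<in>UNIV. {v :: real^'x. 0 \<le> v $ x})" by (auto simp: nonneg_fields_def)
    also have "closed \<dots>" by (intro closed_INT ballI closed_Collect_le continuous_intros)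
    finally show ?thesis by simp
  qed
  \<comment> \<open>F is controlled on \<open>nonneg_fields\<close> only; extension by 0 gives a
    bounded Borel function on the whole space, and all fields involved take values where F' =
    F.\<close>
  define F' where "F' v = (if v \<in> nonneg_fields then F v else 0)" for v
  have F'_meas: "F' \<in> borel_measurable borel"
    unfolding F'_def[abs_def] using F N by (subst measurable_If_restrict_space_iff) auto
  obtain K where K: "\<And>v. v \<in> nonneg_fields \<Longrightarrow> \<bar>F v\<bar> \<le> K" using bd by (auto simp: bounded_iff)
  have F'_bd: "\<bar>F' v\<bar> \<le> \<bar>K\<bar>" for v using K[of v] by (auto simp: F'_def)
  have occ_m: "occupation C \<kappa> \<in> borel_measurable ?B"
    using measurable_occupation by (simp cong: measurable_cong_sets[OF sets_bridge_measure refl])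
  have Z_m: "?Z \<in> borel_measurable (?B \<Otimes>\<^sub>M M)"
    by (intro borel_measurable_add measurable_compose[OF measurable_snd measurable_ens] measurable_compose[OF measurable_fst occ_m])
  have Z_nn: "?Z p \<in> nonneg_fields" for p
    using ens_nonneg[of "snd p"] occupation_nonneg[of "fst p"] by (simp add: nonneg_fields_def)
  have hm: "(\<lambda>\<omega>. half_square (\<phi> \<omega>)) \<in> borel_measurable M\<^sub>\<phi>"
    by (rule borel_measurable_vecI) (simp add: half_square_def)
  \<comment> \<open>The product measure is finite, so bounded integrands are integrable and Fubini
    restores the iterated form of the right-hand side.\<close>
  have split: "(LINT p|(?B \<Otimes>\<^sub>M M). h (?Z p)) = (LINT \<gamma>|?B. LINT \<omega>|M. h (ens \<omega> + occupation C \<kappa> \<gamma>))"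
    if h: "h \<in> borel_measurable borel" "\<And>v. v \<in> nonneg_fields \<Longrightarrow> \<bar>h v\<bar> \<le> K'" for h :: "real^'x \<Rightarrow> real" and K'
  proof -
    have "integrable (?B \<Otimes>\<^sub>M M) (\<lambda>p. h (?Z p))"
      using h(2)[OF Z_nn] by (intro BM.integrable_const_bound[where B = K'] measurable_compose[OF Z_m h(1)]) auto
    from P.integral_fst'[OF this] show ?thesis by simp
  qed
  have "(LINT \<omega>|M\<^sub>\<phi>. (\<phi> \<omega> $ x * \<phi> \<omega> $ y) * F' (half_square (\<phi> \<omega>))) = (LINT p|(?B \<Otimes>\<^sub>M M). 1 * F' (?Z p))"
  proof (rule laplace_uniqueness[OF hm Z_m integrable_product _ half_square_nonneg Z_nn _ F'_meas F'_bd])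
    show "integrable (?B \<Otimes>\<^sub>M M) (\<lambda>_. 1 :: real)" by simp
    fix q :: "'x \<Rightarrow> real" assume q: "\<And>x. 0 \<le> q x"
    have "(LINT p|(?B \<Otimes>\<^sub>M M). 1 * field_exp q (?Z p)) = (LINT \<gamma>|?B. LINT \<omega>|M. field_exp q (ens \<omega> + occupation C \<kappa> \<gamma>))"
      using split[of "field_exp q" 1] field_exp_le_1[where q = q, OF q] field_exp_pos[of q] by (simp add: less_imp_le)
    also have "\<dots> = (LINT \<gamma>|?B. gaussian_laplace q * field_exp q (occupation C \<kappa> \<gamma>))"
      unfolding field_exp_add by (simp add: ensemble_laplace[OF q])
    also have "\<dots> = gaussian_laplace q * (LINT \<gamma>|?B. field_exp q (occupation C \<kappa> \<gamma>))" by simp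
    also have "(LINT \<gamma>|?B. field_exp q (occupation C \<kappa> \<gamma>)) = W q x y"
      using bridge_laplace[where q = q and x = x and y = y, OF q] W_nonneg[where q = q and x = x and y = y, OF q] measurable_compose[OF occ_m measurable_field_exp]
      by (intro integral_eq_nn_integral[THEN trans]) (auto simp: less_imp_le[OF field_exp_pos])
    finally show "(LINT \<omega>|M\<^sub>\<phi>. (\<phi> \<omega> $ x * \<phi> \<omega> $ y) * field_exp q (half_square (\<phi> \<omega>))) = (LINT p|(?B \<Otimes>\<^sub>M M). 1 * field_exp q (?Z p))"
      by (simp add: weight_half_square weighted_covariance[OF q])
  qed
  also have "\<dots> = (LINT \<gamma>|?B. LINT \<omega>|M. F' (ens \<omega> + occupation C \<kappa> \<gamma>))"
    using split[OF F'_meas F'_bd] by simp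
  finally have main: "(LINT \<omega>|M\<^sub>\<phi>. (\<phi> \<omega> $ x * \<phi> \<omega> $ y) * F' (half_square (\<phi> \<omega>)))
    = (LINT \<gamma>|?B. LINT \<omega>|M. F' (ens \<omega> + occupation C \<kappa> \<gamma>))" .
  have e1: "F' (half_square (\<phi> \<omega>)) = F (half_square (\<phi> \<omega>))" for \<omega>
    by (simp add: F'_def half_square_nonneg)
  have e2: "F' (ens \<omega> + occupation C \<kappa> \<gamma>) = F (ens \<omega> + occupation C \<kappa> \<gamma>)" for \<omega> \<gamma>
    using Z_nn[of "(\<gamma>, \<omega>)"] by (simp add: F'_def)
  show ?thesis using main unfolding e1 e2 .
qed

end
end

theorem theorem2:
  fixes C :: "'x::finite \<Rightarrow> 'x \<Rightarrow> real"
    and \<kappa> :: "'x \<Rightarrow> real"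
    and M :: "'w measure" and L :: "'w \<Rightarrow> 'x path measure"
    and M\<^sub>\<phi> :: "'p measure" and \<phi> :: "'p \<Rightarrow> real^'x"
  assumes "\<And>x y. C x y = C y x"
    and "\<And>x y. 0 \<le> C x y"
    and "\<And>x. C x x = 0"
    and "\<And>x y. (\<lambda>u v. 0 < C u v)\<^sup>*\<^sup>* x y"
    and "\<And>x. 0 \<le> \<kappa> x"
    and "\<exists>x. \<kappa> x \<noteq> 0"
    and "poisson_point_process M (scale_measure (1/2) (loop_measure C \<kappa>)) L"
    and "centered_gaussian_vector M\<^sub>\<phi> (green C \<kappa>) \<phi>"
  shows "distr M borel (\<lambda>\<omega>. ensemble_occupation C \<kappa> (L \<omega>))
           = distr M\<^sub>\<phi> borel (\<lambda>\<omega>. half_square (\<phi> \<omega>))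
         \<and>
         (\<forall>x y. \<forall>F :: real^'x \<Rightarrow> real.
           F \<in> borel_measurable (restrict_space borel nonneg_fields) \<longrightarrow>
           bounded (F ` nonneg_fields) \<longrightarrow>
           (LINT \<omega>|M\<^sub>\<phi>. \<phi> \<omega> $ x * \<phi> \<omega> $ y * F (half_square (\<phi> \<omega>)))
             = (LINT \<gamma>|bridge_measure C \<kappa> x y.
                  LINT \<omega>|M. F (ensemble_occupation C \<kappa> (L \<omega>) + occupation C \<kappa> \<gamma>)))"
proof -
  interpret field_network C \<kappa> M\<^sub>\<phi> \<phi>
    by unfold_locales (use assms in auto)
  show ?thesis
    using isomorphism_distr[OF assms(7)] isomorphism_bridge[OF assms(7)] by blast
qed

end
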